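(* Let $a=\{a_n\}_{n\in\mathbb{N}}$ be a complex sequence with $\sum_{n=1}^\infty |a_n|<\infty$, and define for $x>0$ $$f(x)=\sum_{n=1}^\infty a_n\left[J^2_{in/2}(x)+Y^2_{in/2}(x)\right].$$ For $x>0$ and $n\in\mathbb{N}$ let $$\Phi_n(x)=x\int_0^\pi J_0(2x\cosh u)\,\sinh(2u)\,\sin(nu)\,du.$$ Then for every $n\in\mathbb{N}$, $$a_n=\sinh\left(\frac{\pi n}{2}\right)\int_0^\infty \Phi_n(x)f(x)\,dx,$$ where the integral converges in the improper sense, i.e. as $\lim_{T\to\infty}\int_0^T$.
   Context: $J_\nu$ and $Y_\nu$ denote the Bessel functions of the first and second kind of (complex) order $\nu$; here the orders $in/2$ are purely imaginary, $i$ being the imaginary unit. *)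

theory Defs
  imports "HOL-Analysis.Analysis"
begin

text \<open>Bessel function of the first kind of complex order nu, at a positive real argument x,
  via its power series  J_nu(x) = sum_k (-1)^k / (k! Gamma(k+nu+1)) (x/2)^(2k+nu),
  with 1/Gamma written as rGamma (entire), and (x/2)^s = exp(s ln(x/2)).\<close>
definition besselJ :: "complex \<Rightarrow> real \<Rightarrow> complex" where
  "besselJ \<nu> x = (\<Sum>k. (-1) ^ k * rGamma (of_nat k + \<nu> + 1) / of_nat (fact k)
                        * (complex_of_real (x / 2)) powr (of_nat (2 * k) + \<nu>))"

text \<open>Bessel function of the second kind for non-integer order nu:
  Y_nu(x) = (J_nu(x) cos(nu pi) - J_{-nu}(x)) / sin(nu pi).\<close>
definition besselY :: "complex \<Rightarrow> real \<Rightarrow> complex" where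
  "besselY \<nu> x = (besselJ \<nu> x * cos (\<nu> * of_real pi) - besselJ (- \<nu>) x) / sin (\<nu> * of_real pi)"

definition kl_f :: "(nat \<Rightarrow> complex) \<Rightarrow> real \<Rightarrow> complex" where
  "kl_f a x = (\<Sum>m. let n = Suc m; \<nu> = \<i> * of_nat n / 2 in
                  a n * ((besselJ \<nu> x)\<^sup>2 + (besselY \<nu> x)\<^sup>2))"

definition kl_Phi :: "nat \<Rightarrow> real \<Rightarrow> complex" where
  "kl_Phi n x = of_real x * integral {0..pi}
      (\<lambda>u. besselJ 0 (2 * x * cosh u) * of_real (sinh (2 * u) * sin (real n * u)))"

end

theory Submission
  imports Defs "HOL-Real_Asymp.Real_Asymp"
begin

text \<open>
  Nicholson's formula
  \<open>J\<^sub>\<nu>\<^sup>2 + Y\<^sub>\<nu>\<^sup>2 = 8/\<pi>\<^sup>2 \<integral>\<^sub>0\<^sup>\<infinity> K\<^sub>0(2x sinh t) cos (n t) dt\<close>, \<open>\<nu> = in/2\<close>, bounds these functions by \<open>C/x\<close>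
  uniformly in \<open>n\<close>, while \<open>|\<Phi>\<^sub>m(x)| \<le> C min(x, x\<^sup>-\<^sup>1\<^sup>/\<^sup>2)\<close>; hence the series may be integrated termwise and the claim reduces to a
  biorthogonality relation. There Fubini's theorem,
  \<open>\<integral>\<^sub>0\<^sup>\<infinity> x J\<^sub>0(bx) K\<^sub>0(ax) dx = 1/(a\<^sup>2 + b\<^sup>2)\<close> and
  \<open>\<integral>\<^sub>0\<^sup>\<infinity> cos (n t) sinh (2u) / (cosh (2t) + cosh (2u)) dt = \<pi>/2 sin (n u) / sinh (\<pi> n/2)\<close>
  leave the orthogonality of the functions \<open>sin (n u)\<close> on \<open>[0, \<pi>]\<close>.

  Nicholson's formula itself is proved by comparing two solutions of the third-order equation
  \<open>\<theta>(\<theta>\<^sup>2 + n\<^sup>2)w + 4x\<^sup>2(\<theta> + 1)w = 0\<close>, \<open>\<theta> = x d/dx\<close>: both sides satisfy it and have the same behaviour at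
  \<open>0\<close>, and a quadratic energy of their difference, vanishing at \<open>0\<close>, grows at most like
  \<open>exp (C x\<^sup>2)\<close> times its initial value.
\<close>

section \<open>Integration on the half-line\<close>

text \<open>Everything is arranged for absolute convergence: a function of size min(x, x^(-1/2))
  times C/x is integrable at both ends, so the improper integral of the claim is a Lebesgue integral
  and every interchange is Fubini or dominated convergence. The obstacle is Nicholson's formula. The
  origin is a singular point of the third-order equation, with exponents 0, iy and -iy; all
  solutions built from them stay bounded there, and both sides oscillate like powers (x/2)^(iy)
  without having a limit. Uniqueness therefore needs the exact leading terms, for the functions and
  for their first two images under \<theta>. On the Bessel side they come from the power series,
  with reciprocal Gamma values. On the integral side the oscillating term arises from replacing 2 x
  sinh t by x exp t, which produces Gamma(1 + iy/2)^2, while the constant term is a sine integral of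
  coth t - 1, evaluated through a functional equation under halving of y. The reflection formula for
  Gamma makes the two descriptions meet.\<close>

definition hl :: "real measure" where "hl = restrict_space lborel {0<..}"

lemma space_hl [simp]: "space hl = {0<..}"
  by (simp add: hl_def space_restrict_space)

lemma borel_measurable_hl:
  "f \<in> borel_measurable borel \<Longrightarrow> f \<in> borel_measurable hl"
  unfolding hl_def by (intro measurable_restrict_space1) simp

lemma measurable_hl_id: "(\<lambda>x. x) \<in> measurable hl borel"
  unfolding hl_def by (intro measurable_restrict_space1) simp

text \<open>For the Fubini steps, joint measurability is checked on the whole plane, where
  \<open>measurable\<close> decides it, and pulled back along the inclusion.\<close>

lemma borel_measurable_pair_subspace:
  assumes N: "(\<lambda>x. x) \<in> measurable N1 borel" "(\<lambda>x. x) \<in> measurable N2 borel"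
    and f: "f \<in> borel_measurable (borel \<Otimes>\<^sub>M borel)"
  shows "f \<in> borel_measurable (N1 \<Otimes>\<^sub>M N2)"
proof -
  have "(\<lambda>p. (fst p, snd p)) \<in> measurable (N1 \<Otimes>\<^sub>M N2) (borel \<Otimes>\<^sub>M borel)"
    using N by (intro measurable_Pair measurable_compose[OF measurable_fst] measurable_compose[OF measurable_snd])
  from measurable_compose[OF this f] show ?thesis by simp
qed

lemma borel_measurable_hl_pair:
  "f \<in> borel_measurable (borel \<Otimes>\<^sub>M borel) \<Longrightarrow> f \<in> borel_measurable (hl \<Otimes>\<^sub>M hl)"
  by (rule borel_measurable_pair_subspace[OF measurable_hl_id measurable_hl_id])

lemma borel_measurable_cosh_sinh [measurable (raw)]:
  fixes f :: "'a \<Rightarrow> real"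
  assumes "f \<in> borel_measurable M"
  shows "(\<lambda>x. cosh (f x)) \<in> borel_measurable M" and "(\<lambda>x. sinh (f x)) \<in> borel_measurable M"
  using assms unfolding cosh_def sinh_def by measurable

lemma borel_measurable_hl_continuous:
  "continuous_on {0<..} f \<Longrightarrow> f \<in> borel_measurable hl"
  unfolding hl_def measurable_cong_sets[OF sets_restrict_space_cong[OF sets_lborel] refl]
  by (rule borel_measurable_continuous_on_restrict)

lemma integrable_hl_iff:
  fixes f :: "real \<Rightarrow> 'b::{banach, second_countable_topology}"
  shows "integrable hl f \<longleftrightarrow> set_integrable lborel {0<..} f"
  unfolding hl_def set_integrable_def by (rule integrable_restrict_space) simp

lemma integral_hl_eq:
  fixes f :: "real \<Rightarrow> 'b::{banach, second_countable_topology}"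
  shows "integral\<^sup>L hl f = set_lebesgue_integral lborel {0<..} f"
  unfolding hl_def set_lebesgue_integral_def by (rule integral_restrict_space) simp

interpretation hl: sigma_finite_measure hl
  unfolding hl_def by (intro sigma_finite_measure_restrict_space) (auto simp: sigma_finite_lborel)

interpretation hl_pair: pair_sigma_finite hl hl ..

text \<open>The form in which all integrations by parts on the half-line are done: \<open>f\<close>
  is the sum of the two integrands, \<open>F\<close> the boundary term, and only its limits at 0 and
  infinity matter.\<close>

lemma integral_hl_FTC:
  fixes f F :: "real \<Rightarrow> real"
  assumes F: "\<And>x. x > 0 \<Longrightarrow> (F has_real_derivative f x) (at x)"
    and f: "continuous_on {0<..} f" and int: "integrable hl f"
    and A: "(F \<longlongrightarrow> A) (at_right 0)" and B: "(F \<longlongrightarrow> B) at_top"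
  shows "integral\<^sup>L hl f = B - A"
proof -
  have "(LBINT x=0..\<infinity>. f x) = B - A"
  proof (rule interval_integral_FTC_integrable)
    show "((F \<circ> real_of_ereal) \<longlongrightarrow> A) (at_right 0)"
      using A by (simp add: ereal_tendsto_simps zero_ereal_def)
    show "((F \<circ> real_of_ereal) \<longlongrightarrow> B) (at_left \<infinity>)"
      using B by (simp add: ereal_tendsto_simps)
    show "set_integrable lborel (einterval 0 \<infinity>) f"
      using int by (simp add: integrable_hl_iff einterval_def greaterThan_def zero_ereal_def)
    show "isCont f x" if "0 < ereal x" for x
      using f that by (simp add: continuous_on_eq_continuous_at zero_ereal_def)
  qed (use F in \<open>auto simp: zero_ereal_def has_real_derivative_iff_has_vector_derivative\<close>)
  then show ?thesis
    by (simp add: interval_lebesgue_integral_def integral_hl_eq einterval_def greaterThan_def zero_ereal_def)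
qed

lemma integrable_hl_FTC_nonneg:
  fixes f F :: "real \<Rightarrow> real"
  assumes F: "\<And>x. x > 0 \<Longrightarrow> (F has_real_derivative f x) (at x)"
    and f: "continuous_on {0<..} f" and nn: "\<And>x. x > 0 \<Longrightarrow> f x \<ge> 0"
    and A: "(F \<longlongrightarrow> A) (at_right 0)" and B: "(F \<longlongrightarrow> B) at_top"
  shows "integrable hl f"
proof -
  have "set_integrable lborel (einterval 0 \<infinity>) f"
  proof (rule interval_integral_FTC_nonneg)
    show "((F \<circ> real_of_ereal) \<longlongrightarrow> A) (at_right 0)"
      using A by (simp add: ereal_tendsto_simps zero_ereal_def)
    show "((F \<circ> real_of_ereal) \<longlongrightarrow> B) (at_left \<infinity>)"
      using B by (simp add: ereal_tendsto_simps)
    show "isCont f x" if "0 < ereal x" for x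
      using f that by (simp add: continuous_on_eq_continuous_at zero_ereal_def)
  qed (use F nn in \<open>auto simp: zero_ereal_def\<close>)
  then show ?thesis
    by (simp add: integrable_hl_iff einterval_def greaterThan_def zero_ereal_def)
qed

text \<open>Dominated convergence for difference quotients along an arbitrary null sequence.\<close>

lemma leibniz_dominated:
  fixes f :: "real \<Rightarrow> 'a \<Rightarrow> real"
  assumes e: "e > 0"
    and int: "\<And>x. \<bar>x - x0\<bar> < e \<Longrightarrow> integrable M (f x)"
    and der: "\<And>x t. \<bar>x - x0\<bar> < e \<Longrightarrow> t \<in> space M \<Longrightarrow> ((\<lambda>x. f x t) has_real_derivative f' x t) (at x)"
    and bound: "\<And>x t. \<bar>x - x0\<bar> < e \<Longrightarrow> t \<in> space M \<Longrightarrow> \<bar>f' x t\<bar> \<le> g t"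
    and g: "integrable M g"
    and meas: "f' x0 \<in> borel_measurable M"
  shows "((\<lambda>x. \<integral>t. f x t \<partial>M) has_real_derivative (\<integral>t. f' x0 t \<partial>M)) (at x0)"
proof -
  have "((\<lambda>h. ((\<integral>t. f (x0 + h) t \<partial>M) - (\<integral>t. f x0 t \<partial>M)) / h) \<longlongrightarrow> (\<integral>t. f' x0 t \<partial>M)) (at 0 within {-e<..<e})"
  proof (subst tendsto_at_iff_sequentially, intro allI impI)
    fix X :: "nat \<Rightarrow> real" assume X: "\<forall>i. X i \<in> {- e<..<e} - {0}" and lim: "X \<longlonglongrightarrow> 0"
    have Xe: "\<bar>X i\<bar> < e" "X i \<noteq> 0" for i using X[rule_format, of i] by auto
    have lim': "filterlim X (at 0) sequentially"
      using lim Xe by (auto simp: filterlim_at)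
    have eq: "((\<integral>t. f (x0 + X i) t \<partial>M) - (\<integral>t. f x0 t \<partial>M)) / X i = (\<integral>t. (f (x0 + X i) t - f x0 t) / X i \<partial>M)" for i
      using int[of "x0 + X i"] int[of x0] Xe[of i] e by (simp add: Bochner_Integration.integral_diff)
    have "(\<lambda>i. \<integral>t. (f (x0 + X i) t - f x0 t) / X i \<partial>M) \<longlonglongrightarrow> (\<integral>t. f' x0 t \<partial>M)"
    proof (rule integral_dominated_convergence[where w = g])
      show "(\<lambda>t. (f (x0 + X i) t - f x0 t) / X i) \<in> borel_measurable M" for i
        using int[of "x0 + X i"] int[of x0] Xe[of i] e by auto
      show "AE t in M. (\<lambda>i. (f (x0 + X i) t - f x0 t) / X i) \<longlonglongrightarrow> f' x0 t"
      proof (rule AE_I2)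
        fix t assume "t \<in> space M"
        from der[OF _ this, of x0] e have "((\<lambda>h. (f (x0 + h) t - f x0 t) / h) \<longlongrightarrow> f' x0 t) (at 0)"
          by (simp add: DERIV_def)
        from filterlim_compose[OF this lim'] show "(\<lambda>i. (f (x0 + X i) t - f x0 t) / X i) \<longlonglongrightarrow> f' x0 t" .
      qed
      show "AE t in M. norm ((f (x0 + X i) t - f x0 t) / X i) \<le> g t" for i
      proof (rule AE_I2)
        fix t assume t: "t \<in> space M"
        have in_ball: "\<bar>z - x0\<bar> < e" if "z \<in> ball x0 e" for z
          using that by (simp add: dist_real_def abs_minus_commute)
        \<comment> \<open>The mean value inequality on the ball turns the bound \<open>g\<close> on
          the derivative into a majorant of the difference quotients.\<close>
        have "norm (f (x0 + X i) t - f x0 t) \<le> g t * norm (x0 + X i - x0)"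
        proof (rule field_differentiable_bound[of "ball x0 e" "\<lambda>x. f x t" "\<lambda>x. f' x t"])
          show "((\<lambda>x. f x t) has_field_derivative f' z t) (at z within ball x0 e)" if "z \<in> ball x0 e" for z
            by (rule has_field_derivative_at_within, rule der, rule in_ball[OF that], rule t)
          show "norm (f' z t) \<le> g t" if "z \<in> ball x0 e" for z
            using bound[OF in_ball[OF that] t] by simp
          show "x0 + X i \<in> ball x0 e" "x0 \<in> ball x0 e" using Xe(1)[of i] e by (simp_all add: dist_real_def)
        qed simp
        then show "norm ((f (x0 + X i) t - f x0 t) / X i) \<le> g t"
          using Xe(2)[of i] by (simp add: norm_divide pos_divide_le_eq)
      qed
    qed (use g meas in auto)
    then show "((\<lambda>h. ((\<integral>t. f (x0 + h) t \<partial>M) - (\<integral>t. f x0 t \<partial>M)) / h) \<circ> X) \<longlonglongrightarrow> (\<integral>t. f' x0 t \<partial>M)"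
      by (simp add: o_def eq)
  qed
  then show ?thesis
    using e by (simp add: DERIV_def at_within_open[of 0 "{-e<..<e}"])
qed

lemma integrable_hl_exp:
  assumes "(c::real) > 0"
  shows "integrable hl (\<lambda>s. exp (- c * s))" and "integral\<^sup>L hl (\<lambda>s. exp (- c * s)) = 1 / c"
proof -
  let ?F = "\<lambda>s. - exp (- c * s) / c"
  have F: "(?F has_real_derivative exp (- c * s)) (at s)" for s
    using assms by (auto intro!: derivative_eq_intros)
  have A: "(?F \<longlongrightarrow> - 1 / c) (at_right 0)"
    using assms by (auto intro!: tendsto_eq_intros)
  have "filterlim (\<lambda>s. c * s) at_top at_top"
    using assms by (intro filterlim_tendsto_pos_mult_at_top[OF tendsto_const _ filterlim_ident]) auto
  then have "((\<lambda>s. exp (- (c * s))) \<longlongrightarrow> 0) at_top"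
    by (intro filterlim_compose[OF exp_at_bot] filterlim_compose[OF filterlim_uminus_at_bot_at_top])
  from tendsto_mult_left[OF this, of "- 1 / c"] have B: "(?F \<longlongrightarrow> 0) at_top"
    by simp
  have c: "continuous_on {0<..} (\<lambda>s. exp (- c * s))" by (intro continuous_intros)
  show "integrable hl (\<lambda>s. exp (- c * s))"
    by (rule integrable_hl_FTC_nonneg[OF F c _ A B]) auto
  from integral_hl_FTC[OF F c this A B]
  show "integral\<^sup>L hl (\<lambda>s. exp (- c * s)) = 1 / c" by simp
qed

section \<open>The functions \<open>K\<^sub>0(z)\<close> and \<open>z K\<^sub>1(z)\<close>\<close>

text \<open>\<open>zK1 z\<close> stands for \<open>z K\<^sub>1(z)\<close>, and \<open>z2K0 z\<close> below for \<open>z\<^sup>2 K\<^sub>0(z)\<close>. For \<open>z \<le> 0\<close> the integrals diverge and have the junk value \<open>0\<close>.\<close>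

definition K0 :: "real \<Rightarrow> real" where
  "K0 z = (\<integral>s. exp (- z * cosh s) \<partial>hl)"

definition zK1 :: "real \<Rightarrow> real" where
  "zK1 z = (\<integral>s. z * cosh s * exp (- z * cosh s) \<partial>hl)"

lemma cosh_ge_half_exp: "cosh (s::real) \<ge> exp s / 2"
  by (simp add: cosh_def)

lemma power4_le_exp:
  fixes y :: real
  assumes "y \<ge> 0"
  shows "y ^ 4 \<le> 24 * exp y"
proof -
  have "(\<Sum>n\<in>{4}. y ^ n /\<^sub>R fact n) \<le> (\<Sum>n. y ^ n /\<^sub>R fact n)"
    using assms by (intro sum_le_suminf summable_exp_generic) auto
  then show ?thesis by (simp add: exp_def fact_numeral field_simps)
qed

text \<open>One power more of \<open>z * cosh s\<close> than needed is absorbed by the exponential,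
  which leaves 1 / cosh s and hence the decay exp(-s). The cube dominates every power of cosh that
  differentiation in z brings down below.\<close>

lemma cosh_cube_exp_le:
  fixes z s :: real
  assumes "z > 0"
  shows "cosh s ^ 3 * exp (- z * cosh s) \<le> 48 / z ^ 4 * exp (- s)"
proof -
  have c: "cosh s > 0" by simp
  have "(z * cosh s) ^ 4 \<le> 24 * exp (z * cosh s)"
    using assms by (intro power4_le_exp) auto
  then have "cosh s ^ 3 * exp (- z * cosh s) * cosh s \<le> 24 / z ^ 4"
    using assms by (simp add: exp_minus field_simps power_mult_distrib power_numeral_reduce)
  then have "cosh s ^ 3 * exp (- z * cosh s) \<le> 24 / z ^ 4 * (1 / cosh s)"
    using pos_le_divide_eq[OF c, of "cosh s ^ 3 * exp (- z * cosh s)" "24 / z ^ 4"] by simp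
  also have "1 / cosh s \<le> 2 * exp (- s)"
    using cosh_ge_half_exp[of s] c by (simp add: exp_minus field_simps)
  finally show ?thesis using assms by (simp add: mult_left_mono field_simps)
qed

lemma integrable_cosh_cube_exp:
  assumes "(z::real) > 0"
  shows "integrable hl (\<lambda>s. cosh s ^ 3 * exp (- z * cosh s))"
proof (rule Bochner_Integration.integrable_bound)
  show "integrable hl (\<lambda>s. 48 / z ^ 4 * exp (- s))"
    using integrable_hl_exp(1)[of 1] by simp
  show "AE s in hl. norm (cosh s ^ 3 * exp (- z * cosh s)) \<le> norm (48 / z ^ 4 * exp (- s))"
    using cosh_cube_exp_le[OF assms] by (intro AE_I2) (simp add: abs_mult)
qed (intro borel_measurable_hl_continuous continuous_intros)

lemma integrable_cosh_power_exp:
  assumes "(z::real) > 0" "k \<le> 3"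
  shows "integrable hl (\<lambda>s. cosh s ^ k * exp (- z * cosh s))"
proof (rule Bochner_Integration.integrable_bound[OF integrable_cosh_cube_exp[OF assms(1)]])
  show "AE s in hl. norm (cosh s ^ k * exp (- z * cosh s)) \<le> norm (cosh s ^ 3 * exp (- z * cosh s))"
    using assms(2) by (intro AE_I2) (auto simp: abs_mult intro!: mult_right_mono power_increasing cosh_real_ge_1)
qed (intro borel_measurable_hl_continuous continuous_intros)

lemma integrable_K0_integrand: "z > 0 \<Longrightarrow> integrable hl (\<lambda>s. exp (- z * cosh s))"
  using integrable_cosh_power_exp[of z 0] by simp

lemma integrable_zK1_integrand: "z > 0 \<Longrightarrow> integrable hl (\<lambda>s. z * cosh s * exp (- z * cosh s))"
  using integrable_cosh_power_exp[of z 1] by (simp add: mult.assoc)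

lemma borel_measurable_K0 [measurable]: "K0 \<in> borel_measurable borel"
  unfolding K0_def by (intro hl.borel_measurable_lebesgue_integral borel_measurable_pair_subspace[OF _ measurable_hl_id]) measurable

lemma K0_nonneg: "K0 z \<ge> 0"
  unfolding K0_def by simp

lemma K0_antimono: "0 < y \<Longrightarrow> y \<le> z \<Longrightarrow> K0 z \<le> K0 y"
  unfolding K0_def by (intro integral_mono integrable_K0_integrand) auto

text \<open>With sinh in place of cosh the integrand is an exact derivative with integral exp(-z).
  The remainder cosh s - sinh s = exp(-s) costs at most z exp(-z).\<close>

lemma zK1_ge_exp_and_le:
  assumes "z > 0"
  shows "exp (- z) \<le> zK1 z" and "zK1 z \<le> (1 + z) * exp (- z)"
proof -
  let ?F = "\<lambda>s. - exp (- z * cosh s)"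
  have lim: "filterlim (\<lambda>s. z * cosh s) at_top at_top"
  proof (rule filterlim_tendsto_pos_mult_at_top[OF tendsto_const assms])
    show "filterlim (cosh :: real \<Rightarrow> real) at_top at_top" by (rule cosh_real_at_top)
  qed
  have "((\<lambda>s. exp (- (z * cosh s))) \<longlongrightarrow> 0) at_top"
    by (intro filterlim_compose[OF exp_at_bot] filterlim_compose[OF filterlim_uminus_at_bot_at_top lim])
  from tendsto_minus[OF this] have B: "(?F \<longlongrightarrow> 0) at_top" by simp
  have A: "(?F \<longlongrightarrow> - exp (- z)) (at_right 0)"
    by (auto intro!: tendsto_eq_intros)
  have F: "(?F has_real_derivative z * sinh s * exp (- z * cosh s)) (at s)" for s
    by (auto intro!: derivative_eq_intros)
  have c: "continuous_on {0<..} (\<lambda>s. z * sinh s * exp (- z * cosh s))" by (intro continuous_intros)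
  have int: "integrable hl (\<lambda>s. z * sinh s * exp (- z * cosh s))"
    by (rule integrable_hl_FTC_nonneg[OF F c _ A B]) (use assms in auto)
  have eq: "(\<integral>s. z * sinh s * exp (- z * cosh s) \<partial>hl) = exp (- z)"
    using integral_hl_FTC[OF F c int A B] by simp
  have "exp (- z) \<le> zK1 z"
    unfolding zK1_def eq[symmetric] using assms
    by (intro integral_mono int integrable_zK1_integrand) (auto intro!: mult_mono simp: sinh_def cosh_def)
  moreover have "zK1 z \<le> (\<integral>s. z * sinh s * exp (- z * cosh s) + z * exp (- z) * exp (- 1 * s) \<partial>hl)"
    unfolding zK1_def
  proof (intro integral_mono integrable_zK1_integrand assms Bochner_Integration.integrable_add int)
    show "integrable hl (\<lambda>s. z * exp (- z) * exp (- 1 * s))"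
      using integrable_hl_exp(1)[of 1] by (intro integrable_mult_right) auto
    fix s assume "s \<in> space hl"
    have "z * exp (- s) * exp (- z * cosh s) \<le> z * exp (- s) * exp (- z)"
      using assms cosh_real_ge_1[of s] by (intro mult_left_mono) auto
    moreover have "cosh s = sinh s + exp (- s)" by (simp add: sinh_def cosh_def field_simps)
    then have "z * cosh s * exp (- z * cosh s) = z * sinh s * exp (- z * cosh s) + z * exp (- s) * exp (- z * cosh s)"
      by (metis (no_types, opaque_lifting) distrib_left distrib_right)
    ultimately show "z * cosh s * exp (- z * cosh s) \<le> z * sinh s * exp (- z * cosh s) + z * exp (- z) * exp (- 1 * s)"
      by (simp add: mult_ac)
  qed
  moreover have "\<dots> = exp (- z) + z * exp (- z)"
    using integrable_hl_exp[of 1] int eq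
    by (subst Bochner_Integration.integral_add) (auto intro!: integrable_mult_right)
  ultimately show "exp (- z) \<le> zK1 z" "zK1 z \<le> (1 + z) * exp (- z)" by (simp_all add: distrib_right)
qed

lemma zK1_pos: "z > 0 \<Longrightarrow> zK1 z > 0"
  using zK1_ge_exp_and_le(1)[of z] by (simp add: less_le_trans[of 0 "exp (- z)"])

lemma zK1_le_exp: assumes "z > 0" shows "zK1 z \<le> 2 * exp (- z / 2)"
proof -
  have "zK1 z \<le> (1 + z) * exp (- z)" by (rule zK1_ge_exp_and_le(2)[OF assms])
  also have "exp (- z) = exp (- z / 2) * exp (- z / 2)" by (simp flip: exp_add)
  also have "(1 + z) * (exp (- z / 2) * exp (- z / 2)) \<le> 2 * exp (- z / 2)"
  proof -
    have "1 + z \<le> 2 * exp (z / 2)" using exp_ge_add_one_self[of "z / 2"] by linarith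
    then have "(1 + z) * exp (- z / 2) \<le> 2" by (simp add: exp_minus field_simps)
    then show ?thesis by (simp add: mult_right_mono flip: mult.assoc)
  qed
  finally show ?thesis .
qed

lemma zK1_le_1: assumes "z > 0" shows "zK1 z \<le> 1"
proof -
  have "(1 + z) * exp (- z) \<le> 1"
    using exp_ge_add_one_self[of z] by (simp add: exp_minus field_simps)
  with zK1_ge_exp_and_le(2)[OF assms] show ?thesis by simp
qed

lemma zK1_ge: assumes "z > 0" shows "1 - zK1 z \<le> z"
  using zK1_ge_exp_and_le(1)[OF assms] exp_ge_add_one_self[of "-z"] by simp

lemma K0_le_zK1: assumes "z > 0" shows "z * K0 z \<le> zK1 z"
proof -
  have "z * K0 z = (\<integral>s. z * exp (- z * cosh s) \<partial>hl)" unfolding K0_def by simp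
  also have "\<dots> \<le> zK1 z" unfolding zK1_def
    using assms integrable_K0_integrand[OF assms]
    by (intro integral_mono integrable_zK1_integrand integrable_mult_right) (auto intro!: mult_left_mono simp: cosh_real_ge_1)
  finally show ?thesis .
qed

text \<open>A crude substitute for the logarithmic singularity at 0, sufficient for boundary terms
  in which \<open>K0\<close> is multiplied by a factor of order z. It rests on sqrt y \<le> exp y
  with y = z cosh s.\<close>

lemma K0_le_sqrt: assumes "z > 0" shows "K0 z \<le> 4 / sqrt z"
proof -
  have "K0 z \<le> (\<integral>s. 2 / sqrt z * exp (- (1/2) * s) \<partial>hl)"
    unfolding K0_def
  proof (intro integral_mono integrable_K0_integrand assms)
    show "integrable hl (\<lambda>s. 2 / sqrt z * exp (- (1/2) * s))"
      using integrable_hl_exp(1)[of "1/2"] by (intro integrable_mult_right) auto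
    fix s :: real
    define y where "y = z * cosh s"
    have y: "y > 0" using assms by (simp add: y_def)
    have "y \<le> (exp y)\<^sup>2"
    proof -
      have "y \<le> exp y" using exp_ge_add_one_self[of y] by linarith
      also have "exp y * 1 \<le> exp y * exp y" using y by (intro mult_left_mono) auto
      finally show ?thesis by (simp add: power2_eq_square)
    qed
    then have "sqrt y \<le> exp y" by (rule real_le_lsqrt[rotated -1]) (use y in auto)
    then have "exp (- y) \<le> 1 / sqrt y" using y by (simp add: exp_minus field_simps)
    also have "\<dots> = 1 / sqrt z * (1 / sqrt (cosh s))" by (simp add: y_def real_sqrt_mult)
    also have "1 / sqrt (cosh s) \<le> 2 * exp (- (1/2) * s)"
    proof -
      have "(exp (s/2) / 2)\<^sup>2 \<le> cosh s"
      proof -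
        have "(exp (s/2))\<^sup>2 = exp s" by (simp add: power2_eq_square flip: exp_add)
        then show ?thesis using cosh_ge_half_exp[of s] cosh_real_nonneg[of s]
            unfolding power_divide by (simp del: cosh_real_nonneg cosh_real_pos)
      qed
      then have "exp (s/2) / 2 \<le> sqrt (cosh s)" by (rule real_le_rsqrt)
      then show ?thesis by (simp add: exp_minus field_simps)
    qed
    finally show "exp (- z * cosh s) \<le> 2 / sqrt z * exp (- (1/2) * s)"
      using assms by (simp add: y_def mult_left_mono field_simps)
  qed
  also have "\<dots> = 4 / sqrt z"
    using integrable_hl_exp(2)[of "1/2"] by simp
  finally show ?thesis .
qed

lemma K0_deriv:
  assumes z: "z > 0"
  shows "(K0 has_real_derivative - zK1 z / z) (at z)"
proof -
  have "((\<lambda>x. \<integral>s. exp (- x * cosh s) \<partial>hl) has_real_derivative (\<integral>s. - cosh s * exp (- z * cosh s) \<partial>hl)) (at z)"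
  proof (rule leibniz_dominated[where e = "z / 2" and f' = "\<lambda>x s. - cosh s * exp (- x * cosh s)" and g = "\<lambda>s. cosh s ^ 3 * exp (- (z / 2) * cosh s)"])
    show "integrable hl (\<lambda>s. exp (- x * cosh s))" if "\<bar>x - z\<bar> < z / 2" for x
      using that z by (intro integrable_K0_integrand) linarith
    show "\<bar>- cosh s * exp (- x * cosh s)\<bar> \<le> cosh s ^ 3 * exp (- (z / 2) * cosh s)" if "\<bar>x - z\<bar> < z / 2" for x s
    proof -
      have "x \<ge> z / 2" using that by linarith
      then show ?thesis
        using power_increasing[of 1 3 "cosh s"] cosh_real_ge_1[of s]
        by (auto simp: abs_mult intro!: mult_mono)
    qed
    show "(\<lambda>s. - cosh s * exp (- z * cosh s)) \<in> borel_measurable hl" by (rule borel_measurable_hl) measurable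
    show "integrable hl (\<lambda>s. cosh s ^ 3 * exp (- (z / 2) * cosh s))"
      using z by (intro integrable_cosh_cube_exp) auto
  qed (use z in \<open>auto intro!: derivative_eq_intros\<close>)
  moreover have "(\<integral>s. - cosh s * exp (- z * cosh s) \<partial>hl) = - zK1 z / z"
    using z by (simp add: zK1_def mult.assoc)
  ultimately show ?thesis unfolding K0_def by simp
qed

lemma zK1_deriv:
  assumes z: "z > 0"
  shows "(zK1 has_real_derivative - z * K0 z) (at z)"
proof -
  let ?f' = "\<lambda>x s. (cosh s - x * cosh s ^ 2) * exp (- x * cosh s)"
  have "((\<lambda>x. \<integral>s. x * cosh s * exp (- x * cosh s) \<partial>hl) has_real_derivative (\<integral>s. ?f' z s \<partial>hl)) (at z)"
  proof (rule leibniz_dominated[where e = "z / 2" and f' = ?f' and g = "\<lambda>s. (1 + 2 * z) * (cosh s ^ 3 * exp (- (z / 2) * cosh s))"])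
    show "integrable hl (\<lambda>s. x * cosh s * exp (- x * cosh s))" if "\<bar>x - z\<bar> < z / 2" for x
      using that z by (intro integrable_zK1_integrand) linarith
    show "\<bar>?f' x s\<bar> \<le> (1 + 2 * z) * (cosh s ^ 3 * exp (- (z / 2) * cosh s))" if "\<bar>x - z\<bar> < z / 2" for x s
    proof -
      have x: "x \<ge> z / 2" "x \<le> 2 * z" using that z by linarith+
      have "\<bar>cosh s - x * cosh s ^ 2\<bar> \<le> cosh s + x * cosh s ^ 2"
        using x z cosh_real_ge_1[of s] by (intro order_trans[OF abs_triangle_ineq4]) auto
      also have "\<dots> \<le> cosh s ^ 3 + (2 * z) * cosh s ^ 3"
        using x z power_increasing[of 1 3 "cosh s"] power_increasing[of 2 3 "cosh s"] cosh_real_ge_1[of s]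
        by (intro add_mono mult_mono) auto
      finally have "\<bar>cosh s - x * cosh s ^ 2\<bar> * exp (- x * cosh s) \<le> ((1 + 2 * z) * cosh s ^ 3) * exp (- (z / 2) * cosh s)"
        using x cosh_real_ge_1[of s] z by (intro mult_mono) (auto simp: algebra_simps)
      then show ?thesis by (simp add: abs_mult mult.assoc)
    qed
    show "(\<lambda>s. ?f' z s) \<in> borel_measurable hl" by (rule borel_measurable_hl) measurable
    show "integrable hl (\<lambda>s. (1 + 2 * z) * (cosh s ^ 3 * exp (- (z / 2) * cosh s)))"
      using z by (intro integrable_mult_right integrable_cosh_cube_exp) auto
  qed (use z in \<open>auto intro!: derivative_eq_intros simp: algebra_simps power2_eq_square\<close>)
  moreover have "(\<integral>s. ?f' z s \<partial>hl) = - z * K0 z"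
  proof -
    \<comment> \<open>Since sinh^2 = cosh^2 - 1, the derivative of \<open>?F\<close> is (cosh s - z
      cosh^2 s + z) exp(-z cosh s), so the integral of \<open>?f'\<close> is that of the last
      summand with opposite sign.\<close>
    let ?F = "\<lambda>s. sinh s * exp (- z * cosh s)"
    have i: "integrable hl (\<lambda>s. ?f' z s + z * exp (- z * cosh s))"
      using integrable_cosh_power_exp[OF z, of 1] integrable_cosh_power_exp[OF z, of 2] integrable_cosh_power_exp[OF z, of 0]
      by (simp add: left_diff_distrib mult.assoc)
    have "(\<integral>s. ?f' z s + z * exp (- z * cosh s) \<partial>hl) = 0 - 0"
    proof (rule integral_hl_FTC[OF _ _ i, where F = ?F])
      show "(?F has_real_derivative ?f' z s + z * exp (- z * cosh s)) (at s)" for s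
      proof -
        have "cosh s ^ 2 = sinh s ^ 2 + 1" using cosh_square_eq[of s] by simp
        then show ?thesis
          by (auto intro!: derivative_eq_intros simp: algebra_simps power2_eq_square)
      qed
      show "(?F \<longlongrightarrow> 0) (at_right 0)" by (auto intro!: tendsto_eq_intros)
      show "(?F \<longlongrightarrow> 0) at_top"
      proof (rule Lim_null_comparison)
        have "filterlim (\<lambda>s::real. -s) at_bot at_top" by (rule filterlim_uminus_at_bot_at_top)
        then have "((\<lambda>s::real. exp (-s)) \<longlongrightarrow> 0) at_top" by (rule filterlim_compose[OF exp_at_bot])
        from tendsto_mult_left[OF this, of "48 / z^4"] show "((\<lambda>s. 48 / z ^ 4 * exp (- s)) \<longlongrightarrow> 0) at_top" by simp
        show "\<forall>\<^sub>F s in at_top. norm (?F s) \<le> 48 / z ^ 4 * exp (- s)"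
        proof (intro always_eventually allI)
          fix s :: real
          have "\<bar>sinh s\<bar> \<le> cosh s" using abs_triangle_ineq4[of "exp s" "exp (- s)"]
            by (simp add: sinh_field_def cosh_field_def)
          also have "cosh s \<le> cosh s ^ 3" using power_increasing[of 1 3 "cosh s"] cosh_real_ge_1[of s] by simp
          finally have "\<bar>sinh s\<bar> * exp (- z * cosh s) \<le> cosh s ^ 3 * exp (- z * cosh s)"
            by (intro mult_right_mono) auto
          also note cosh_cube_exp_le[OF z, of s]
          finally show "norm (?F s) \<le> 48 / z ^ 4 * exp (- s)"
            by (simp add: abs_mult)
        qed
      qed
    qed (intro continuous_intros)
    moreover have "(\<integral>s. ?f' z s + z * exp (- z * cosh s) \<partial>hl) = (\<integral>s. ?f' z s \<partial>hl) + z * K0 z"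
      using integrable_cosh_power_exp[OF z, of 1] integrable_cosh_power_exp[OF z, of 2] integrable_cosh_power_exp[OF z, of 0]
      unfolding K0_def by (subst Bochner_Integration.integral_add) (auto simp: left_diff_distrib mult.assoc)
    ultimately show ?thesis by simp
  qed
  ultimately show ?thesis unfolding zK1_def by simp
qed

lemma continuous_on_K0: "continuous_on {0<..} K0"
  using K0_deriv by (auto intro!: continuous_at_imp_continuous_on DERIV_isCont)

lemma continuous_on_zK1: "continuous_on {0<..} zK1"
  using zK1_deriv by (auto intro!: continuous_at_imp_continuous_on DERIV_isCont)

text \<open>Integrating over z first leaves 1 / cosh s. The resulting constant governs the bound on
  the Nicholson integrals that is uniform in the order.\<close>

lemma integrable_hl_K0: "integrable hl K0"
proof -
  have "integrable (hl \<Otimes>\<^sub>M hl) (\<lambda>(s, z). exp (- z * cosh s))"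
  proof (rule hl_pair.Fubini_integrable)
    have "integrable hl (\<lambda>s. 1 / cosh s)"
    proof (rule Bochner_Integration.integrable_bound)
      show "integrable hl (\<lambda>s. 2 * exp (- s))" using integrable_hl_exp(1)[of 1] by simp
      show "AE s in hl. norm (1 / cosh s) \<le> norm (2 * exp (- s))"
        using cosh_ge_half_exp by (intro AE_I2) (auto simp: exp_minus field_simps)
    qed (rule borel_measurable_hl, measurable)
    moreover have "(\<integral>z. exp (- z * cosh s) \<partial>hl) = 1 / cosh s" for s
      using integrable_hl_exp(2)[of "cosh s"] by (simp add: mult.commute)
    ultimately show "integrable hl (\<lambda>s. \<integral>z. norm (case (s, z) of (s, z) \<Rightarrow> exp (- z * cosh s)) \<partial>hl)" by simp
    show "AE s in hl. integrable hl (\<lambda>z. case (s, z) of (s, z) \<Rightarrow> exp (- z * cosh s))"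
      using integrable_hl_exp(1)[of "cosh s" for s] by (simp add: mult.commute)
  qed (rule borel_measurable_hl_pair, measurable)
  then have "integrable hl (\<lambda>z. \<integral>s. exp (- z * cosh s) \<partial>hl)"
    by (rule hl_pair.integrable_snd)
  then show ?thesis by (simp add: K0_def[abs_def])
qed

section \<open>Gamma integrals in exponential coordinates\<close>

lemma integrable_lborel_hl:
  fixes f :: "real \<Rightarrow> 'b::{banach, second_countable_topology}"
  assumes "integrable lborel f"
  shows "integrable hl f" and "integrable hl (\<lambda>t. f (- t))"
proof -
  have gen: "integrable hl f" if "integrable lborel f" for f :: "real \<Rightarrow> 'b"
    using integrable_mult_indicator[OF _ that, of "{0<..}"] by (simp add: integrable_hl_iff set_integrable_def)
  show "integrable hl f" by (rule gen[OF assms])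
  show "integrable hl (\<lambda>t. f (- t))"
    using gen[OF lborel_integrable_real_affine[OF assms, of "-1" 0]] by simp
qed

lemma integral_lborel_split:
  fixes f :: "real \<Rightarrow> 'b::{banach, second_countable_topology}"
  assumes "integrable lborel f"
  shows "integral\<^sup>L lborel f = integral\<^sup>L hl f + integral\<^sup>L hl (\<lambda>t. f (- t))"
proof -
  have i: "integrable lborel (\<lambda>x. indicator {0<..} x *\<^sub>R f x)" "integrable lborel (\<lambda>x. indicator {..<0} x *\<^sub>R f x)"
    using assms by (auto intro!: integrable_mult_indicator)
  have "integral\<^sup>L lborel f = (\<integral>x. indicator {0<..} x *\<^sub>R f x + indicator {..<0} x *\<^sub>R f x \<partial>lborel)"
    using assms i AE_lborel_singleton[of 0] by (intro integral_cong_AE) (auto split: split_indicator)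
  also have "\<dots> = integral\<^sup>L hl f + (\<integral>x. indicator {..<0} x *\<^sub>R f x \<partial>lborel)"
    using i by (simp add: integral_hl_eq set_lebesgue_integral_def)
  also have "(\<integral>x. indicator {..<0} x *\<^sub>R f x \<partial>lborel) = integral\<^sup>L hl (\<lambda>t. f (- t))"
    by (subst lborel_integral_real_affine[of "-1" _ 0])
       (auto simp: integral_hl_eq set_lebesgue_integral_def intro!: Bochner_Integration.integral_cong split: split_indicator)
  finally show ?thesis .
qed

text \<open>Euler's integral under t = exp \<sigma>. On the whole line the multiplicative
  substitutions in products of Gamma integrals become translations.\<close>

lemma has_bochner_integral_Gamma_exp:
  fixes a :: complex
  assumes a: "Re a > 0"
  shows "has_bochner_integral lborel (\<lambda>\<sigma>. exp (a * of_real \<sigma> - of_real (exp \<sigma>))) (Gamma a)"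
proof -
  let ?f = "\<lambda>t. complex_of_real t powr (a - 1) / of_real (exp t)"
  have "?f absolutely_integrable_on {0<..}"
    using absolutely_integrable_Gamma_integral[OF a zero_less_one] by simp
  moreover have "integral {0<..} ?f = Gamma a"
  proof -
    have "integral {0<..} ?f = integral {0..} ?f"
      by (rule integral_spike_set) (auto intro: negligible_subset[of "{0}"])
    then show ?thesis using Gamma_integral_complex[OF a] by (simp add: integral_unique)
  qed
  moreover have "exp ` (UNIV :: real set) = {0<..}"
    by (auto, metis exp_ln rangeI)
  ultimately have "?f absolutely_integrable_on (exp ` (UNIV :: real set)) \<and> integral (exp ` (UNIV :: real set)) ?f = Gamma a"
    by simp
  then have *: "(\<lambda>\<sigma>. \<bar>exp \<sigma>\<bar> *\<^sub>R ?f (exp \<sigma>)) absolutely_integrable_on UNIV"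
    "integral UNIV (\<lambda>\<sigma>. \<bar>exp \<sigma>\<bar> *\<^sub>R ?f (exp \<sigma>)) = Gamma a"
    using has_absolute_integral_change_of_variables_real[of UNIV exp exp ?f "Gamma a"]
    by (auto intro!: derivative_eq_intros simp: inj_on_def)
  have eq: "\<bar>exp \<sigma>\<bar> *\<^sub>R ?f (exp \<sigma>) = exp (a * of_real \<sigma> - of_real (exp \<sigma>))" for \<sigma> :: real
  proof -
    have "complex_of_real (exp \<sigma>) powr (a - 1) = exp ((a - 1) * of_real \<sigma>)"
      by (simp add: powr_def Ln_of_real[symmetric] exp_of_real[symmetric])
    then show ?thesis
      by (simp add: scaleR_conv_of_real exp_diff field_simps flip: exp_of_real exp_add)
  qed
  have m: "(\<lambda>\<sigma>. exp (a * of_real \<sigma> - of_real (exp \<sigma>))) \<in> borel_measurable lborel" by measurable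
  have i: "integrable lebesgue (\<lambda>\<sigma>. exp (a * of_real \<sigma> - of_real (exp \<sigma>)))"
    using *(1) unfolding eq set_integrable_def by simp
  then have "integrable lborel (\<lambda>\<sigma>. exp (a * of_real \<sigma> - of_real (exp \<sigma>)))"
    using integrable_completion[OF m] by simp
  moreover have "integral\<^sup>L lborel (\<lambda>\<sigma>. exp (a * of_real \<sigma> - of_real (exp \<sigma>))) = Gamma a"
    using set_lebesgue_integral_eq_integral(2)[OF *(1)[unfolded eq]] *(2)[unfolded eq]
    by (simp add: set_lebesgue_integral_def integral_completion[OF m])
  ultimately show ?thesis by (simp add: has_bochner_integral_iff)
qed

lemma integrable_exp_minus_cosh:
  assumes "z > 0"
  shows "integrable lborel (\<lambda>s. exp (- z * cosh s))" and "integral\<^sup>L lborel (\<lambda>s. exp (- z * cosh s)) = 2 * K0 z"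
proof -
  have "set_integrable lborel ({0<..} \<union> {..<0}) (\<lambda>s. exp (- z * cosh s))"
  proof (rule set_integrable_Un)
    show 1: "set_integrable lborel {0<..} (\<lambda>s. exp (- z * cosh s))"
      using integrable_K0_integrand[OF assms] by (simp add: integrable_hl_iff)
    from lborel_integrable_real_affine[OF 1[unfolded set_integrable_def], of "-1" 0]
    show "set_integrable lborel {..<0} (\<lambda>s. exp (- z * cosh s))"
      unfolding set_integrable_def by (rule Bochner_Integration.integrable_cong[THEN iffD1, OF refl, rotated -1]) (auto split: split_indicator)
  qed auto
  then show i: "integrable lborel (\<lambda>s. exp (- z * cosh s))"
    unfolding set_integrable_def
    by (rule integrable_cong_AE_imp) (use AE_lborel_singleton[of 0] in \<open>auto elim!: eventually_mono split: split_indicator\<close>)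
  show "integral\<^sup>L lborel (\<lambda>s. exp (- z * cosh s)) = 2 * K0 z"
    using integral_lborel_split[OF i] by (simp add: K0_def)
qed

text \<open>Writing \<open>\<Gamma>(a)\<^sup>2\<close> as a double integral over \<open>(\<sigma>, \<rho>)\<close> and substituting \<open>\<rho> = 2r - \<sigma>\<close>, \<open>\<sigma> = r + s\<close>
  turns the inner integral into \<open>K\<^sub>0(2 exp r)\<close>.\<close>

lemma Gamma_square_eq_K0:
  fixes a :: complex
  assumes a: "Re a > 0"
  shows "has_bochner_integral lborel (\<lambda>r. 4 * exp (2 * a * of_real r) * of_real (K0 (2 * exp r))) ((Gamma a)\<^sup>2)"
proof -
  define G where "G = (\<lambda>\<sigma>::real. exp (a * of_real \<sigma> - of_real (exp \<sigma>)))"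
  note G = has_bochner_integral_Gamma_exp[OF a, folded G_def]
  have iG: "integrable lborel G" using G by (simp add: has_bochner_integral_iff)
  have [measurable]: "G \<in> borel_measurable borel" using iG by auto
  have aff: "has_bochner_integral lborel (\<lambda>r. 2 * G (2 * r - \<sigma>)) (Gamma a)" for \<sigma>
    using lborel_has_bochner_integral_real_affine_iff[of 2 G "Gamma a" "-\<sigma>"] G
    by (simp add: add.commute scaleR_conv_of_real has_bochner_integral_iff mult.commute)
  have naff: "has_bochner_integral lborel (\<lambda>r. 2 * norm (G (2 * r - \<sigma>))) (\<integral>r. norm (G r) \<partial>lborel)" for \<sigma>
    using lborel_has_bochner_integral_real_affine_iff[of 2 "\<lambda>r. norm (G r)" "\<integral>r. norm (G r) \<partial>lborel" "-\<sigma>"] iG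
    by (simp add: add.commute has_bochner_integral_iff)
  have int: "integrable (lborel \<Otimes>\<^sub>M lborel) (\<lambda>(\<sigma>, r). G \<sigma> * (2 * G (2 * r - \<sigma>)))"
  proof (rule lborel_pair.Fubini_integrable)
    have "(\<integral>r. norm (G \<sigma> * (2 * G (2 * r - \<sigma>))) \<partial>lborel) = norm (G \<sigma>) * (\<integral>r. norm (G r) \<partial>lborel)" for \<sigma>
      using naff[of \<sigma>] by (simp add: norm_mult has_bochner_integral_iff)
    then show "integrable lborel (\<lambda>\<sigma>. \<integral>r. norm (case (\<sigma>, r) of (\<sigma>, r) \<Rightarrow> G \<sigma> * (2 * G (2 * r - \<sigma>))) \<partial>lborel)"
      using iG by simp
    show "AE \<sigma> in lborel. integrable lborel (\<lambda>r. case (\<sigma>, r) of (\<sigma>, r) \<Rightarrow> G \<sigma> * (2 * G (2 * r - \<sigma>)))"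
      using aff by (auto simp: has_bochner_integral_iff)
  qed measurable
  have "(\<integral>\<sigma>. \<integral>r. G \<sigma> * (2 * G (2 * r - \<sigma>)) \<partial>lborel \<partial>lborel) = (\<integral>\<sigma>. G \<sigma> * Gamma a \<partial>lborel)"
    using aff by (intro Bochner_Integration.integral_cong) (auto simp: has_bochner_integral_iff)
  also have "\<dots> = (Gamma a)\<^sup>2" using G by (simp add: has_bochner_integral_iff power2_eq_square)
  finally have val: "(\<integral>r. \<integral>\<sigma>. G \<sigma> * (2 * G (2 * r - \<sigma>)) \<partial>lborel \<partial>lborel) = (Gamma a)\<^sup>2"
    using lborel_pair.Fubini_integral[OF int] by simp
  have inner: "(\<integral>\<sigma>. G \<sigma> * (2 * G (2 * r - \<sigma>)) \<partial>lborel) = 4 * exp (2 * a * of_real r) * of_real (K0 (2 * exp r))" for r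
  proof -
    have "(\<integral>\<sigma>. G \<sigma> * (2 * G (2 * r - \<sigma>)) \<partial>lborel) = (\<integral>s. G (r + s) * (2 * G (r - s)) \<partial>lborel)"
      by (subst lborel_integral_real_affine[of 1 _ r]) (auto simp: algebra_simps)
    also have "\<dots> = (\<integral>s. 2 * exp (2 * a * of_real r) * of_real (exp (- (2 * exp r) * cosh s)) \<partial>lborel)"
    proof (intro Bochner_Integration.integral_cong refl)
      fix s :: real
      have "exp (r + s) + exp (r - s) = 2 * exp r * cosh s"
        by (simp add: cosh_field_def exp_add exp_diff exp_minus field_simps)
      then have "complex_of_real (exp (r + s)) + complex_of_real (exp (r - s)) = of_real (2 * exp r * cosh s)"
        by (metis of_real_add)
      then have "(a * of_real (r + s) - of_real (exp (r + s))) + (a * of_real (r - s) - of_real (exp (r - s)))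
          = 2 * a * of_real r + of_real (- (2 * exp r) * cosh s)"
        by (simp add: algebra_simps)
      then show "G (r + s) * (2 * G (r - s)) = 2 * exp (2 * a * of_real r) * of_real (exp (- (2 * exp r) * cosh s))"
        unfolding G_def exp_of_real[symmetric] by (simp only: mult.left_commute[of _ 2] mult.assoc mult_exp_exp)
    qed
    also have "\<dots> = 2 * exp (2 * a * of_real r) * of_real (2 * K0 (2 * exp r))"
      using integrable_exp_minus_cosh[of "2 * exp r"] by simp
    finally show ?thesis by simp
  qed
  show ?thesis
    using val lborel_pair.integrable_snd[OF int] unfolding inner by (simp add: has_bochner_integral_iff)
qed

text \<open>The step from Gamma(z) to Gamma(1 + z) supplies a factor iy, whose i cancels against
  sin(i \<pi> y) = i sinh(\<pi> y).\<close>

lemma Gamma_reflection_one_plus_imag: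
  fixes y :: real
  assumes "y > 0"
  shows "Gamma (1 + \<i> * of_real y) * Gamma (1 - \<i> * of_real y) = of_real (pi * y / sinh (pi * y))"
proof -
  have nz: "\<i> * complex_of_real y \<noteq> 0" using assms by simp
  have "\<i> * complex_of_real y \<notin> \<int>\<^sub>\<le>\<^sub>0"
  proof
    assume "\<i> * complex_of_real y \<in> \<int>\<^sub>\<le>\<^sub>0"
    then have "Im (\<i> * complex_of_real y) = 0" by (auto elim!: nonpos_Ints_cases)
    with assms show False by simp
  qed
  then have "Gamma (1 + \<i> * of_real y) = \<i> * of_real y * Gamma (\<i> * of_real y)"
    using Gamma_plus1[of "\<i> * of_real y"] by (simp add: add.commute)
  then have "Gamma (1 + \<i> * of_real y) * Gamma (1 - \<i> * of_real y)
      = \<i> * of_real y * (of_real pi / sin (of_real pi * (\<i> * of_real y)))"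
    using Gamma_reflection_complex[of "\<i> * of_real y"] by (simp add: mult.assoc)
  also have "sin (of_real pi * (\<i> * of_real y)) = \<i> * of_real (sinh (pi * y))"
    using sin_i_times[of "of_real (pi * y)"] by (simp add: mult_ac sinh_field_def exp_minus flip: exp_of_real)
  finally show ?thesis by simp
qed

text \<open>A Beta integral: Gamma(a) Gamma(b) with a + b = 2 is a double integral whose inner part
  gives exp(bv) / (1 + exp v)^2 because Gamma(2) = 1. Then v = 2w makes the kernel 1 / cosh^2, and
  the reflection formula evaluates the product.\<close>

lemma has_bochner_integral_sech_square_cis:
  fixes y :: real
  assumes y: "y > 0"
  shows "has_bochner_integral lborel (\<lambda>w. exp (\<i> * of_real (y * w)) / of_real ((cosh w)\<^sup>2))
           (of_real (pi * y / sinh (pi * y / 2)))"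
proof -
  define a b where "a = 1 - \<i> * complex_of_real (y / 2)" and "b = 1 + \<i> * complex_of_real (y / 2)"
  have ab: "Re a > 0" "Re b > 0" "a + b = 2" by (simp_all add: a_def b_def)
  define G where "G = (\<lambda>a::complex. \<lambda>\<sigma>::real. exp (a * of_real \<sigma> - of_real (exp \<sigma>)))"
  have G: "has_bochner_integral lborel (G c) (Gamma c)" if "Re c > 0" for c
    unfolding G_def by (rule has_bochner_integral_Gamma_exp[OF that])
  have iG: "integrable lborel (G a)" "integrable lborel (G b)"
    using G[OF ab(1)] G[OF ab(2)] by (auto simp: has_bochner_integral_iff)
  have [measurable]: "G a \<in> borel_measurable borel" "G b \<in> borel_measurable borel" using iG by auto
  have aff: "has_bochner_integral lborel (\<lambda>v. G b (v + \<sigma>)) (Gamma b)" for \<sigma>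
    using lborel_has_bochner_integral_real_affine_iff[of 1 "G b" "Gamma b" \<sigma>] G[OF ab(2)]
    by (simp add: add.commute has_bochner_integral_iff)
  have naff: "has_bochner_integral lborel (\<lambda>v. norm (G b (v + \<sigma>))) (\<integral>r. norm (G b r) \<partial>lborel)" for \<sigma>
    using lborel_has_bochner_integral_real_affine_iff[of 1 "\<lambda>r. norm (G b r)" "\<integral>r. norm (G b r) \<partial>lborel" \<sigma>] iG
    by (simp add: add.commute has_bochner_integral_iff)
  have int: "integrable (lborel \<Otimes>\<^sub>M lborel) (\<lambda>(\<sigma>, v). G a \<sigma> * G b (v + \<sigma>))"
  proof (rule lborel_pair.Fubini_integrable)
    have "(\<integral>v. norm (G a \<sigma> * G b (v + \<sigma>)) \<partial>lborel) = norm (G a \<sigma>) * (\<integral>r. norm (G b r) \<partial>lborel)" for \<sigma>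
      using naff[of \<sigma>] by (simp add: norm_mult has_bochner_integral_iff)
    then show "integrable lborel (\<lambda>\<sigma>. \<integral>v. norm (case (\<sigma>, v) of (\<sigma>, v) \<Rightarrow> G a \<sigma> * G b (v + \<sigma>)) \<partial>lborel)"
      using iG by simp
    show "AE \<sigma> in lborel. integrable lborel (\<lambda>v. case (\<sigma>, v) of (\<sigma>, v) \<Rightarrow> G a \<sigma> * G b (v + \<sigma>))"
      using aff by (auto simp: has_bochner_integral_iff)
  qed measurable
  have "(\<integral>\<sigma>. \<integral>v. G a \<sigma> * G b (v + \<sigma>) \<partial>lborel \<partial>lborel) = (\<integral>\<sigma>. G a \<sigma> * Gamma b \<partial>lborel)"
    using aff by (intro Bochner_Integration.integral_cong) (auto simp: has_bochner_integral_iff)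
  also have "\<dots> = Gamma a * Gamma b" using G[OF ab(1)] by (simp add: has_bochner_integral_iff)
  finally have val: "(\<integral>v. \<integral>\<sigma>. G a \<sigma> * G b (v + \<sigma>) \<partial>lborel \<partial>lborel) = Gamma a * Gamma b"
    using lborel_pair.Fubini_integral[OF int] by simp
  have inner: "(\<integral>\<sigma>. G a \<sigma> * G b (v + \<sigma>) \<partial>lborel) = exp (b * of_real v) / of_real ((1 + exp v)\<^sup>2)" for v
  proof -
    \<comment> \<open>The shift by \<open>l\<close> absorbs the factor in exp \<sigma> + exp(v +
      \<sigma>) = (1 + exp v) exp \<sigma>, so that a single Gamma integrand remains.\<close>
    define l where "l = ln (1 + exp v)"
    have el: "exp l = 1 + exp v" by (simp add: l_def add_pos_pos)
    have "(\<integral>\<sigma>. G a \<sigma> * G b (v + \<sigma>) \<partial>lborel) = (\<integral>s. G a (s - l) * G b (v + (s - l)) \<partial>lborel)"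
      by (subst lborel_integral_real_affine[of 1 _ "-l"]) (auto simp: algebra_simps)
    also have "\<dots> = (\<integral>s. exp (b * of_real v - 2 * of_real l) * G 2 s \<partial>lborel)"
    proof (intro Bochner_Integration.integral_cong refl)
      fix s :: real
      have "exp (s - l) + exp (v + (s - l)) = exp s"
      proof -
        have "exp (s - l) + exp (v + (s - l)) = exp (s - l) * exp l"
          unfolding el exp_add by (simp add: algebra_simps)
        then show ?thesis by (simp flip: exp_add)
      qed
      then have e: "complex_of_real (exp (s - l)) + complex_of_real (exp (v + (s - l))) = of_real (exp s)"
        by (metis of_real_add)
      have "a * of_real (s - l) + b * of_real (v + (s - l)) = b * of_real v + (a + b) * of_real (s - l)"
        by (simp add: algebra_simps)
      with e have "(a * of_real (s - l) - of_real (exp (s - l))) + (b * of_real (v + (s - l)) - of_real (exp (v + (s - l))))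
          = (b * of_real v - 2 * of_real l) + (2 * of_real s - of_real (exp s))"
        unfolding ab(3) by (simp add: algebra_simps)
      then show "G a (s - l) * G b (v + (s - l)) = exp (b * of_real v - 2 * of_real l) * G 2 s"
        unfolding G_def by (simp only: mult_exp_exp)
    qed
    also have "\<dots> = exp (b * of_real v - 2 * of_real l)"
      using G[of 2] Gamma_fact[of 1, where 'a = complex] by (simp add: has_bochner_integral_iff)
    also have "\<dots> = exp (b * of_real v) / of_real ((exp l)\<^sup>2)"
      by (simp add: exp_diff power2_eq_square flip: exp_of_real exp_add)
    finally show ?thesis by (simp add: el)
  qed
  have "has_bochner_integral lborel (\<lambda>v. exp (b * of_real v) / of_real ((1 + exp v)\<^sup>2)) (Gamma a * Gamma b)"
    using val lborel_pair.integrable_snd[OF int] unfolding inner by (simp add: has_bochner_integral_iff)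
  from lborel_has_bochner_integral_real_affine_iff[of 2 _ _ 0, THEN iffD1, OF _ this]
  have "has_bochner_integral lborel (\<lambda>w. 4 * (exp (b * of_real (2 * w)) / of_real ((1 + exp (2 * w))\<^sup>2))) (4 * (Gamma a * Gamma b / 2))"
    by (intro has_bochner_integral_mult_right) (simp add: scaleR_conv_of_real)
  moreover have "4 * (exp (b * of_real (2 * w)) / of_real ((1 + exp (2 * w))\<^sup>2)) = exp (\<i> * of_real (y * w)) / of_real ((cosh w)\<^sup>2)" for w
  proof -
    have "b * of_real (2 * w) = of_real (2 * w) + \<i> * of_real (y * w)" by (simp add: b_def algebra_simps)
    then have "exp (b * of_real (2 * w)) = of_real (exp (2 * w)) * exp (\<i> * of_real (y * w))"
      by (simp add: exp_add flip: exp_of_real)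
    moreover have "4 * exp (2 * w) / (1 + exp (2 * w))\<^sup>2 = 1 / (cosh w)\<^sup>2"
    proof -
      have "1 + exp (2 * w) = 2 * exp w * cosh w"
        by (simp add: cosh_field_def exp_minus field_simps flip: exp_add)
      moreover have "exp (2 * w) = (exp w)\<^sup>2" by (simp add: power2_eq_square flip: exp_add)
      ultimately show ?thesis by (simp add: power_mult_distrib)
    qed
    then have "complex_of_real (4 * exp (2 * w) / (1 + exp (2 * w))\<^sup>2) = of_real (1 / (cosh w)\<^sup>2)" by simp
    ultimately show ?thesis by (simp add: field_simps)
  qed
  moreover have "4 * (Gamma a * Gamma b / 2) = of_real (pi * y / sinh (pi * y / 2))"
    using Gamma_reflection_one_plus_imag[of "y / 2"] y by (simp add: a_def b_def mult.commute)
  ultimately show ?thesis by simp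
qed

lemma integral_sech_square_cos:
  fixes y :: real
  assumes y: "y > 0"
  shows "has_bochner_integral lborel (\<lambda>w. cos (y * w) / (cosh w)\<^sup>2) (pi * y / sinh (pi * y / 2))"
proof -
  from has_bochner_integral_bounded_linear[OF bounded_linear_Re has_bochner_integral_sech_square_cis[OF y]]
  have "has_bochner_integral lborel (\<lambda>w. Re (exp (\<i> * of_real (y * w)) / of_real ((cosh w)\<^sup>2))) (pi * y / sinh (pi * y / 2))"
    by simp
  moreover have "Re (exp (\<i> * of_real (y * w)) / of_real ((cosh w)\<^sup>2)) = cos (y * w) / (cosh w)\<^sup>2" for w
    by (simp only: Re_divide_of_real) (simp add: Re_exp)
  ultimately show ?thesis by simp
qed

section \<open>The integral of \<open>(coth t - 1) sin (y t)\<close>\<close>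

lemma abs_sin_le: "0 \<le> t \<Longrightarrow> \<bar>sin (y * t)\<bar> \<le> \<bar>y\<bar> * (t::real)"
  using abs_sin_x_le_abs_x[of "y * t"] by (simp add: abs_mult)

lemma integrable_hl_bound:
  fixes f g :: "real \<Rightarrow> real"
  assumes "continuous_on {0<..} f" "integrable hl g" "\<And>t. t > 0 \<Longrightarrow> \<bar>f t\<bar> \<le> g t"
  shows "integrable hl f"
proof (rule Bochner_Integration.integrable_bound[OF assms(2)])
  show "f \<in> borel_measurable hl" by (rule borel_measurable_hl_continuous[OF assms(1)])
  show "AE t in hl. norm (f t) \<le> norm (g t)"
    using assms(3) by (intro AE_I2) force
qed

lemma has_bochner_integral_hl_scale:
  fixes f :: "real \<Rightarrow> 'b::{banach, second_countable_topology}"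
  assumes "has_bochner_integral hl f I" and c: "c > 0"
  shows "has_bochner_integral hl (\<lambda>t. f (c * t)) (I /\<^sub>R c)"
proof -
  have hl: "has_bochner_integral hl f I \<longleftrightarrow> has_bochner_integral lborel (\<lambda>x. indicator {0<..} x *\<^sub>R f x) I"
    for f :: "real \<Rightarrow> 'b" and I
    by (simp add: has_bochner_integral_iff integrable_hl_iff integral_hl_eq set_integrable_def set_lebesgue_integral_def)
  have "(\<lambda>x. indicator {0<..} (0 + c * x) *\<^sub>R f (0 + c * x)) = (\<lambda>x. indicator {0<..} x *\<^sub>R f (c * x))"
    using c by (intro ext) (auto split: split_indicator simp: zero_less_mult_iff)
  then show ?thesis
    using lborel_has_bochner_integral_real_affine_iff[of c "\<lambda>x. indicator {0<..} x *\<^sub>R f x" I 0] assms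
    unfolding hl by simp
qed

lemma sinh_ge_arg: "0 \<le> t \<Longrightarrow> t \<le> sinh (t::real)"
proof -
  assume t: "0 \<le> t"
  have "(\<lambda>t. sinh t - t) 0 \<le> (\<lambda>t. sinh t - t) t"
    by (rule DERIV_nonneg_imp_nondecreasing[OF t])
       (auto intro!: exI derivative_eq_intros simp: cosh_real_ge_1)
  then show ?thesis by simp
qed

lemma coth_minus_1: "t > 0 \<Longrightarrow> cosh t / sinh t - 1 = exp (- t) / sinh (t::real)"
  using cosh_minus_sinh[of t] by (simp add: diff_divide_distrib flip: cosh_minus_sinh)

text \<open>Source of the constant term in the behaviour of \<open>nichN\<close> at 0. Subtracting 1
  is what makes the integral converge at infinity.\<close>

definition cothC :: "real \<Rightarrow> real" where
  "cothC y = (\<integral>t. (cosh t / sinh t - 1) * sin (y * t) \<partial>hl)"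

text \<open>The pole of exp(-t) / sinh t at 0 is cancelled by |sin(yt)| \<le> |y| t \<le> |y| sinh
  t. The factor |y| also yields the limit 0 of \<open>cothC\<close> at 0.\<close>

lemma cothC_integrand_le:
  fixes t y :: real
  assumes "t > 0"
  shows "\<bar>(cosh t / sinh t - 1) * sin (y * t)\<bar> \<le> \<bar>y\<bar> * exp (- 1 * t)"
proof -
  have s: "sinh t > 0" using assms by simp
  have "\<bar>sin (y * t)\<bar> \<le> \<bar>y\<bar> * t" using abs_sin_le[of t y] assms by simp
  also have "\<dots> \<le> \<bar>y\<bar> * sinh t" using sinh_ge_arg[of t] assms by (intro mult_left_mono) auto
  finally have "exp (- t) * \<bar>sin (y * t)\<bar> \<le> exp (- t) * (\<bar>y\<bar> * sinh t)" by (intro mult_left_mono) auto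
  then show ?thesis using s by (simp add: coth_minus_1[OF assms] abs_mult field_simps)
qed

lemma cothC_integrable: "integrable hl (\<lambda>t. (cosh t / sinh t - 1) * sin (y * t))"
proof (rule integrable_hl_bound)
  show "integrable hl (\<lambda>t. \<bar>y\<bar> * exp (- 1 * t))" by (intro integrable_mult_right integrable_hl_exp) auto
qed (use cothC_integrand_le in \<open>auto intro!: continuous_intros\<close>)

lemma abs_cothC_le: "\<bar>cothC y\<bar> \<le> \<bar>y\<bar>"
proof -
  have "\<bar>cothC y\<bar> \<le> (\<integral>t. \<bar>y\<bar> * exp (- 1 * t) \<partial>hl)"
    unfolding cothC_def
    by (rule integral_abs_bound_integral[OF cothC_integrable])
       (use cothC_integrand_le integrable_hl_exp(1)[of 1] in auto)
  also have "\<dots> = \<bar>y\<bar>" using integrable_hl_exp(2)[of 1] by simp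
  finally show ?thesis .
qed

text \<open>By parts against cos(yt): the derivative of tanh is 1 / cosh^2, whose cosine transform
  is known, and the boundary value 1 at t = 0 gives the term 1 / y.\<close>

lemma integral_one_minus_tanh_sin:
  assumes y: "y > 0"
  shows "has_bochner_integral hl (\<lambda>t. (1 - tanh t) * sin (y * t)) (1 / y - (pi / 2) / sinh (pi * y / 2))"
proof -
  have tanh_eq: "1 - tanh t = exp (- t) / cosh t" for t :: real
    by (simp add: tanh_def cosh_minus_sinh[symmetric] diff_divide_distrib)
  have bound: "\<bar>(1 - tanh t) * sin (y * t)\<bar> \<le> exp (- 1 * t)" for t
  proof -
    have "exp (- t) * \<bar>sin (y * t)\<bar> \<le> exp (- t) * cosh t"
      using abs_sin_le_one[of "y * t"] cosh_real_ge_1[of t] by (intro mult_left_mono) (linarith | simp)+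
    then show ?thesis unfolding tanh_eq by (simp add: abs_mult pos_divide_le_eq)
  qed
  have i1: "integrable hl (\<lambda>t. (1 - tanh t) * sin (y * t))"
    by (rule integrable_hl_bound[where g = "\<lambda>t. exp (- 1 * t)"])
       (use bound integrable_hl_exp(1)[of 1] in \<open>auto intro!: continuous_intros\<close>)
  note S = integral_sech_square_cos[OF y]
  have iS: "integrable lborel (\<lambda>w. cos (y * w) / (cosh w)\<^sup>2)" using S by (simp add: has_bochner_integral_iff)
  have i2: "integrable hl (\<lambda>w. cos (y * w) / (cosh w)\<^sup>2)" by (rule integrable_lborel_hl[OF iS])
  have v2: "(\<integral>w. cos (y * w) / (cosh w)\<^sup>2 \<partial>hl) = (pi * y / 2) / sinh (pi * y / 2)"
    using integral_lborel_split[OF iS] S by (simp add: has_bochner_integral_iff)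
  let ?f = "\<lambda>t. - (cos (y * t) / (cosh t)\<^sup>2) - y * ((1 - tanh t) * sin (y * t))"
  have i: "integrable hl ?f" using i1 i2 by auto
  have "integral\<^sup>L hl ?f = 0 - 1"
  proof (rule integral_hl_FTC[where F = "\<lambda>t. (1 - tanh t) * cos (y * t)", OF _ _ i])
    fix t :: real
    have "1 - (tanh t)\<^sup>2 = ((cosh t)\<^sup>2 - (sinh t)\<^sup>2) / (cosh t)\<^sup>2"
      by (simp add: tanh_def power_divide diff_divide_distrib)
    then have e: "1 - (tanh t)\<^sup>2 = 1 / (cosh t)\<^sup>2" by (simp add: hyperbolic_pythagoras)
    have "((\<lambda>t. (1 - tanh t) * cos (y * t)) has_real_derivative
        - ((1 - (tanh t)\<^sup>2) * cos (y * t)) - y * ((1 - tanh t) * sin (y * t))) (at t)"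
      by (auto intro!: derivative_eq_intros simp: algebra_simps)
    then show "((\<lambda>t. (1 - tanh t) * cos (y * t)) has_real_derivative ?f t) (at t)"
      unfolding e by simp
  next
    show "((\<lambda>t. (1 - tanh t) * cos (y * t)) \<longlongrightarrow> 1) (at_right 0)"
      by (auto intro!: tendsto_eq_intros)
    have "((\<lambda>t::real. 1 - tanh t) \<longlongrightarrow> 0) at_top"
      using tendsto_diff[OF tendsto_const tanh_real_at_top, of 1] by simp
    then show "((\<lambda>t. (1 - tanh t) * cos (y * t)) \<longlongrightarrow> 0) at_top"
      by (rule lim_null_mult_right_bounded[where B = 1]) auto
  qed (intro continuous_intros, auto)
  then have "(pi * y / 2) / sinh (pi * y / 2) + y * (\<integral>t. (1 - tanh t) * sin (y * t) \<partial>hl) = 1"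
    using i1 i2 v2 by simp
  then have "(\<integral>t. (1 - tanh t) * sin (y * t) \<partial>hl) = (1 - (pi * y / 2) / sinh (pi * y / 2)) / y"
    using y by (subst eq_divide_eq) (simp only: mult.commute[of _ y], auto)
  then have "(\<integral>t. (1 - tanh t) * sin (y * t) \<partial>hl) = 1 / y - (pi / 2) / sinh (pi * y / 2)"
    using y by (simp add: diff_divide_distrib)
  with i1 show ?thesis by (simp add: has_bochner_integral_iff)
qed

lemma coth_double: "t \<noteq> 0 \<Longrightarrow> 2 * (cosh (2 * t) / sinh (2 * t)) = tanh t + cosh t / sinh (t::real)"
  unfolding sinh_double cosh_double tanh_def by (simp add: field_simps power2_eq_square)

text \<open>Scaling t to 2t in \<open>cothC (y / 2)\<close> puts both integrals on the same
  frequency; by \<open>coth_double\<close> the difference of the kernels collapses to 1 - tanh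
  t.\<close>

lemma cothC_half:
  assumes y: "y > 0"
  shows "cothC y - cothC (y / 2) = 1 / y - (pi / 2) / sinh (pi * y / 2)"
proof -
  have "has_bochner_integral hl (\<lambda>t. (cosh t / sinh t - 1) * sin ((y / 2) * t)) (cothC (y / 2))"
    using cothC_integrable[of "y / 2"] by (simp add: has_bochner_integral_iff cothC_def)
  from has_bochner_integral_mult_right[OF has_bochner_integral_hl_scale[OF this, of 2], of 2]
  have "has_bochner_integral hl (\<lambda>t. 2 * ((cosh (2 * t) / sinh (2 * t) - 1) * sin (y * t))) (cothC (y / 2))"
    by (simp add: mult.commute)
  moreover have "has_bochner_integral hl (\<lambda>t. (cosh t / sinh t - 1) * sin (y * t)) (cothC y)"
    using cothC_integrable[of "y"] by (simp add: has_bochner_integral_iff cothC_def)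
  ultimately have "has_bochner_integral hl (\<lambda>t. (cosh t / sinh t - 1) * sin (y * t) - 2 * ((cosh (2 * t) / sinh (2 * t) - 1) * sin (y * t))) (cothC y - cothC (y / 2))"
    by (rule has_bochner_integral_diff[rotated])
  also have "?this \<longleftrightarrow> has_bochner_integral hl (\<lambda>t. (1 - tanh t) * sin (y * t)) (cothC y - cothC (y / 2))"
  proof (intro has_bochner_integral_cong refl)
    fix t assume "t \<in> space hl"
    then have "t \<noteq> 0" by auto
    have "(cosh t / sinh t - 1) * sin (y * t) - 2 * ((cosh (2 * t) / sinh (2 * t) - 1) * sin (y * t))
        = (cosh t / sinh t + 1 - 2 * (cosh (2 * t) / sinh (2 * t))) * sin (y * t)"
      by (simp add: algebra_simps)
    then show "(cosh t / sinh t - 1) * sin (y * t) - 2 * ((cosh (2 * t) / sinh (2 * t) - 1) * sin (y * t)) = (1 - tanh t) * sin (y * t)"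
      using coth_double[OF \<open>t \<noteq> 0\<close>] by simp
  qed
  finally show ?thesis
    using integral_one_minus_tanh_sin[OF y] by (rule has_bochner_integral_eq)
qed

text \<open>Herglotz' trick: both sides satisfy the functional equation \<open>cothC_half\<close> and vanish at \<open>0\<close>.\<close>

lemma cothC_eq:
  assumes y: "y > 0"
  shows "cothC y = (pi / 2) * (cosh (pi * y / 2) / sinh (pi * y / 2)) - 1 / y"
proof -
  define c where "c = (\<lambda>y. (pi / 2) * (cosh (pi * y / 2) / sinh (pi * y / 2)) - 1 / y)"
  have half: "cothC y - c y = cothC (y / 2) - c (y / 2)" if y: "y > 0" for y
  proof -
    define a where "a = pi * y / 4"
    have a: "a > 0" using y by (simp add: a_def)
    have "cosh (2 * a) / sinh (2 * a) - cosh a / sinh a = - 1 / sinh (2 * a)"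
    proof -
      have "cosh (2 * a) - 2 * (cosh a)\<^sup>2 = - 1"
        using cosh_double_cosh[of a] by simp
      moreover have "cosh (2 * a) / sinh (2 * a) - cosh a / sinh a = (cosh (2 * a) - 2 * (cosh a)\<^sup>2) / sinh (2 * a)"
        using a unfolding sinh_double by (simp add: field_simps power2_eq_square)
      ultimately show ?thesis by simp
    qed
    moreover have "2 * a = pi * y / 2" "a = pi * (y / 2) / 2" by (simp_all add: a_def)
    ultimately have e: "cosh (pi * y / 2) / sinh (pi * y / 2) - cosh (pi * (y / 2) / 2) / sinh (pi * (y / 2) / 2) = - 1 / sinh (pi * y / 2)"
      by simp
    have "c y - c (y / 2) = (pi / 2) * (cosh (pi * y / 2) / sinh (pi * y / 2) - cosh (pi * (y / 2) / 2) / sinh (pi * (y / 2) / 2)) + 1 / y"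
      by (simp add: c_def right_diff_distrib)
    also have "\<dots> = 1 / y - (pi / 2) / sinh (pi * y / 2)" unfolding e by simp
    finally show ?thesis using cothC_half[OF y] by simp
  qed
  have iter: "cothC y - c y = cothC (y / 2 ^ k) - c (y / 2 ^ k)" for k
  proof (induction k)
    case (Suc k)
    then show ?case using half[of "y / 2 ^ k"] y by (simp add: mult.commute)
  qed simp
  have lim0: "filterlim (\<lambda>k. y / 2 ^ k) (at_right 0) sequentially"
    using y by real_asymp
  have "((\<lambda>a::real. ((exp a + exp (- a)) / 2) / ((exp a - exp (- a)) / 2) - 1 / a) \<longlongrightarrow> 0) (at_right 0)"
    by real_asymp
  then have "((\<lambda>a::real. cosh a / sinh a - 1 / a) \<longlongrightarrow> 0) (at_right 0)"
    by (simp add: cosh_field_def sinh_field_def)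
  moreover have "filterlim (\<lambda>y. pi * y / 2) (at_right 0) (at_right 0)"
    by real_asymp
  ultimately have "((\<lambda>y. cosh (pi * y / 2) / sinh (pi * y / 2) - 1 / (pi * y / 2)) \<longlongrightarrow> 0) (at_right 0)"
    by (rule filterlim_compose)
  from tendsto_mult_left[OF this, of "pi / 2"] have "(c \<longlongrightarrow> 0) (at_right 0)"
    by (simp add: c_def right_diff_distrib)
  from filterlim_compose[OF this lim0] have 1: "(\<lambda>k. c (y / 2 ^ k)) \<longlonglongrightarrow> 0" .
  have "(cothC \<longlongrightarrow> 0) (at_right 0)"
  proof (rule Lim_null_comparison)
    show "\<forall>\<^sub>F y in at_right 0. norm (cothC y) \<le> \<bar>y\<bar>" using abs_cothC_le by simp
    show "((\<lambda>y::real. \<bar>y\<bar>) \<longlongrightarrow> 0) (at_right 0)" by (auto intro!: tendsto_eq_intros)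
  qed
  from filterlim_compose[OF this lim0] have 2: "(\<lambda>k. cothC (y / 2 ^ k)) \<longlonglongrightarrow> 0" .
  have "(\<lambda>k. cothC (y / 2 ^ k) - c (y / 2 ^ k)) \<longlonglongrightarrow> 0"
    using tendsto_diff[OF 2 1] by simp
  then have "(\<lambda>k::nat. cothC y - c y) \<longlonglongrightarrow> 0" by (simp flip: iter)
  then have "cothC y - c y = 0" by (simp add: LIMSEQ_const_iff)
  then show ?thesis by (simp add: c_def)
qed

section \<open>Nicholson's integral: the differential system\<close>

lemma tendsto_exp_minus_mult: "c > 0 \<Longrightarrow> ((\<lambda>t::real. exp (- c * t)) \<longlongrightarrow> 0) at_top"
  by real_asymp

text \<open>Half of the exponential decay is spent on the cube and on the factor 1 + z in the bound
  of \<open>zK1\<close>. The constant is 768 = 2^4 * 24 * 2, from the fourth power of (1 + z) / 2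
  and from exp(1/2) \<le> 2.\<close>

lemma zK1_poly_le:
  assumes z: "z > 0"
  shows "(1 + z) ^ 3 * zK1 z \<le> 768 * exp (- z / 2)"
proof -
  have "((1 + z) / 2) ^ 4 \<le> 24 * exp ((1 + z) / 2)"
    using z by (intro power4_le_exp) auto
  also have "exp ((1 + z) / 2) = exp (1 / 2) * exp (z / 2)" by (simp flip: exp_add add: add_divide_distrib)
  also have "exp (1 / 2 :: real) \<le> 2" using exp_bound_half[of "1 / 2 :: real"] by simp
  finally have *: "(1 + z) ^ 4 \<le> 768 * exp (z / 2)" by (simp add: power_divide mult_right_mono)
  have "(1 + z) ^ 3 * zK1 z \<le> (1 + z) ^ 3 * ((1 + z) * exp (- z))"
    using z by (intro mult_left_mono zK1_ge_exp_and_le) auto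
  also have "\<dots> = (1 + z) ^ 4 * exp (- z)" by (simp add: power_numeral_reduce mult_ac)
  also have "\<dots> \<le> 768 * exp (z / 2) * exp (- z)" by (intro mult_right_mono *) auto
  also have "\<dots> = 768 * exp (- z / 2)" by (simp flip: exp_add)
  finally show ?thesis .
qed

lemma zK1_sinh_poly_le:
  assumes x: "x > 0" and t: "t > 0"
  shows "(1 + 2 * x * sinh t) ^ 3 * zK1 (2 * x * sinh t) \<le> 768 * exp (- x * t)"
proof -
  have "2 * x * sinh t > 0" using assms by simp
  then have "(1 + 2 * x * sinh t) ^ 3 * zK1 (2 * x * sinh t) \<le> 768 * exp (- (2 * x * sinh t) / 2)"
    by (rule zK1_poly_le)
  also have "exp (- (2 * x * sinh t) / 2) \<le> exp (- x * t)"
    using sinh_ge_arg[of t] assms by simp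
  finally show ?thesis by simp
qed

lemma zK1_sinh_power_le:
  assumes x: "x > 0" and t: "t > 0" and "a \<ge> 0" "a \<le> (1 + 2 * x * sinh t) ^ 3"
  shows "a * zK1 (2 * x * sinh t) \<le> 768 * exp (- x * t)"
proof -
  have "2 * x * sinh t > 0" using x t by simp
  then have "a * zK1 (2 * x * sinh t) \<le> (1 + 2 * x * sinh t) ^ 3 * zK1 (2 * x * sinh t)"
    using assms zK1_pos[of "2 * x * sinh t"] by (intro mult_right_mono) auto
  also note zK1_sinh_poly_le[OF x t]
  finally show ?thesis .
qed

definition z2K0 :: "real \<Rightarrow> real" where "z2K0 z = z\<^sup>2 * K0 z"

lemma z2K0_nonneg: "z2K0 z \<ge> 0" by (simp add: z2K0_def K0_nonneg)

lemma z2K0_le_zK1: assumes "z > 0" shows "z2K0 z \<le> z * zK1 z"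
  using mult_left_mono[OF K0_le_zK1[OF assms], of z] assms by (simp add: z2K0_def power2_eq_square mult.assoc)

lemma z2K0_le: assumes "z > 0" shows "z2K0 z \<le> z"
  using order_trans[OF z2K0_le_zK1[OF assms] mult_left_mono[OF zK1_le_1[OF assms], of z]] assms by simp

lemma z2K0_deriv:
  assumes "z > 0"
  shows "(z2K0 has_real_derivative 2 * z * K0 z - z * zK1 z) (at z)"
proof -
  have "((\<lambda>z. z\<^sup>2 * K0 z) has_real_derivative 2 * z * K0 z + (- zK1 z / z) * z\<^sup>2) (at z)"
    using DERIV_mult[OF DERIV_power[OF DERIV_ident, of 2] K0_deriv[OF assms]] by simp
  then show ?thesis using assms by (simp add: z2K0_def[abs_def] power2_eq_square mult.commute)
qed

text \<open>Needed to replace the argument 2 x sinh t by x exp t. Both parts of the derivative, 2 z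
  K_0(z) and z^2 K_1(z), lie between 0 and 2.\<close>

lemma z2K0_Lipschitz:
  assumes "0 < a" "a \<le> b"
  shows "\<bar>z2K0 b - z2K0 a\<bar> \<le> 2 * (b - a)"
proof -
  have "norm (z2K0 b - z2K0 a) \<le> 2 * norm (b - a)"
  proof (rule field_differentiable_bound[of "{a..b}" z2K0 "\<lambda>z. 2 * z * K0 z - z * zK1 z"])
    show "(z2K0 has_field_derivative 2 * z * K0 z - z * zK1 z) (at z within {a..b})" if "z \<in> {a..b}" for z
      by (rule has_field_derivative_at_within, rule z2K0_deriv) (use that assms in auto)
    show "norm (2 * z * K0 z - z * zK1 z) \<le> 2" if "z \<in> {a..b}" for z
    proof -
      have z: "z > 0" using that assms by auto
      have 1: "0 \<le> z * K0 z" "z * K0 z \<le> 1"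
        using z K0_nonneg[of z] K0_le_zK1[OF z] zK1_le_1[OF z] by auto
      have "z * zK1 z \<le> z * ((1 + z) * exp (- z))"
        using z by (intro mult_left_mono zK1_ge_exp_and_le) auto
      also have "\<dots> \<le> 2"
      proof -
        have "1 + z + z\<^sup>2 / 2 \<le> exp z" using z by (intro exp_lower_Taylor_quadratic) auto
        then have "z * (1 + z) \<le> 2 * exp z" using z by (simp add: power2_eq_square algebra_simps)
        then show ?thesis by (simp add: exp_minus field_simps)
      qed
      finally have 2: "z * zK1 z \<le> 2" .
      have "0 \<le> z * zK1 z" using z zK1_pos[OF z] by simp
      with 1 2 show ?thesis by (simp only: real_norm_def abs_le_iff) linarith
    qed
  qed (use assms in auto)
  then show ?thesis using assms by simp
qed

lemma cosh_le_1_plus_sinh: "0 \<le> t \<Longrightarrow> cosh t \<le> 1 + sinh (t::real)"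
  using cosh_minus_sinh[of t] by (simp add: algebra_simps)

context
  fixes y :: real
begin

text \<open>\<open>K0\<close>, \<open>zK1\<close>, \<open>z2K0\<close> are, up to sign, successive
  images under z d/dz, and scaling commutes with that operator. Hence \<open>nichQ\<close> is minus
  \<theta> of \<open>nichN\<close>, and \<open>nichP\<close> is \<theta> of \<theta> of it.\<close>

definition nichN :: "real \<Rightarrow> real" where "nichN x = (\<integral>t. cos (y * t) * K0 (2 * x * sinh t) \<partial>hl)"
definition nichQ :: "real \<Rightarrow> real" where "nichQ x = (\<integral>t. cos (y * t) * zK1 (2 * x * sinh t) \<partial>hl)"
definition nichP :: "real \<Rightarrow> real" where "nichP x = (\<integral>t. cos (y * t) * z2K0 (2 * x * sinh t) \<partial>hl)"

lemma continuous_on_K0_sinh: "x > 0 \<Longrightarrow> continuous_on {0<..} (\<lambda>t. K0 (2 * x * sinh t))"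
  by (rule continuous_on_compose2[OF continuous_on_K0]) (auto intro!: continuous_intros)

lemma continuous_on_zK1_sinh: "x > 0 \<Longrightarrow> continuous_on {0<..} (\<lambda>t. zK1 (2 * x * sinh t))"
  by (rule continuous_on_compose2[OF continuous_on_zK1]) (auto intro!: continuous_intros)

lemma continuous_on_z2K0_sinh: "x > 0 \<Longrightarrow> continuous_on {0<..} (\<lambda>t. z2K0 (2 * x * sinh t))"
  unfolding z2K0_def by (intro continuous_intros continuous_on_K0_sinh)

lemmas continuous_on_bessel_sinh = continuous_on_K0_sinh continuous_on_zK1_sinh continuous_on_z2K0_sinh

lemma K0_scale_integral:
  assumes "x > 0"
  shows "has_bochner_integral hl (\<lambda>t. K0 (2 * x * t)) (integral\<^sup>L hl K0 / (2 * x))"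
  using has_bochner_integral_hl_scale[OF has_bochner_integral_integrable[OF integrable_hl_K0], of "2 * x"] assms
  by (simp add: field_simps)

lemma K0_sinh_le: "x > 0 \<Longrightarrow> t > 0 \<Longrightarrow> K0 (2 * x * sinh t) \<le> K0 (2 * x * t)"
  by (intro K0_antimono) (auto intro: sinh_ge_arg)

lemma integrable_K0_sinh: "x > 0 \<Longrightarrow> integrable hl (\<lambda>t. K0 (2 * x * sinh t))"
proof (rule integrable_hl_bound)
  assume x: "x > 0"
  show "integrable hl (\<lambda>t. K0 (2 * x * t))" using K0_scale_integral[OF x] by (simp add: has_bochner_integral_iff)
qed (use K0_sinh_le K0_nonneg in \<open>auto intro!: continuous_on_bessel_sinh\<close>)

lemma integrable_nichN: "x > 0 \<Longrightarrow> integrable hl (\<lambda>t. cos (y * t) * K0 (2 * x * sinh t))"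
  by (rule integrable_hl_bound[OF _ integrable_K0_sinh])
     (auto intro!: continuous_intros continuous_on_bessel_sinh mult_left_le_one_le simp: abs_mult K0_nonneg)

text \<open>From sinh t \<ge> t and the monotonicity of \<open>K0\<close>. The bound does not
  contain \<open>y\<close>, so absolute summability of the coefficients alone controls the
  series.\<close>

lemma abs_nichN_le: assumes "x > 0" shows "\<bar>nichN x\<bar> \<le> integral\<^sup>L hl K0 / (2 * x)"
proof -
  have "\<bar>nichN x\<bar> \<le> (\<integral>t. K0 (2 * x * t) \<partial>hl)"
    unfolding nichN_def
  proof (rule integral_abs_bound_integral[OF integrable_nichN[OF assms]])
    show "integrable hl (\<lambda>t. K0 (2 * x * t))" using K0_scale_integral[OF assms] by (simp add: has_bochner_integral_iff)
    fix t assume "t \<in> space hl"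
    then have "K0 (2 * x * sinh t) \<le> K0 (2 * x * t)" using K0_sinh_le assms by auto
    moreover have "\<bar>cos (y * t)\<bar> * K0 (2 * x * sinh t) \<le> K0 (2 * x * sinh t)"
      by (intro mult_left_le_one_le) (auto simp: K0_nonneg)
    ultimately show "\<bar>cos (y * t) * K0 (2 * x * sinh t)\<bar> \<le> K0 (2 * x * t)"
      by (simp add: abs_mult K0_nonneg)
  qed
  then show ?thesis using K0_scale_integral[OF assms] by (simp add: has_bochner_integral_iff)
qed

lemma integrable_hl_exp_bound:
  assumes "x > 0" "continuous_on {0<..} f" "\<And>t. t > 0 \<Longrightarrow> \<bar>f t\<bar> \<le> C * exp (- x * t)"
  shows "integrable hl f"
  by (rule integrable_hl_bound[OF assms(2) _ assms(3)]) (use integrable_hl_exp(1)[OF assms(1)] in auto)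

text \<open>Every weight is at most (1 + z)^3 with z = 2 x sinh t, so one exponential majorant
  serves all integrands. The factor cosh t \<le> 1 + z / (2x) costs 1 / x, harmless for fixed
  x.\<close>

lemma zK1_sinh_bounds:
  assumes x: "x > 0" and t: "t > 0"
  shows "zK1 (2 * x * sinh t) \<le> 768 * exp (- x * t)"
    and "z2K0 (2 * x * sinh t) \<le> 768 * exp (- x * t)"
    and "(2 * x * sinh t)\<^sup>2 * zK1 (2 * x * sinh t) \<le> 768 * exp (- x * t)"
    and "cosh t * zK1 (2 * x * sinh t) \<le> (1 + 1 / x) * 768 * exp (- x * t)"
proof -
  define z where "z = 2 * x * sinh t"
  have z: "z > 0" using x t by (simp add: z_def)
  have p1: "1 \<le> (1 + z) ^ 3" using z by (simp add: power_numeral_reduce algebra_simps)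
  have p2: "z \<le> (1 + z) ^ 3" using z by (simp add: power_numeral_reduce algebra_simps add_nonneg_nonneg)
  have p3: "z\<^sup>2 \<le> (1 + z) ^ 3" using z by (simp add: power_numeral_reduce power2_eq_square algebra_simps add_nonneg_nonneg)
  show "zK1 (2 * x * sinh t) \<le> 768 * exp (- x * t)"
    using zK1_sinh_power_le[OF x t, of 1] p1 by (simp add: z_def)
  show "z2K0 (2 * x * sinh t) \<le> 768 * exp (- x * t)"
    using zK1_sinh_power_le[OF x t, of z] p2 z z2K0_le_zK1[OF z] by (simp add: z_def)
  show "(2 * x * sinh t)\<^sup>2 * zK1 (2 * x * sinh t) \<le> 768 * exp (- x * t)"
    using zK1_sinh_power_le[OF x t, of "z\<^sup>2"] p3 z by (simp add: z_def)
  have "cosh t \<le> 1 + sinh t" using t by (intro cosh_le_1_plus_sinh) auto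
  also have "sinh t = (1 / x) * (z / 2)" using x by (simp add: z_def)
  also have "1 + (1 / x) * (z / 2) \<le> (1 + 1 / x) * (1 + z)"
    using x z by (simp add: field_simps)
  also have "1 + z \<le> (1 + z) ^ 3" using power_increasing[of 1 3 "1 + z"] z by simp
  finally have "cosh t \<le> (1 + 1 / x) * (1 + z) ^ 3" using x by (simp add: mult_left_mono)
  then have "cosh t * zK1 z \<le> (1 + 1 / x) * (1 + z) ^ 3 * zK1 z"
    using zK1_pos[OF z] by (intro mult_right_mono) auto
  also have "\<dots> \<le> (1 + 1 / x) * (768 * exp (- x * t))"
    unfolding mult.assoc using zK1_sinh_poly_le[OF x t] x by (intro mult_left_mono) (auto simp: z_def)
  finally show "cosh t * zK1 (2 * x * sinh t) \<le> (1 + 1 / x) * 768 * exp (- x * t)" by (simp only: z_def mult.assoc)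
qed

lemma abs_mult_trig_le: "\<bar>c\<bar> \<le> 1 \<Longrightarrow> \<bar>a\<bar> \<le> b \<Longrightarrow> \<bar>c * a\<bar> \<le> (b::real)"
  using mult_mono[of "\<bar>c\<bar>" 1 "\<bar>a\<bar>" b] by (simp add: abs_mult)

lemma integrable_nichQ: assumes "x > 0" shows "integrable hl (\<lambda>t. cos (y * t) * zK1 (2 * x * sinh t))"
proof (rule integrable_hl_exp_bound[OF assms, where C = 768])
  fix t :: real assume t: "t > 0"
  show "\<bar>cos (y * t) * zK1 (2 * x * sinh t)\<bar> \<le> 768 * exp (- x * t)"
    using zK1_sinh_bounds(1)[OF assms t] zK1_pos[of "2 * x * sinh t"] assms t by (intro abs_mult_trig_le) auto
qed (use assms in \<open>auto intro!: continuous_intros continuous_on_bessel_sinh\<close>)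

lemma integrable_nichP: assumes "x > 0" shows "integrable hl (\<lambda>t. cos (y * t) * z2K0 (2 * x * sinh t))"
proof (rule integrable_hl_exp_bound[OF assms, where C = 768])
  fix t :: real assume t: "t > 0"
  show "\<bar>cos (y * t) * z2K0 (2 * x * sinh t)\<bar> \<le> 768 * exp (- x * t)"
    using zK1_sinh_bounds(2)[OF assms t] z2K0_nonneg[of "2 * x * sinh t"] assms t by (intro abs_mult_trig_le) auto
qed (use assms in \<open>auto intro!: continuous_intros continuous_on_bessel_sinh\<close>)

text \<open>Here \<open>f'\<close> stands for z d/dz of \<open>f\<close>, not for its derivative;
  the inner factor sinh t then disappears. On the neighbourhood of radius x / 2 the decay exp(-(x/2)
  t) is a common majorant.\<close>

lemma leibniz_sinh:
  assumes x: "x > 0"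
    and int: "\<And>x. x > 0 \<Longrightarrow> integrable hl (\<lambda>t. cos (y * t) * f (2 * x * sinh t))"
    and der: "\<And>z. z > 0 \<Longrightarrow> (f has_real_derivative f' z / z) (at z)"
    and cont: "\<And>x. x > 0 \<Longrightarrow> continuous_on {0<..} (\<lambda>t. f' (2 * x * sinh t))"
    and bound: "\<And>x t. x > 0 \<Longrightarrow> t > 0 \<Longrightarrow> \<bar>f' (2 * x * sinh t)\<bar> \<le> C * exp (- x * t)"
  shows "((\<lambda>x. \<integral>t. cos (y * t) * f (2 * x * sinh t) \<partial>hl) has_real_derivative (\<integral>t. cos (y * t) * f' (2 * x * sinh t) \<partial>hl) / x) (at x)"
proof -
  have C: "C \<ge> 0"
  proof -
    have "0 \<le> C * exp (- x * 1)" using bound[OF x, of 1] by (meson abs_ge_zero order_trans zero_less_one)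
    then show ?thesis by (simp add: zero_le_mult_iff)
  qed
  have "((\<lambda>x. \<integral>t. cos (y * t) * f (2 * x * sinh t) \<partial>hl) has_real_derivative (\<integral>t. cos (y * t) * f' (2 * x * sinh t) / x \<partial>hl)) (at x)"
  proof (rule leibniz_dominated[where e = "x / 2" and f' = "\<lambda>x t. cos (y * t) * f' (2 * x * sinh t) / x" and g = "\<lambda>t. 2 * C / x * exp (- (x / 2) * t)"])
    show "integrable hl (\<lambda>t. cos (y * t) * f (2 * w * sinh t))" if "\<bar>w - x\<bar> < x / 2" for w
      using that x by (intro int) linarith
    show "((\<lambda>w. cos (y * t) * f (2 * w * sinh t)) has_real_derivative cos (y * t) * f' (2 * w * sinh t) / w) (at w)"
      if "\<bar>w - x\<bar> < x / 2" "t \<in> space hl" for w t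
    proof -
      have w: "w > 0" using that x by linarith
      have t: "sinh t > 0" using that by simp
      have "((\<lambda>w. f (2 * w * sinh t)) has_real_derivative f' (2 * w * sinh t) / (2 * w * sinh t) * (2 * sinh t)) (at w)"
        using w t by (intro DERIV_chain2[where f = f] der) (auto intro!: derivative_eq_intros)
      also have "f' (2 * w * sinh t) / (2 * w * sinh t) * (2 * sinh t) = f' (2 * w * sinh t) / w"
        using w t by (simp add: field_simps)
      finally have "((\<lambda>w. f (2 * w * sinh t)) has_real_derivative f' (2 * w * sinh t) / w) (at w)" .
      from DERIV_cmult[OF this, of "cos (y * t)"] show ?thesis by simp
    qed
    show "\<bar>cos (y * t) * f' (2 * w * sinh t) / w\<bar> \<le> 2 * C / x * exp (- (x / 2) * t)"
      if "\<bar>w - x\<bar> < x / 2" "t \<in> space hl" for w t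
    proof -
      have w: "w > x / 2" using that x by linarith
      then have w0: "w > 0" using x by linarith
      have t: "t > 0" using that by simp
      have "\<bar>cos (y * t) * f' (2 * w * sinh t)\<bar> \<le> C * exp (- w * t)"
        using w0 t by (intro abs_mult_trig_le bound) auto
      also have "\<dots> \<le> C * exp (- (x / 2) * t)" using w t C by (intro mult_left_mono) auto
      finally have "\<bar>cos (y * t) * f' (2 * w * sinh t)\<bar> / w \<le> C * exp (- (x / 2) * t) / (x / 2)"
        using w w0 x C by (intro frac_le) auto
      then show ?thesis using w0 by (simp add: abs_mult mult_ac)
    qed
    show "integrable hl (\<lambda>t. 2 * C / x * exp (- (x / 2) * t))"
      using x by (intro integrable_mult_right integrable_hl_exp) auto
    show "(\<lambda>t. cos (y * t) * f' (2 * x * sinh t) / x) \<in> borel_measurable hl"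
      using x by (intro borel_measurable_hl_continuous continuous_intros cont) auto
  qed (use x in auto)
  then show ?thesis by simp
qed

lemma nichN_deriv: assumes "x > 0" shows "(nichN has_real_derivative - nichQ x / x) (at x)"
proof -
  have "((\<lambda>x. \<integral>t. cos (y * t) * K0 (2 * x * sinh t) \<partial>hl) has_real_derivative (\<integral>t. cos (y * t) * (- zK1 (2 * x * sinh t)) \<partial>hl) / x) (at x)"
  proof (rule leibniz_sinh[OF assms integrable_nichN, where C = 768])
    show "\<bar>- zK1 (2 * x * sinh t)\<bar> \<le> 768 * exp (- x * t)" if "x > 0" "t > 0" for x t
      using zK1_sinh_bounds(1)[OF that] zK1_pos[of "2 * x * sinh t"] that by simp
  qed (use K0_deriv in \<open>auto intro!: continuous_intros continuous_on_bessel_sinh\<close>)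
  then show ?thesis by (simp add: nichN_def[abs_def] nichQ_def)
qed

lemma nichQ_deriv: assumes "x > 0" shows "(nichQ has_real_derivative - nichP x / x) (at x)"
proof -
  have "((\<lambda>x. \<integral>t. cos (y * t) * zK1 (2 * x * sinh t) \<partial>hl) has_real_derivative (\<integral>t. cos (y * t) * (- z2K0 (2 * x * sinh t)) \<partial>hl) / x) (at x)"
  proof (rule leibniz_sinh[OF assms integrable_nichQ, where C = 768])
    show "\<bar>- z2K0 (2 * x * sinh t)\<bar> \<le> 768 * exp (- x * t)" if "x > 0" "t > 0" for x t
      using zK1_sinh_bounds(2)[OF that] z2K0_nonneg[of "2 * x * sinh t"] by simp
    show "(zK1 has_real_derivative - z2K0 z / z) (at z)" if "z > 0" for z
      using zK1_deriv[OF that] that by (simp add: z2K0_def power2_eq_square)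
  qed (auto intro!: continuous_intros continuous_on_bessel_sinh)
  then show ?thesis by (simp add: nichQ_def[abs_def] nichP_def)
qed

lemma abs_sin_cos_mult_le: "0 \<le> a \<Longrightarrow> a \<le> b \<Longrightarrow> \<bar>sin u * a\<bar> \<le> b" "0 \<le> a \<Longrightarrow> a \<le> b \<Longrightarrow> \<bar>cos u * a\<bar> \<le> (b::real)"
  by (intro abs_mult_trig_le; simp)+

text \<open>Minus the t-derivative of \<open>zK1 (2 * x * sinh t)\<close>. It tends to 0 with t
  because z K_0(z) does, so it leaves no boundary term at the origin.\<close>

definition zK1_slope :: "real \<Rightarrow> real \<Rightarrow> real" where
  "zK1_slope x t = 2 * x * cosh t * (2 * x * sinh t * K0 (2 * x * sinh t))"

lemma continuous_on_zK1_slope: "x > 0 \<Longrightarrow> continuous_on {0<..} (zK1_slope x)"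
  unfolding zK1_slope_def[abs_def] by (intro continuous_intros continuous_on_bessel_sinh)

lemma zK1_slope_nonneg: "x > 0 \<Longrightarrow> t > 0 \<Longrightarrow> zK1_slope x t \<ge> 0"
  unfolding zK1_slope_def using K0_nonneg[of "2 * x * sinh t"] by simp

lemma zK1_slope_le:
  assumes x: "x > 0" and t: "t > 0"
  shows "zK1_slope x t \<le> 2 * x * ((1 + 1 / x) * 768) * exp (- x * t)"
proof -
  have z: "2 * x * sinh t > 0" using x t by simp
  have "zK1_slope x t \<le> 2 * x * (cosh t * zK1 (2 * x * sinh t))"
    unfolding zK1_slope_def mult.assoc using x K0_le_zK1[OF z] by (intro mult_left_mono) (auto simp: mult_ac)
  also have "\<dots> \<le> 2 * x * ((1 + 1 / x) * 768 * exp (- x * t))"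
    using zK1_sinh_bounds(4)[OF x t] x by (intro mult_left_mono) auto
  finally show ?thesis by (simp only: mult.assoc)
qed

lemma zK1_sinh_deriv:
  assumes x: "x > 0" and t: "t > 0"
  shows "((\<lambda>t. zK1 (2 * x * sinh t)) has_real_derivative - zK1_slope x t) (at t)"
proof -
  have z: "2 * x * sinh t > 0" using x t by simp
  have "((\<lambda>t. 2 * x * sinh t) has_real_derivative 2 * x * cosh t) (at t)"
    by (auto intro!: derivative_eq_intros)
  from DERIV_chain2[OF zK1_deriv[OF z] this] show ?thesis by (simp add: zK1_slope_def mult_ac)
qed

lemma K0_sinh_deriv:
  assumes x: "x > 0" and t: "t > 0"
  shows "((\<lambda>t. K0 (2 * x * sinh t)) has_real_derivative - (cosh t / sinh t * zK1 (2 * x * sinh t))) (at t)"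
proof -
  have z: "2 * x * sinh t > 0" using x t by simp
  have "((\<lambda>t. 2 * x * sinh t) has_real_derivative 2 * x * cosh t) (at t)"
    by (auto intro!: derivative_eq_intros)
  from DERIV_chain2[OF K0_deriv[OF z] this] show ?thesis using x by (simp add: mult_ac)
qed

text \<open>With z = 2 x sinh t, the split 4 x^2 cosh^2 t = 4 x^2 + z^2 isolates z d/dz of
  \<open>z2K0\<close>, that is, the integrand of \<theta> \<open>nichP\<close>. The rest is a
  multiple of \<open>K0\<close> and \<open>zK1\<close>, which is why the system closes.\<close>

lemma zK1_slope_deriv:
  assumes x: "x > 0" and t: "t > 0"
  shows "(zK1_slope x has_real_derivative 2 * z2K0 (2 * x * sinh t) - (2 * x * sinh t)\<^sup>2 * zK1 (2 * x * sinh t)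
            + 4 * x\<^sup>2 * (K0 (2 * x * sinh t) - zK1 (2 * x * sinh t))) (at t)"
proof -
  define z where "z = 2 * x * sinh t"
  have s: "sinh t > 0" using t by simp
  have "((\<lambda>t. 2 * x * cosh t * (2 * x * sinh t * K0 (2 * x * sinh t))) has_real_derivative
      2 * x * sinh t * (z * K0 z) + (2 * x * cosh t * K0 z + - (cosh t / sinh t * zK1 z) * (2 * x * sinh t)) * (2 * x * cosh t)) (at t)"
    unfolding z_def
    by (intro DERIV_mult K0_sinh_deriv x t) (auto intro!: derivative_eq_intros)
  also have "2 * x * sinh t * (z * K0 z) + (2 * x * cosh t * K0 z + - (cosh t / sinh t * zK1 z) * (2 * x * sinh t)) * (2 * x * cosh t)
     = z\<^sup>2 * K0 z + 4 * x\<^sup>2 * (cosh t)\<^sup>2 * (K0 z - zK1 z)"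
    using s by (simp add: z_def field_simps power2_eq_square)
  also have "4 * x\<^sup>2 * (cosh t)\<^sup>2 = 4 * x\<^sup>2 + z\<^sup>2"
    by (simp add: z_def cosh_square_eq algebra_simps)
  finally show ?thesis
    by (simp add: zK1_slope_def[abs_def] z_def z2K0_def algebra_simps)
qed

lemma zK1_tendsto_0: "(zK1 \<longlongrightarrow> 1) (at_right 0)"
proof (rule tendsto_sandwich)
  show "\<forall>\<^sub>F z in at_right 0. exp (- z) \<le> zK1 z" "\<forall>\<^sub>F z in at_right 0. zK1 z \<le> 1"
    using zK1_ge_exp_and_le(1) zK1_le_1 by (auto simp: eventually_at_filter)
  show "((\<lambda>z::real. exp (- z)) \<longlongrightarrow> 1) (at_right 0)" by (auto intro!: tendsto_eq_intros)
qed simp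

lemma sinh_tendsto_0: assumes "x > (0::real)" shows "filterlim (\<lambda>t. 2 * x * sinh t) (at_right 0) (at_right 0)"
proof -
  have "((\<lambda>t. 2 * x * sinh t) \<longlongrightarrow> 0) (at_right 0)" by (auto intro!: tendsto_eq_intros)
  then show ?thesis using assms by (auto simp: filterlim_at eventually_at_filter)
qed

lemma zK1_sinh_tendsto_0: "x > 0 \<Longrightarrow> ((\<lambda>t. zK1 (2 * x * sinh t)) \<longlongrightarrow> 1) (at_right 0)"
  by (rule filterlim_compose[OF zK1_tendsto_0 sinh_tendsto_0])

lemma z_K0_tendsto_0: "((\<lambda>z. z * K0 z) \<longlongrightarrow> 0) (at_right 0)"
proof (rule Lim_null_comparison)
  show "\<forall>\<^sub>F z in at_right 0. norm (z * K0 z) \<le> 4 * sqrt z"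
  proof -
    have "norm (z * K0 z) \<le> 4 * sqrt z" if "z > 0" for z
    proof -
      have "z * K0 z \<le> z * (4 / sqrt z)" using K0_le_sqrt[OF that] that by (intro mult_left_mono) auto
      also have "\<dots> = 4 * (z / sqrt z)" by simp
      also have "\<dots> = 4 * sqrt z" using that by (simp only: real_div_sqrt less_imp_le)
      finally show ?thesis using that K0_nonneg[of z] by (simp add: abs_mult)
    qed
    then show ?thesis by (auto simp: eventually_at_filter)
  qed
  show "((\<lambda>z. 4 * sqrt z) \<longlongrightarrow> 0) (at_right 0)" by (auto intro!: tendsto_eq_intros)
qed

lemma zK1_slope_tendsto_0: assumes "x > 0" shows "(zK1_slope x \<longlongrightarrow> 0) (at_right 0)"
proof -
  have "((\<lambda>t. 2 * x * cosh t * (2 * x * sinh t * K0 (2 * x * sinh t))) \<longlongrightarrow> 2 * x * cosh 0 * 0) (at_right 0)"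
    by (intro tendsto_intros filterlim_compose[OF z_K0_tendsto_0 sinh_tendsto_0[OF assms]])
  then show ?thesis by (simp add: zK1_slope_def[abs_def])
qed

lemma tendsto_0_exp_bound:
  assumes "x > 0" "\<And>t. t > 0 \<Longrightarrow> \<bar>f t\<bar> \<le> C * exp (- x * t)"
  shows "(f \<longlongrightarrow> (0::real)) at_top"
proof (rule Lim_null_comparison)
  show "\<forall>\<^sub>F t in at_top. norm (f t) \<le> C * exp (- x * t)"
    using assms(2) by (auto intro: eventually_mono[OF eventually_gt_at_top[of 0]])
  show "((\<lambda>t. C * exp (- x * t)) \<longlongrightarrow> 0) at_top"
    using tendsto_mult_right_zero[OF tendsto_exp_minus_mult[OF assms(1)]] .
qed

text \<open>Differentiating under the integral leaves a combination that closes the system only after two integrations by parts in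
  \<open>t\<close>, encoded by the antiderivative \<open>?F\<close>.\<close>

lemma nichP_deriv:
  assumes x: "x > 0"
  shows "(nichP has_real_derivative (y\<^sup>2 * nichQ x - 4 * x\<^sup>2 * (nichN x - nichQ x)) / x) (at x)"
proof -
  define R where "R = (\<integral>t. cos (y * t) * (2 * z2K0 (2 * x * sinh t) - (2 * x * sinh t)\<^sup>2 * zK1 (2 * x * sinh t)) \<partial>hl)"
  have b: "\<bar>2 * z2K0 (2 * x * sinh t) - (2 * x * sinh t)\<^sup>2 * zK1 (2 * x * sinh t)\<bar> \<le> (2 * 768) * exp (- x * t)" if "x > 0" "t > 0" for x t
  proof -
    have "0 \<le> (2 * x * sinh t)\<^sup>2 * zK1 (2 * x * sinh t)"
      using zK1_pos[of "2 * x * sinh t"] that by simp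
    then show ?thesis
      using zK1_sinh_bounds(2,3)[OF that] z2K0_nonneg[of "2 * x * sinh t"] by (simp only: abs_le_iff) linarith
  qed
  have iR: "integrable hl (\<lambda>t. cos (y * t) * (2 * z2K0 (2 * x * sinh t) - (2 * x * sinh t)\<^sup>2 * zK1 (2 * x * sinh t)))"
    by (rule integrable_hl_exp_bound[OF x _ abs_mult_trig_le[OF _ b]])
       (use x in \<open>auto intro!: continuous_intros continuous_on_bessel_sinh\<close>)
  have "((\<lambda>x. \<integral>t. cos (y * t) * z2K0 (2 * x * sinh t) \<partial>hl) has_real_derivative R / x) (at x)"
    unfolding R_def
  proof (rule leibniz_sinh[OF x integrable_nichP, where C = "2 * 768" and f' = "\<lambda>z. 2 * z2K0 z - z\<^sup>2 * zK1 z"])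
    show "(z2K0 has_real_derivative (2 * z2K0 z - z\<^sup>2 * zK1 z) / z) (at z)" if "z > 0" for z
      using z2K0_deriv[OF that] that by (simp add: z2K0_def power2_eq_square diff_divide_distrib mult.assoc)
  qed (use b in \<open>auto intro!: continuous_intros continuous_on_bessel_sinh\<close>)
  moreover have "R = y\<^sup>2 * nichQ x - 4 * x\<^sup>2 * (nichN x - nichQ x)"
  proof -
    let ?f = "\<lambda>t. y\<^sup>2 * (cos (y * t) * zK1 (2 * x * sinh t)) - (cos (y * t) * (2 * z2K0 (2 * x * sinh t) - (2 * x * sinh t)\<^sup>2 * zK1 (2 * x * sinh t))
       + 4 * x\<^sup>2 * (cos (y * t) * K0 (2 * x * sinh t) - cos (y * t) * zK1 (2 * x * sinh t)))"
    let ?F = "\<lambda>t. y * (sin (y * t) * zK1 (2 * x * sinh t)) - cos (y * t) * zK1_slope x t"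
    have i: "integrable hl ?f"
      using iR integrable_nichN[OF x] integrable_nichQ[OF x] by auto
    have "integral\<^sup>L hl ?f = 0 - 0"
    proof (rule integral_hl_FTC[where F = ?F, OF _ _ i])
      fix t :: real assume t: "t > 0"
      have "(?F has_real_derivative y * (cos (y * t) * y * zK1 (2 * x * sinh t) + - zK1_slope x t * sin (y * t))
         - (- sin (y * t) * y * zK1_slope x t + (2 * z2K0 (2 * x * sinh t) - (2 * x * sinh t)\<^sup>2 * zK1 (2 * x * sinh t)
            + 4 * x\<^sup>2 * (K0 (2 * x * sinh t) - zK1 (2 * x * sinh t))) * cos (y * t))) (at t)"
        by (intro DERIV_diff DERIV_cmult DERIV_mult zK1_sinh_deriv zK1_slope_deriv x t) (auto intro!: derivative_eq_intros)
      then show "(?F has_real_derivative ?f t) (at t)"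
        by (simp add: algebra_simps power2_eq_square)
    next
      show "continuous_on {0<..} ?f"
        using x by (intro continuous_intros continuous_on_bessel_sinh) auto
      have "(?F \<longlongrightarrow> y * (sin (y * 0) * 1) - cos (y * 0) * 0) (at_right 0)"
        by (intro tendsto_intros zK1_sinh_tendsto_0 zK1_slope_tendsto_0 x)
      then show "(?F \<longlongrightarrow> 0) (at_right 0)" by simp
      have "((\<lambda>t. sin (y * t) * zK1 (2 * x * sinh t)) \<longlongrightarrow> 0) at_top"
        by (rule tendsto_0_exp_bound[OF x abs_sin_cos_mult_le(1)[OF less_imp_le[OF zK1_pos] zK1_sinh_bounds(1)[OF x]]])
           (use x in auto)
      moreover have "((\<lambda>t. cos (y * t) * zK1_slope x t) \<longlongrightarrow> 0) at_top"
        by (rule tendsto_0_exp_bound[OF x abs_sin_cos_mult_le(2)[OF zK1_slope_nonneg zK1_slope_le]]) (use x in auto)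
      ultimately have "(?F \<longlongrightarrow> y * 0 - 0) at_top" by (intro tendsto_intros)
      then show "(?F \<longlongrightarrow> 0) at_top" by simp
    qed
    moreover have "integral\<^sup>L hl ?f = y\<^sup>2 * nichQ x - (R + 4 * x\<^sup>2 * (nichN x - nichQ x))"
      using iR integrable_nichN[OF x] integrable_nichQ[OF x] by (simp add: nichQ_def nichN_def R_def)
    ultimately show ?thesis by simp
  qed
  ultimately show ?thesis by (simp add: nichP_def[abs_def])
qed

end

section \<open>Nicholson's integral: behaviour at the origin\<close>

lemma integrable_nR:
  assumes x: "x > 0"
  shows "integrable hl (\<lambda>t. sin (y * t) * z2K0 (2 * x * sinh t))"
    and "integrable hl (\<lambda>t. sin (y * t) * zK1 (2 * x * sinh t))"
    and "integrable hl (\<lambda>t. sin (y * t) * zK1_slope x t)"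
    and "integrable hl (\<lambda>t. cos (y * t) * zK1_slope x t)"
proof -
  show "integrable hl (\<lambda>t. sin (y * t) * z2K0 (2 * x * sinh t))"
    by (rule integrable_hl_exp_bound[OF x _ abs_sin_cos_mult_le(1)[OF z2K0_nonneg zK1_sinh_bounds(2)[OF x]]])
       (use x in \<open>auto intro!: continuous_intros continuous_on_bessel_sinh\<close>)
  show "integrable hl (\<lambda>t. sin (y * t) * zK1 (2 * x * sinh t))"
    by (rule integrable_hl_exp_bound[OF x _ abs_sin_cos_mult_le(1)[OF less_imp_le[OF zK1_pos] zK1_sinh_bounds(1)[OF x]]])
       (use x in \<open>auto intro!: continuous_intros continuous_on_bessel_sinh\<close>)
  show "integrable hl (\<lambda>t. sin (y * t) * zK1_slope x t)"
    by (rule integrable_hl_exp_bound[OF x _ abs_sin_cos_mult_le(1)[OF zK1_slope_nonneg zK1_slope_le]])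
       (use x in \<open>auto intro!: continuous_intros continuous_on_zK1_slope\<close>)
  show "integrable hl (\<lambda>t. cos (y * t) * zK1_slope x t)"
    by (rule integrable_hl_exp_bound[OF x _ abs_sin_cos_mult_le(2)[OF zK1_slope_nonneg zK1_slope_le]])
       (use x in \<open>auto intro!: continuous_intros continuous_on_zK1_slope\<close>)
qed

text \<open>Integration by parts trades \<open>zK1\<close> for its slope in t, which is close enough
  to \<open>z2K0\<close> to lead to the Gamma square.\<close>

lemma nichQ_eq_zK1_slope:
  assumes x: "x > 0"
  shows "y * nichQ y x = (\<integral>t. sin (y * t) * zK1_slope x t \<partial>hl)"
proof -
  let ?f = "\<lambda>t. y * (cos (y * t) * zK1 (2 * x * sinh t)) - sin (y * t) * zK1_slope x t"
  let ?F = "\<lambda>t. sin (y * t) * zK1 (2 * x * sinh t)"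
  have i: "integrable hl ?f" using integrable_nichQ[OF x] integrable_nR[OF x] by auto
  have "integral\<^sup>L hl ?f = 0 - 0"
  proof (rule integral_hl_FTC[where F = ?F, OF _ _ i])
    fix t :: real assume t: "t > 0"
    have "(?F has_real_derivative cos (y * t) * y * zK1 (2 * x * sinh t) + - zK1_slope x t * sin (y * t)) (at t)"
      by (intro DERIV_mult zK1_sinh_deriv x t) (auto intro!: derivative_eq_intros)
    then show "(?F has_real_derivative ?f t) (at t)" by (simp add: algebra_simps)
  next
    show "continuous_on {0<..} ?f"
      using x by (intro continuous_intros continuous_on_bessel_sinh continuous_on_zK1_slope) auto
    have "(?F \<longlongrightarrow> sin (y * 0) * 1) (at_right 0)" by (intro tendsto_intros zK1_sinh_tendsto_0 x)
    then show "(?F \<longlongrightarrow> 0) (at_right 0)" by simp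
    show "(?F \<longlongrightarrow> 0) at_top"
      by (rule tendsto_0_exp_bound[OF x abs_sin_cos_mult_le(1)[OF less_imp_le[OF zK1_pos] zK1_sinh_bounds(1)[OF x]]])
         (use x in auto)
  qed
  then show ?thesis using integrable_nichQ[OF x] integrable_nR[OF x] by (simp add: nichQ_def)
qed

text \<open>The companion integration by parts. The boundary value 1 of \<open>zK1\<close> at 0
  later joins \<open>y * cothC y\<close> in the constant term.\<close>

lemma integral_sin_zK1:
  assumes x: "x > 0"
  shows "y * (\<integral>t. sin (y * t) * zK1 (2 * x * sinh t) \<partial>hl) = 1 - (\<integral>t. cos (y * t) * zK1_slope x t \<partial>hl)"
proof -
  let ?f = "\<lambda>t. - (cos (y * t) * zK1_slope x t) - y * (sin (y * t) * zK1 (2 * x * sinh t))"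
  let ?F = "\<lambda>t. cos (y * t) * zK1 (2 * x * sinh t)"
  have i: "integrable hl ?f" using integrable_nR[OF x] by auto
  have "integral\<^sup>L hl ?f = 0 - 1"
  proof (rule integral_hl_FTC[where F = ?F, OF _ _ i])
    fix t :: real assume t: "t > 0"
    have "(?F has_real_derivative - sin (y * t) * y * zK1 (2 * x * sinh t) + - zK1_slope x t * cos (y * t)) (at t)"
      by (intro DERIV_mult zK1_sinh_deriv x t) (auto intro!: derivative_eq_intros)
    then show "(?F has_real_derivative ?f t) (at t)" by (simp add: algebra_simps)
  next
    show "continuous_on {0<..} ?f"
      using x by (intro continuous_intros continuous_on_bessel_sinh continuous_on_zK1_slope) auto
    have "(?F \<longlongrightarrow> cos (y * 0) * 1) (at_right 0)" by (intro tendsto_intros zK1_sinh_tendsto_0 x)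
    then show "(?F \<longlongrightarrow> 1) (at_right 0)" by simp
    show "(?F \<longlongrightarrow> 0) at_top"
      by (rule tendsto_0_exp_bound[OF x abs_sin_cos_mult_le(2)[OF less_imp_le[OF zK1_pos] zK1_sinh_bounds(1)[OF x]]])
         (use x in auto)
  qed
  then show ?thesis using integrable_nR[OF x] by simp
qed

lemma integrable_coth_zK1:
  assumes x: "x > 0"
  shows "integrable hl (\<lambda>t. sin (y * t) * (cosh t / sinh t * zK1 (2 * x * sinh t)))"
proof (rule integrable_hl_exp_bound[OF x])
  show "continuous_on {0<..} (\<lambda>t. sin (y * t) * (cosh t / sinh t * zK1 (2 * x * sinh t)))"
    using x by (intro continuous_intros continuous_on_bessel_sinh) auto
  fix t :: real assume t: "t > 0"
  have s: "sinh t > 0" using t by simp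
  have h: "zK1 (2 * x * sinh t) > 0" using x t by (intro zK1_pos) auto
  have "\<bar>sin (y * t)\<bar> \<le> \<bar>y\<bar> * t" using t by (intro abs_sin_le) auto
  also have "\<dots> \<le> \<bar>y\<bar> * sinh t" using sinh_ge_arg[of t] t by (intro mult_left_mono) auto
  finally have "\<bar>sin (y * t)\<bar> * (cosh t / sinh t * zK1 (2 * x * sinh t)) \<le> \<bar>y\<bar> * sinh t * (cosh t / sinh t * zK1 (2 * x * sinh t))"
    using s h by (intro mult_right_mono) auto
  also have "\<dots> = \<bar>y\<bar> * (cosh t * zK1 (2 * x * sinh t))" using s by simp
  also have "\<dots> \<le> \<bar>y\<bar> * ((1 + 1 / x) * 768 * exp (- x * t))"
    using zK1_sinh_bounds(4)[OF x t] by (intro mult_left_mono) auto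
  finally show "\<bar>sin (y * t) * (cosh t / sinh t * zK1 (2 * x * sinh t))\<bar> \<le> (\<bar>y\<bar> * ((1 + 1 / x) * 768)) * exp (- x * t)"
    using s h by (simp add: abs_mult mult.assoc)
qed

text \<open>Integrating by parts makes the limit \<open>x \<rightarrow> 0\<close> accessible: unlike \<open>K0\<close>, \<open>zK1\<close> stays bounded at \<open>0\<close>.\<close>

lemma nichN_eq_coth:
  assumes x: "x > 0"
  shows "y * nichN y x = (\<integral>t. sin (y * t) * (cosh t / sinh t * zK1 (2 * x * sinh t)) \<partial>hl)"
proof -
  let ?f = "\<lambda>t. y * (cos (y * t) * K0 (2 * x * sinh t)) - sin (y * t) * (cosh t / sinh t * zK1 (2 * x * sinh t))"
  let ?F = "\<lambda>t. sin (y * t) * K0 (2 * x * sinh t)"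
  have i: "integrable hl ?f" using integrable_nichN[OF x] integrable_coth_zK1[OF x] by auto
  have "integral\<^sup>L hl ?f = 0 - 0"
  proof (rule integral_hl_FTC[where F = ?F, OF _ _ i])
    fix t :: real assume t: "t > 0"
    have "(?F has_real_derivative cos (y * t) * y * K0 (2 * x * sinh t) + - (cosh t / sinh t * zK1 (2 * x * sinh t)) * sin (y * t)) (at t)"
      by (intro DERIV_mult K0_sinh_deriv x t) (auto intro!: derivative_eq_intros)
    then show "(?F has_real_derivative ?f t) (at t)" by (simp add: algebra_simps)
  next
    show "continuous_on {0<..} ?f"
      using x by (intro continuous_intros continuous_on_bessel_sinh continuous_on_zK1_slope) auto
    \<comment> \<open>\<open>K0\<close> is unbounded at 0, but sin(yt) is of order sinh t, so the
      boundary term is controlled by z K_0(z) with z = 2 x sinh t.\<close>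
    show "(?F \<longlongrightarrow> 0) (at_right 0)"
    proof (rule Lim_null_comparison)
      have "norm (?F t) \<le> \<bar>y\<bar> / (2 * x) * (2 * x * sinh t * K0 (2 * x * sinh t))" if t: "t > 0" for t
      proof -
        have "\<bar>sin (y * t)\<bar> \<le> \<bar>y\<bar> * t" using t by (intro abs_sin_le) auto
        also have "\<dots> \<le> \<bar>y\<bar> * sinh t" using sinh_ge_arg[of t] t by (intro mult_left_mono) auto
        finally have "\<bar>sin (y * t)\<bar> * K0 (2 * x * sinh t) \<le> \<bar>y\<bar> * sinh t * K0 (2 * x * sinh t)"
          using K0_nonneg by (intro mult_right_mono) auto
        then show ?thesis using x by (simp add: abs_mult K0_nonneg)
      qed
      then show "\<forall>\<^sub>F t in at_right 0. norm (?F t) \<le> \<bar>y\<bar> / (2 * x) * (2 * x * sinh t * K0 (2 * x * sinh t))"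
        by (auto simp: eventually_at_filter)
      show "((\<lambda>t. \<bar>y\<bar> / (2 * x) * (2 * x * sinh t * K0 (2 * x * sinh t))) \<longlongrightarrow> 0) (at_right 0)"
        by (intro tendsto_mult_right_zero filterlim_compose[OF z_K0_tendsto_0 sinh_tendsto_0[OF x]])
    qed
    show "(?F \<longlongrightarrow> 0) at_top"
    proof (rule Lim_null_comparison)
      have "norm (?F t) \<le> 4 / sqrt (2 * x * t)" if t: "t > 0" for t
      proof -
        have "norm (?F t) \<le> K0 (2 * x * t)"
          using abs_sin_cos_mult_le(1)[OF K0_nonneg K0_sinh_le[OF x t], of "y * t"] by simp
        also have "\<dots> \<le> 4 / sqrt (2 * x * t)" using x t by (intro K0_le_sqrt) auto
        finally show ?thesis .
      qed
      then show "\<forall>\<^sub>F t in at_top. norm (?F t) \<le> 4 / sqrt (2 * x * t)"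
        by (auto intro: eventually_mono[OF eventually_gt_at_top[of 0]])
      show "((\<lambda>t. 4 / sqrt (2 * x * t)) \<longlongrightarrow> 0) at_top" using x by real_asymp
    qed
  qed
  then show ?thesis using integrable_nichN[OF x] integrable_coth_zK1[OF x] by (simp add: nichN_def)
qed

lemma abs_integral_le_exp:
  assumes i: "integrable hl f" and b: "\<And>t. t > 0 \<Longrightarrow> \<bar>f t\<bar> \<le> C * exp (- t)"
  shows "\<bar>integral\<^sup>L hl f\<bar> \<le> C"
proof -
  have "\<bar>integral\<^sup>L hl f\<bar> \<le> (\<integral>t. C * exp (- 1 * t) \<partial>hl)"
    by (rule integral_abs_bound_integral[OF i]) (use b integrable_hl_exp(1)[of 1] in auto)
  also have "\<dots> = C" using integrable_hl_exp(2)[of 1] by simp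
  finally show ?thesis .
qed

text \<open>The two differ by cosh t - sinh t = exp(-t) in one factor, and z K_0(z) \<le> 1; after
  integration over t the replacement costs only O(x).\<close>

lemma zK1_slope_minus_z2K0_le:
  assumes x: "x > 0" and t: "t > 0"
  shows "\<bar>zK1_slope x t - z2K0 (2 * x * sinh t)\<bar> \<le> 2 * x * exp (- t)"
proof -
  define z where "z = 2 * x * sinh t"
  have z: "z > 0" using x t by (simp add: z_def)
  have "zK1_slope x t - z2K0 z = 2 * x * (cosh t - sinh t) * (z * K0 z)"
    by (simp add: zK1_slope_def z2K0_def z_def algebra_simps power2_eq_square)
  also have "\<dots> = 2 * x * exp (- t) * (z * K0 z)" by (simp add: cosh_minus_sinh)
  finally have e: "zK1_slope x t - z2K0 z = 2 * x * exp (- t) * (z * K0 z)" .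
  have "0 \<le> z * K0 z" "z * K0 z \<le> 1"
    using z K0_nonneg[of z] K0_le_zK1[OF z] zK1_le_1[OF z] by auto
  then show ?thesis unfolding z_def[symmetric] e using x mult_left_mono[of "z * K0 z" 1 "2 * x * exp (- t)"]
    by (simp add: abs_mult)
qed

lemma nichQ_asymp_sin:
  assumes x: "x > 0"
  shows "\<bar>y * nichQ y x - (\<integral>t. sin (y * t) * z2K0 (2 * x * sinh t) \<partial>hl)\<bar> \<le> 2 * x"
proof -
  have "y * nichQ y x - (\<integral>t. sin (y * t) * z2K0 (2 * x * sinh t) \<partial>hl)
      = (\<integral>t. sin (y * t) * (zK1_slope x t - z2K0 (2 * x * sinh t)) \<partial>hl)"
    unfolding nichQ_eq_zK1_slope[OF x] right_diff_distrib using integrable_nR[OF x] by simp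
  also have "\<bar>\<dots>\<bar> \<le> 2 * x"
  proof (rule abs_integral_le_exp)
    show "integrable hl (\<lambda>t. sin (y * t) * (zK1_slope x t - z2K0 (2 * x * sinh t)))"
      unfolding right_diff_distrib using integrable_nR[OF x] by auto
  qed (use zK1_slope_minus_z2K0_le[OF x] in \<open>auto intro!: abs_mult_trig_le\<close>)
  finally show ?thesis .
qed

text \<open>Write coth * zK1 = (coth - 1)(zK1 - 1) + (coth - 1) + zK1. The second part gives
  \<open>cothC\<close>, the third is \<open>integral_sin_zK1\<close>, and the first is the
  error.\<close>

lemma nichN_asymp_nichP:
  assumes x: "x > 0" and y: "y > 0"
  shows "\<bar>y\<^sup>2 * nichN y x - (1 + y * cothC y - nichP y x)\<bar> \<le> (2 * y + 2) * x"
proof -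
  \<comment> \<open>Small because 1 - zK1 z \<le> z cancels the pole of coth t - 1 = exp(-t) / sinh
    t.\<close>
  define E where "E = (\<integral>t. sin (y * t) * ((cosh t / sinh t - 1) * (zK1 (2 * x * sinh t) - 1)) \<partial>hl)"
  have iE: "integrable hl (\<lambda>t. sin (y * t) * (cosh t / sinh t * zK1 (2 * x * sinh t)) - sin (y * t) * zK1 (2 * x * sinh t) - (cosh t / sinh t - 1) * sin (y * t))"
    using integrable_coth_zK1[OF x] integrable_nR(2)[OF x] cothC_integrable by (intro Bochner_Integration.integrable_diff)
  have "(\<integral>t. sin (y * t) * (cosh t / sinh t * zK1 (2 * x * sinh t)) - sin (y * t) * zK1 (2 * x * sinh t) - (cosh t / sinh t - 1) * sin (y * t) \<partial>hl)
     = y * nichN y x - (\<integral>t. sin (y * t) * zK1 (2 * x * sinh t) \<partial>hl) - cothC y"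
    unfolding nichN_eq_coth[OF x] cothC_def
    using integrable_coth_zK1[OF x, of y] integrable_nR(2)[OF x, of y] cothC_integrable[of y]
    by (simp only: Bochner_Integration.integral_diff Bochner_Integration.integrable_diff)
  then have E: "E = y * nichN y x - (\<integral>t. sin (y * t) * zK1 (2 * x * sinh t) \<partial>hl) - cothC y"
    by (simp add: E_def algebra_simps)
  have absE: "\<bar>E\<bar> \<le> 2 * x"
    unfolding E_def
  proof (rule abs_integral_le_exp)
    show "integrable hl (\<lambda>t. sin (y * t) * ((cosh t / sinh t - 1) * (zK1 (2 * x * sinh t) - 1)))"
      using iE by (simp add: algebra_simps)
    fix t :: real assume t: "t > 0"
    define z where "z = 2 * x * sinh t"
    have z: "z > 0" and s: "sinh t > 0" using x t by (simp_all add: z_def)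
    have "\<bar>(cosh t / sinh t - 1) * (zK1 z - 1)\<bar> = exp (- t) / sinh t * (1 - zK1 z)"
      using s zK1_le_1[OF z] by (simp add: coth_minus_1[OF t] abs_mult)
    also have "\<dots> \<le> exp (- t) / sinh t * z" using s zK1_ge[OF z] by (intro mult_left_mono) auto
    also have "\<dots> = 2 * x * exp (- t)" using s by (simp add: z_def)
    finally show "\<bar>sin (y * t) * ((cosh t / sinh t - 1) * (zK1 (2 * x * sinh t) - 1))\<bar> \<le> 2 * x * exp (- t)"
      by (intro abs_mult_trig_le[of "sin (y * t)"]) (simp_all add: z_def)
  qed
  define E2 where "E2 = (\<integral>t. cos (y * t) * (zK1_slope x t - z2K0 (2 * x * sinh t)) \<partial>hl)"
  have absE2: "\<bar>E2\<bar> \<le> 2 * x"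
    unfolding E2_def
  proof (rule abs_integral_le_exp)
    show "integrable hl (\<lambda>t. cos (y * t) * (zK1_slope x t - z2K0 (2 * x * sinh t)))"
      unfolding right_diff_distrib using integrable_nR[OF x] integrable_nichP[OF x] by auto
  qed (use zK1_slope_minus_z2K0_le[OF x] in \<open>auto intro!: abs_mult_trig_le\<close>)
  have E2: "E2 = (\<integral>t. cos (y * t) * zK1_slope x t \<partial>hl) - nichP y x"
    unfolding E2_def right_diff_distrib nichP_def using integrable_nR[OF x] integrable_nichP[OF x] by simp
  have "y\<^sup>2 * nichN y x = y * (E + (\<integral>t. sin (y * t) * zK1 (2 * x * sinh t) \<partial>hl) + cothC y)"
    unfolding E by (simp add: power2_eq_square)
  also have "\<dots> = y * E + (1 - (E2 + nichP y x)) + y * cothC y"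
    using integral_sin_zK1[OF x, of y] unfolding E2 by (simp add: algebra_simps)
  finally have "y\<^sup>2 * nichN y x - (1 + y * cothC y - nichP y x) = y * E - E2" by simp
  moreover have "\<bar>y * E - E2\<bar> \<le> y * (2 * x) + 2 * x"
  proof -
    have "\<bar>y * E\<bar> \<le> y * (2 * x)" using mult_left_mono[OF absE, of y] y by (simp add: abs_mult)
    then show ?thesis using absE2 abs_triangle_ineq4[of "y * E" E2] by linarith
  qed
  ultimately show ?thesis by (simp add: algebra_simps)
qed

text \<open>The oscillating part of \<open>y\<^sup>2 nichN y x\<close> as \<open>x\<close> tends to \<open>0\<close> is \<open>- Re (nichZ y x)\<close>.\<close>

definition nichZ :: "real \<Rightarrow> real \<Rightarrow> complex" where
  "nichZ y x = exp (- \<i> * of_real (y * ln (x / 2))) * (Gamma (1 + \<i> * of_real y / 2))\<^sup>2"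

text \<open>\<open>Gamma_square_eq_K0\<close> at a = 1 + iy/2, translated by ln(x/2) so that its
  argument 2 exp(c + t) becomes x exp t. The translation produces the phase (x/2)^(-iy).\<close>

lemma nichZ_integral:
  assumes x: "x > 0"
  shows "has_bochner_integral lborel (\<lambda>t. of_real (z2K0 (x * exp t)) * exp (\<i> * of_real (y * t))) (nichZ y x)"
proof -
  define a where "a = 1 + \<i> * complex_of_real y / 2"
  define c where "c = ln (x / 2)"
  have ec: "exp c = x / 2" using x by (simp add: c_def)
  have "Re a > 0" by (simp add: a_def)
  note Gamma_square_eq_K0[OF this]
  from lborel_has_bochner_integral_real_affine_iff[of 1 _ _ c, THEN iffD1, OF _ this]
  have "has_bochner_integral lborel (\<lambda>t. exp (- \<i> * of_real (y * c)) * (4 * exp (2 * a * of_real (c + t)) * of_real (K0 (2 * exp (c + t)))))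
     (exp (- \<i> * of_real (y * c)) * (Gamma a)\<^sup>2)"
    by (intro has_bochner_integral_mult_right) simp
  moreover have "exp (- \<i> * of_real (y * c)) * (4 * exp (2 * a * of_real (c + t)) * of_real (K0 (2 * exp (c + t))))
     = of_real (z2K0 (x * exp t)) * exp (\<i> * of_real (y * t))" for t
  proof -
    have z: "2 * exp (c + t) = x * exp t" by (simp add: exp_add ec)
    have "(2 * exp (c + t))\<^sup>2 = 4 * exp (2 * (c + t))"
      by (simp add: power2_eq_square flip: exp_add)
    then have q: "4 * complex_of_real (exp (2 * (c + t))) = of_real ((x * exp t)\<^sup>2)"
      unfolding z by (metis of_real_mult of_real_numeral)
    have "- \<i> * of_real (y * c) + 2 * a * of_real (c + t) = of_real (2 * (c + t)) + \<i> * of_real (y * t)"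
      by (simp add: a_def algebra_simps)
    then have "exp (- \<i> * of_real (y * c)) * exp (2 * a * of_real (c + t)) = of_real (exp (2 * (c + t))) * exp (\<i> * of_real (y * t))"
      unfolding exp_of_real[symmetric] mult_exp_exp by simp
    then have "exp (- \<i> * of_real (y * c)) * (4 * exp (2 * a * of_real (c + t)) * of_real (K0 (2 * exp (c + t))))
       = (4 * complex_of_real (exp (2 * (c + t)))) * exp (\<i> * of_real (y * t)) * of_real (K0 (2 * exp (c + t)))"
      by (simp add: algebra_simps)
    then show ?thesis unfolding q z by (simp add: z2K0_def mult_ac)
  qed
  ultimately show ?thesis by (simp add: nichZ_def a_def c_def)
qed

text \<open>The negative half-line contributes at most x since z^2 K_0(z) \<le> z. On the positive
  one x exp t - 2 x sinh t = x exp(-t), and the Lipschitz constant 2 gives another 2x. The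
  functional \<open>u\<close> is \<open>Re\<close> or \<open>Im\<close>, which treats cosine and
  sine together.\<close>

lemma nichZ_split:
  assumes x: "x > 0" and u: "bounded_linear u" and c: "\<And>r t. u (of_real r * exp (\<i> * of_real (y * t))) = r * T t" "\<And>t. \<bar>T t\<bar> \<le> 1"
    and T: "continuous_on UNIV T"
    and i: "integrable hl (\<lambda>t. T t * z2K0 (2 * x * sinh t))"
  shows "\<bar>(\<integral>t. T t * z2K0 (2 * x * sinh t) \<partial>hl) - u (nichZ y x)\<bar> \<le> (3::real) * x"
proof -
  have h: "has_bochner_integral lborel (\<lambda>t. z2K0 (x * exp t) * T t) (u (nichZ y x))"
    using has_bochner_integral_bounded_linear[OF u nichZ_integral[OF x, of y]] unfolding c .
  then have ih: "integrable lborel (\<lambda>t. z2K0 (x * exp t) * T t)" by (simp add: has_bochner_integral_iff)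
  note ih2 = integrable_lborel_hl[OF ih]
  have u: "u (nichZ y x) = (\<integral>t. z2K0 (x * exp t) * T t \<partial>hl) + (\<integral>t. z2K0 (x * exp (- t)) * T (- t) \<partial>hl)"
    using integral_lborel_split[OF ih] h by (simp add: has_bochner_integral_iff)
  have 1: "\<bar>\<integral>t. z2K0 (x * exp (- t)) * T (- t) \<partial>hl\<bar> \<le> x"
  proof (rule abs_integral_le_exp[OF ih2(2)])
    fix t :: real assume "t > 0"
    show "\<bar>z2K0 (x * exp (- t)) * T (- t)\<bar> \<le> x * exp (- t)"
      unfolding mult.commute[of _ "T (- t)"]
      using z2K0_le[of "x * exp (- t)"] x z2K0_nonneg[of "x * exp (- t)"] by (intro abs_mult_trig_le c) auto
  qed
  have "\<bar>\<integral>t. T t * z2K0 (2 * x * sinh t) - z2K0 (x * exp t) * T t \<partial>hl\<bar> \<le> 2 * x"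
  proof (rule abs_integral_le_exp)
    show "integrable hl (\<lambda>t. T t * z2K0 (2 * x * sinh t) - z2K0 (x * exp t) * T t)"
      using i ih2(1) by auto
    fix t :: real assume t: "t > 0"
    have e: "x * exp t - 2 * x * sinh t = x * exp (- t)"
    proof -
      have "2 * sinh t = exp t - exp (- t)" by (simp add: sinh_field_def)
      then have "x * (2 * sinh t) = x * (exp t - exp (- t))" by simp
      then show ?thesis by (simp add: algebra_simps)
    qed
    have "\<bar>z2K0 (x * exp t) - z2K0 (2 * x * sinh t)\<bar> \<le> 2 * (x * exp t - 2 * x * sinh t)"
    proof (rule z2K0_Lipschitz)
      show "0 < 2 * x * sinh t" using x t by simp
      have "0 \<le> x * exp (- t)" using x by simp
      then show "2 * x * sinh t \<le> x * exp t" using e by linarith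
    qed
    then have "\<bar>T t * (z2K0 (2 * x * sinh t) - z2K0 (x * exp t))\<bar> \<le> 2 * x * exp (- t)"
      unfolding e by (intro abs_mult_trig_le c) (simp add: abs_minus_commute)
    then show "\<bar>T t * z2K0 (2 * x * sinh t) - z2K0 (x * exp t) * T t\<bar> \<le> 2 * x * exp (- t)"
      by (simp add: algebra_simps)
  qed
  then have "\<bar>(\<integral>t. T t * z2K0 (2 * x * sinh t) \<partial>hl) - (\<integral>t. z2K0 (x * exp t) * T t \<partial>hl)\<bar> \<le> 2 * x"
    using i ih2(1) by simp
  with 1 show ?thesis unfolding u by linarith
qed

lemma nichP_asymp:
  assumes x: "x > 0"
  shows "\<bar>nichP y x - Re (nichZ y x)\<bar> \<le> 3 * x"
  unfolding nichP_def
  by (rule nichZ_split[OF x bounded_linear_Re _ _ _ integrable_nichP[OF x]])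
     (auto simp: Re_exp intro!: continuous_intros)

lemma nichQ_asymp:
  assumes x: "x > 0"
  shows "\<bar>y * nichQ y x - Im (nichZ y x)\<bar> \<le> 5 * x"
proof -
  have "\<bar>(\<integral>t. sin (y * t) * z2K0 (2 * x * sinh t) \<partial>hl) - Im (nichZ y x)\<bar> \<le> 3 * x"
    by (rule nichZ_split[OF x bounded_linear_Im _ _ _ integrable_nR(1)[OF x]])
       (auto simp: Im_exp intro!: continuous_intros)
  with nichQ_asymp_sin[OF x, of y] show ?thesis by linarith
qed

text \<open>The closed form of \<open>cothC\<close> enters here; the Bessel side yields the same
  hyperbolic cotangent from the product of orders iy/2 and -iy/2.\<close>

lemma nichN_asymp:
  assumes x: "x > 0" and y: "y > 0"
  shows "\<bar>y\<^sup>2 * nichN y x - ((pi * y / 2) * (cosh (pi * y / 2) / sinh (pi * y / 2)) - Re (nichZ y x))\<bar> \<le> (2 * y + 5) * x"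
proof -
  have "1 + y * cothC y = (pi * y / 2) * (cosh (pi * y / 2) / sinh (pi * y / 2))"
    unfolding cothC_eq[OF y] using y by (simp add: right_diff_distrib)
  with nichN_asymp_nichP[OF x y] nichP_asymp[OF x, of y] show ?thesis by (simp add: algebra_simps)
qed

section \<open>Bessel functions of the first kind\<close>

definition bcoeff :: "complex \<Rightarrow> nat \<Rightarrow> complex" where
  "bcoeff \<nu> k = (-1) ^ k * rGamma (of_nat k + \<nu> + 1) / of_nat (fact k)"

text \<open>J_\<nu> without its branched factor (x/2)^\<nu>, as an entire function of w = (x/2)^2.
  It is regular at the origin, where the leading terms are read off.\<close>

definition bseries :: "complex \<Rightarrow> complex \<Rightarrow> complex" where
  "bseries \<nu> w = (\<Sum>k. bcoeff \<nu> k * w ^ k)"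

lemma bcoeff_Suc: "of_nat (Suc k) * bcoeff \<nu> (Suc k) = - bcoeff (\<nu> + 1) k"
proof -
  define S where "S = (of_nat (Suc k) :: complex)"
  have S: "S \<noteq> 0" unfolding S_def using of_nat_eq_0_iff[of "Suc k", where 'a = complex] by blast
  have f: "(of_nat (fact (Suc k)) :: complex) = S * of_nat (fact k)"
    by (simp add: S_def algebra_simps)
  have e: "S + \<nu> + 1 = of_nat k + (\<nu> + 1) + 1" by (simp add: S_def)
  show ?thesis
    unfolding bcoeff_def f S_def[symmetric] e using S by simp
qed

lemma bcoeff_rec: "bcoeff \<nu> k = (of_nat k + \<nu> + 1) * bcoeff (\<nu> + 1) k"
  using rGamma_plus1[of "of_nat k + \<nu> + 1"] by (simp add: bcoeff_def algebra_simps)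

lemma summable_bseries: "summable (\<lambda>k. bcoeff \<nu> k * w ^ k)"
proof -
  \<comment> \<open>From \<open>N\<close> on, |n + \<nu> + 1| \<ge> 1 and n + 1 \<ge> 2 |w|, so
    consecutive terms at least halve.\<close>
  define N where "N = nat \<lceil>norm \<nu> + 2 * norm w + 1\<rceil>"
  show ?thesis
  proof (rule summable_ratio_test[where c = "1 / 2" and N = N])
    fix n assume "n \<ge> N"
    then have n: "real n \<ge> norm \<nu> + 2 * norm w + 1"
      unfolding N_def by linarith
    have eq: "of_nat (Suc n) * (of_nat n + \<nu> + 1) * bcoeff \<nu> (Suc n) = - bcoeff \<nu> n"
    proof -
      have "of_nat (Suc n) * (of_nat n + \<nu> + 1) * bcoeff \<nu> (Suc n) = (of_nat n + \<nu> + 1) * (of_nat (Suc n) * bcoeff \<nu> (Suc n))"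
        by (simp only: mult_ac)
      then show ?thesis unfolding bcoeff_Suc bcoeff_rec[of \<nu> n] by simp
    qed
    have "norm (of_nat n + \<nu> + 1) \<ge> norm (of_nat (n + 1) :: complex) - norm \<nu>"
      using norm_diff_ineq[of "of_nat (n + 1) :: complex" \<nu>] by (simp add: add_ac)
    then have "norm (of_nat n + \<nu> + 1) \<ge> real n + 1 - norm \<nu>" unfolding norm_of_nat by simp
    moreover have "real n + 1 - norm \<nu> \<ge> 1" using n norm_ge_zero[of w] by linarith
    ultimately have 1: "norm (of_nat n + \<nu> + 1) \<ge> 1" by linarith
    have "norm (bcoeff \<nu> n) = real (Suc n) * norm (of_nat n + \<nu> + 1) * norm (bcoeff \<nu> (Suc n))"
      using arg_cong[OF eq, of norm] by (simp only: norm_mult norm_minus_cancel norm_of_nat)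
    also have "\<dots> \<ge> (2 * norm w) * 1 * norm (bcoeff \<nu> (Suc n))"
    proof -
      have "2 * norm w \<le> real (Suc n)" using n norm_ge_zero[of \<nu>] by linarith
      then show ?thesis using 1 by (intro mult_right_mono mult_mono) auto
    qed
    finally have "2 * norm w * norm (bcoeff \<nu> (Suc n)) * norm w ^ n \<le> norm (bcoeff \<nu> n) * norm w ^ n"
      by (intro mult_right_mono) auto
    then show "norm (bcoeff \<nu> (Suc n) * w ^ Suc n) \<le> 1 / 2 * norm (bcoeff \<nu> n * w ^ n)"
      by (simp add: norm_mult norm_power mult_ac)
  qed simp
qed

lemma bseries_deriv: "(bseries \<nu> has_field_derivative - bseries (\<nu> + 1) w) (at w)"
proof -
  have "((\<lambda>w. \<Sum>k. bcoeff \<nu> k * w ^ k) has_field_derivative (\<Sum>k. diffs (bcoeff \<nu>) k * w ^ k)) (at w)"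
    by (rule termdiffs_strong_converges_everywhere[OF summable_bseries])
  moreover have "(\<lambda>k. diffs (bcoeff \<nu>) k * w ^ k) = (\<lambda>k. - (bcoeff (\<nu> + 1) k * w ^ k))"
    using bcoeff_Suc[of _ \<nu>] by (simp add: diffs_def)
  ultimately show ?thesis
    using suminf_minus[OF summable_bseries[of "\<nu> + 1" w]] by (simp add: bseries_def[abs_def])
qed

text \<open>The three-term recurrence of the Bessel functions with the powers of x/2 removed,
  obtained by comparing coefficients through \<open>bcoeff_rec\<close> and
  \<open>bcoeff_Suc\<close>.\<close>

lemma bseries_rec: "w * bseries (\<nu> + 2) w = (\<nu> + 1) * bseries (\<nu> + 1) w - bseries \<nu> w"
proof -
  have "bseries \<nu> w - (\<nu> + 1) * bseries (\<nu> + 1) w = (\<Sum>k. bcoeff \<nu> k * w ^ k - (\<nu> + 1) * (bcoeff (\<nu> + 1) k * w ^ k))"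
    unfolding bseries_def using summable_bseries by (subst suminf_diff[symmetric]) (auto intro: summable_mult simp: suminf_mult)
  also have "(\<lambda>k. bcoeff \<nu> k * w ^ k - (\<nu> + 1) * (bcoeff (\<nu> + 1) k * w ^ k)) = (\<lambda>k. of_nat k * bcoeff (\<nu> + 1) k * w ^ k)"
    by (simp add: bcoeff_rec[of \<nu>] algebra_simps)
  also have "(\<Sum>k. of_nat k * bcoeff (\<nu> + 1) k * w ^ k) = (\<Sum>k. of_nat (Suc k) * bcoeff (\<nu> + 1) (Suc k) * w ^ Suc k)"
  proof (subst suminf_split_head)
    show "summable (\<lambda>k. of_nat k * bcoeff (\<nu> + 1) k * w ^ k)"
    proof -
      have "summable (\<lambda>k. bcoeff \<nu> k * w ^ k - (\<nu> + 1) * (bcoeff (\<nu> + 1) k * w ^ k))"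
        by (intro summable_diff summable_mult summable_bseries)
      then show ?thesis by (simp add: bcoeff_rec[of \<nu>] algebra_simps)
    qed
  qed simp
  also have "\<dots> = (\<Sum>k. - w * (bcoeff (\<nu> + 2) k * w ^ k))"
    unfolding bcoeff_Suc by (simp add: add.assoc mult_ac)
  also have "\<dots> = - w * bseries (\<nu> + 2) w"
    unfolding bseries_def by (rule suminf_mult[OF summable_bseries])
  finally show ?thesis by (simp add: algebra_simps)
qed

lemma continuous_bseries: "isCont (bseries \<nu>) w"
  by (rule DERIV_isCont[OF bseries_deriv])

lemma bseries_0: "bseries \<nu> 0 = rGamma (\<nu> + 1)"
proof -
  have "bseries \<nu> 0 = (\<Sum>k\<in>{0}. bcoeff \<nu> k * 0 ^ k)"
    unfolding bseries_def by (rule suminf_finite) auto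
  then show ?thesis by (simp add: bcoeff_def)
qed

text \<open>The power (x/2)^\<nu> for positive x. For imaginary \<nu> it has modulus 1, and unless
  \<nu> = 0 it oscillates without limit as x tends to 0.\<close>

definition pw :: "complex \<Rightarrow> real \<Rightarrow> complex" where
  "pw \<nu> x = exp (\<nu> * of_real (ln (x / 2)))"

lemma besselJ_eq:
  assumes "x > 0"
  shows "besselJ \<nu> x = pw \<nu> x * bseries \<nu> (of_real ((x / 2)\<^sup>2))"
proof -
  have "complex_of_real (x / 2) powr (of_nat (2 * k) + \<nu>) = pw \<nu> x * of_real ((x / 2)\<^sup>2) ^ k" for k
  proof -
    have nz: "complex_of_real (x / 2) \<noteq> 0" using assms by simp
    have "complex_of_real (x / 2) powr (of_nat (2 * k) + \<nu>) = complex_of_real (x / 2) powr of_nat (2 * k) * complex_of_real (x / 2) powr \<nu>"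
      by (rule powr_add)
    also have "complex_of_real (x / 2) powr of_nat (2 * k) = complex_of_real (x / 2) ^ (2 * k)"
      by (subst powr_nat) (use nz in simp)
    also have "complex_of_real (x / 2) powr \<nu> = pw \<nu> x"
      using assms nz Ln_of_real[of "x / 2"] by (simp add: powr_def pw_def)
    finally show ?thesis by (simp only: power_mult of_real_power mult.commute[of _ "pw \<nu> x"])
  qed
  then have "besselJ \<nu> x = (\<Sum>k. pw \<nu> x * (bcoeff \<nu> k * of_real ((x / 2)\<^sup>2) ^ k))"
    by (simp add: besselJ_def bcoeff_def mult_ac)
  also have "\<dots> = pw \<nu> x * bseries \<nu> (of_real ((x / 2)\<^sup>2))"
    unfolding bseries_def by (rule suminf_mult[OF summable_bseries])
  finally show ?thesis .
qed

text \<open>The suffix \<open>theta\<close> marks the image under \<open>\<theta> = x d/dx\<close> (for \<open>bseries_theta\<close>, after multiplication with \<open>pw\<close>).\<close>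

definition bseries_theta :: "complex \<Rightarrow> real \<Rightarrow> complex" where
  "bseries_theta \<nu> x = \<nu> * bseries \<nu> (of_real ((x / 2)\<^sup>2)) - 2 * of_real ((x / 2)\<^sup>2) * bseries (\<nu> + 1) (of_real ((x / 2)\<^sup>2))"

definition besselJ_theta :: "complex \<Rightarrow> real \<Rightarrow> complex" where
  "besselJ_theta \<nu> x = pw \<nu> x * bseries_theta \<nu> x"

lemma pw_deriv:
  assumes "x > 0"
  shows "(pw \<nu> has_vector_derivative \<nu> / of_real x * pw \<nu> x) (at x)"
proof -
  have "((\<lambda>x. \<nu> * of_real (ln (x / 2))) has_vector_derivative \<nu> * of_real (1 / x)) (at x)"
    using assms by (auto intro!: derivative_eq_intros has_vector_derivative_mult_right has_vector_derivative_of_real simp flip: has_real_derivative_iff_has_vector_derivative)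
  from field_vector_diff_chain_at[OF this DERIV_exp]
  show ?thesis by (simp add: pw_def[abs_def] o_def)
qed

lemma half_square_deriv: "((\<lambda>x::real. (x / 2)\<^sup>2) has_real_derivative x / 2) (at x)"
  by (auto intro!: derivative_eq_intros)

lemma bseries_sq_deriv:
  assumes "x > 0"
  shows "((\<lambda>x. bseries \<nu> (of_real ((x / 2)\<^sup>2))) has_vector_derivative of_real (x / 2) * - bseries (\<nu> + 1) (of_real ((x / 2)\<^sup>2))) (at x)"
proof -
  have "((\<lambda>x. complex_of_real ((x / 2)\<^sup>2)) has_vector_derivative of_real (x / 2)) (at x)"
    using half_square_deriv by (intro has_vector_derivative_of_real) (simp flip: has_real_derivative_iff_has_vector_derivative)
  from field_vector_diff_chain_at[OF this bseries_deriv]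
  show ?thesis by (simp add: o_def)
qed

lemma besselJ_deriv:
  assumes x: "x > 0"
  shows "(besselJ \<nu> has_vector_derivative besselJ_theta \<nu> x / of_real x) (at x)"
proof -
  have "((\<lambda>x. pw \<nu> x * bseries \<nu> (of_real ((x / 2)\<^sup>2))) has_vector_derivative
     (pw \<nu> x * (of_real (x / 2) * - bseries (\<nu> + 1) (of_real ((x / 2)\<^sup>2))) + \<nu> / of_real x * pw \<nu> x * bseries \<nu> (of_real ((x / 2)\<^sup>2)))) (at x)"
    by (intro has_vector_derivative_mult pw_deriv bseries_sq_deriv x)
  also have "(pw \<nu> x * (of_real (x / 2) * - bseries (\<nu> + 1) (of_real ((x / 2)\<^sup>2))) + \<nu> / of_real x * pw \<nu> x * bseries \<nu> (of_real ((x / 2)\<^sup>2)))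
     = besselJ_theta \<nu> x / of_real x"
    using x by (simp add: besselJ_theta_def bseries_theta_def field_simps power2_eq_square)
  finally show ?thesis
    by (rule has_vector_derivative_transform_within_open[where S = "{0<..}"]) (use x besselJ_eq in auto)
qed

text \<open>Bessel's equation. Differentiating the series twice involves the shifts of the order by
  1 and 2; \<open>bseries_rec\<close> eliminates the latter, and then the former cancels.\<close>

lemma besselJ_theta_deriv:
  assumes x: "x > 0"
  shows "(besselJ_theta \<nu> has_vector_derivative (\<nu>\<^sup>2 - of_real (x\<^sup>2)) * besselJ \<nu> x / of_real x) (at x)"
proof -
  define w where "w = complex_of_real ((x / 2)\<^sup>2)"
  have w': "((\<lambda>x. 2 * complex_of_real ((x / 2)\<^sup>2)) has_vector_derivative 2 * of_real (x / 2)) (at x)"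
    using half_square_deriv by (intro has_vector_derivative_mult_right has_vector_derivative_of_real) (simp flip: has_real_derivative_iff_has_vector_derivative)
  define D where "D = \<nu> * (of_real (x / 2) * - bseries (\<nu> + 1) w) - (2 * w * (of_real (x / 2) * - bseries (\<nu> + 1 + 1) w) + 2 * of_real (x / 2) * bseries (\<nu> + 1) w)"
  have "(besselJ_theta \<nu> has_vector_derivative (pw \<nu> x * D + \<nu> / of_real x * pw \<nu> x * bseries_theta \<nu> x)) (at x)"
    unfolding besselJ_theta_def[abs_def] bseries_theta_def[abs_def] D_def w_def
    by (intro has_vector_derivative_mult pw_deriv x has_vector_derivative_diff has_vector_derivative_mult_right bseries_sq_deriv w')
  also have "pw \<nu> x * D + \<nu> / of_real x * pw \<nu> x * bseries_theta \<nu> x = pw \<nu> x * (D + \<nu> / of_real x * bseries_theta \<nu> x)"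
    by (simp add: algebra_simps)
  also have "D + \<nu> / of_real x * bseries_theta \<nu> x = (\<nu>\<^sup>2 - of_real (x\<^sup>2)) * bseries \<nu> w / of_real x"
  proof -
    have w4: "4 * w = of_real (x\<^sup>2)" by (simp add: w_def power_divide)
    have rx: "of_real (x / 2) = 2 * w / of_real x" using x by (simp add: w_def power2_eq_square)
    have "D = 2 / of_real x * (w * (2 * (w * bseries (\<nu> + 2) w) - (\<nu> + 2) * bseries (\<nu> + 1) w))"
      unfolding D_def rx by (simp add: algebra_simps add.assoc)
    also have "2 * (w * bseries (\<nu> + 2) w) - (\<nu> + 2) * bseries (\<nu> + 1) w = \<nu> * bseries (\<nu> + 1) w - 2 * bseries \<nu> w"
      unfolding bseries_rec by (simp add: algebra_simps)
    finally have "D + \<nu> / of_real x * bseries_theta \<nu> x = (\<nu>\<^sup>2 - 4 * w) * bseries \<nu> w / of_real x"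
      unfolding bseries_theta_def w_def[symmetric] using x by (simp add: field_simps power2_eq_square)
    then show ?thesis unfolding w4 .
  qed
  also have "pw \<nu> x * ((\<nu>\<^sup>2 - of_real (x\<^sup>2)) * bseries \<nu> w / of_real x) = (\<nu>\<^sup>2 - of_real (x\<^sup>2)) * besselJ \<nu> x / of_real x"
    using besselJ_eq[OF x] by (simp add: w_def)
  finally show ?thesis .
qed

section \<open>Uniqueness for the third-order equation with vanishing data at its singular
  point\<close>

lemma energy_zero:
  fixes D0 D1 D2 :: "real \<Rightarrow> real"
  assumes y: "y > 0"
    and d0: "\<And>x. x > 0 \<Longrightarrow> (D0 has_real_derivative D1 x / x) (at x)"
    and d1: "\<And>x. x > 0 \<Longrightarrow> (D1 has_real_derivative D2 x / x) (at x)"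
    and d2: "\<And>x. x > 0 \<Longrightarrow> (D2 has_real_derivative (- y\<^sup>2 * D1 x - 4 * x\<^sup>2 * (D1 x + D0 x)) / x) (at x)"
    and l: "(D0 \<longlongrightarrow> 0) (at_right 0)" "(D1 \<longlongrightarrow> 0) (at_right 0)" "(D2 \<longlongrightarrow> 0) (at_right 0)"
    and x: "x > 0"
  shows "D0 x = 0"
proof -
  \<comment> \<open>Built from the conserved quantities y^2 D1^2 + D2^2 and D2 + y^2 D0 of
    \<theta>(\<theta>^2 + y^2) w = 0. Only the perturbation 4 x^2 (\<theta> + 1) w changes it, which
    supplies the factor x in \<open>E'\<close> that removes the singularity 1/x.\<close>
  define E where "E = (\<lambda>x. y\<^sup>2 * (D1 x)\<^sup>2 + (D2 x)\<^sup>2 + (D2 x + y\<^sup>2 * D0 x)\<^sup>2)"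
  \<comment> \<open>With A = D1 + D0 and B = 2 D2 + y^2 D0, half of A^2 + B^2 is at most
    \<open>\<kappa>\<close> E: the summand 1 comes from B, the summands 1/y^2 and 2/y^4 from D1 and
    D0.\<close>
  define \<kappa> where "\<kappa> = 1 + 1 / y\<^sup>2 + 2 / y ^ 4"
  \<comment> \<open>The integrating factor for E' \<le> 8 \<kappa> x E; \<open>H\<close> is then
    nonincreasing and is bounded by its limit 0 at the origin.\<close>
  define H where "H = (\<lambda>x. E x * exp (- 4 * \<kappa> * x\<^sup>2))"
  define E' where "E' = (\<lambda>x. - 8 * x * ((D1 x + D0 x) * (2 * D2 x + y\<^sup>2 * D0 x)))"
  have E': "(E has_real_derivative E' x) (at x)" if x: "x > 0" for x
  proof -
    have "(E has_real_derivative y\<^sup>2 * (2 * D1 x * (D2 x / x)) + 2 * D2 x * ((- y\<^sup>2 * D1 x - 4 * x\<^sup>2 * (D1 x + D0 x)) / x)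
        + 2 * (D2 x + y\<^sup>2 * D0 x) * ((- y\<^sup>2 * D1 x - 4 * x\<^sup>2 * (D1 x + D0 x)) / x + y\<^sup>2 * (D1 x / x))) (at x)"
      unfolding E_def by (rule derivative_eq_intros d0 d1 d2 x refl | simp add: algebra_simps add_divide_distrib diff_divide_distrib)+
    also have "y\<^sup>2 * (2 * D1 x * (D2 x / x)) + 2 * D2 x * ((- y\<^sup>2 * D1 x - 4 * x\<^sup>2 * (D1 x + D0 x)) / x)
        + 2 * (D2 x + y\<^sup>2 * D0 x) * ((- y\<^sup>2 * D1 x - 4 * x\<^sup>2 * (D1 x + D0 x)) / x + y\<^sup>2 * (D1 x / x)) = E' x"
      using x by (simp add: E'_def field_simps power2_eq_square)
    finally show ?thesis .
  qed
  have E'_le: "E' x \<le> 8 * \<kappa> * x * E x" if x: "x > 0" for x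
  proof -
    define p where "p = D2 x + y\<^sup>2 * D0 x"
    have E: "E x = y\<^sup>2 * (D1 x)\<^sup>2 + (D2 x)\<^sup>2 + p\<^sup>2" by (simp add: E_def p_def)
    have y2: "y\<^sup>2 > 0" using y by simp
    have a: "(D1 x)\<^sup>2 \<le> E x / y\<^sup>2" using y2 unfolding E by (simp add: field_simps)
    have b: "(D0 x)\<^sup>2 \<le> 2 * E x / y ^ 4"
    proof -
      have "D0 x = (p - D2 x) / y\<^sup>2" using y by (simp add: p_def)
      then have "(D0 x)\<^sup>2 = (p - D2 x)\<^sup>2 / y ^ 4" by (simp add: power_divide flip: power_mult)
      also have "(p - D2 x)\<^sup>2 \<le> 2 * E x"
      proof -
        have "(p - D2 x)\<^sup>2 \<le> (p - D2 x)\<^sup>2 + (p + D2 x)\<^sup>2" by simp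
        also have "\<dots> = 2 * (p\<^sup>2 + (D2 x)\<^sup>2)" by (simp add: power2_eq_square algebra_simps)
        also have "\<dots> \<le> 2 * E x" unfolding E by simp
        finally show ?thesis .
      qed
      finally show ?thesis using y by (simp add: divide_right_mono)
    qed
    have c: "(2 * D2 x + y\<^sup>2 * D0 x)\<^sup>2 \<le> 2 * E x"
    proof -
      have e: "2 * D2 x + y\<^sup>2 * D0 x = D2 x + p" by (simp add: p_def)
      have "(2 * D2 x + y\<^sup>2 * D0 x)\<^sup>2 \<le> (D2 x + p)\<^sup>2 + (D2 x - p)\<^sup>2" unfolding e by simp
      also have "\<dots> = 2 * (p\<^sup>2 + (D2 x)\<^sup>2)" by (simp add: power2_eq_square algebra_simps)
      also have "\<dots> \<le> 2 * E x" unfolding E by simp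
      finally show ?thesis .
    qed
    have d: "(D1 x + D0 x)\<^sup>2 \<le> 2 * (E x / y\<^sup>2 + 2 * E x / y ^ 4)"
    proof -
      have "(D1 x + D0 x)\<^sup>2 \<le> (D1 x + D0 x)\<^sup>2 + (D1 x - D0 x)\<^sup>2" by simp
      also have "\<dots> = 2 * ((D1 x)\<^sup>2 + (D0 x)\<^sup>2)" by (simp add: power2_eq_square algebra_simps)
      also have "\<dots> \<le> 2 * (E x / y\<^sup>2 + 2 * E x / y ^ 4)" using a b by simp
      finally show ?thesis .
    qed
    define A where "A = D1 x + D0 x"
    define B where "B = 2 * D2 x + y\<^sup>2 * D0 x"
    have "- (A * B) \<le> (A\<^sup>2 + B\<^sup>2) / 2"
      using zero_le_power2[of "A + B"] by (simp add: power2_eq_square algebra_simps)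
    also have "\<dots> \<le> \<kappa> * E x" using c d unfolding A_def[symmetric] B_def[symmetric] by (simp add: \<kappa>_def algebra_simps)
    finally have "8 * x * (- (A * B)) \<le> 8 * x * (\<kappa> * E x)" using x by (intro mult_left_mono) auto
    then show ?thesis by (simp add: E'_def A_def B_def mult_ac)
  qed
  have H': "\<exists>D. (H has_real_derivative D) (at x) \<and> D \<le> 0" if x: "x > 0" for x
  proof (intro exI conjI)
    show "(H has_real_derivative E' x * exp (- 4 * \<kappa> * x\<^sup>2) + E x * (exp (- 4 * \<kappa> * x\<^sup>2) * (- 4 * \<kappa> * (2 * x)))) (at x)"
      unfolding H_def by (rule derivative_eq_intros E' x refl | simp)+
    have "E' x * exp (- 4 * \<kappa> * x\<^sup>2) \<le> 8 * \<kappa> * x * E x * exp (- 4 * \<kappa> * x\<^sup>2)"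
      using E'_le[OF x] by (intro mult_right_mono) auto
    then show "E' x * exp (- 4 * \<kappa> * x\<^sup>2) + E x * (exp (- 4 * \<kappa> * x\<^sup>2) * (- 4 * \<kappa> * (2 * x))) \<le> 0"
      by (simp add: algebra_simps)
  qed
  have mono: "H x \<le> H s" if "0 < s" "s \<le> x" for s
    using that(2) by (rule DERIV_nonpos_imp_nonincreasing) (use H' that in auto)
  have "(E \<longlongrightarrow> y\<^sup>2 * 0\<^sup>2 + 0\<^sup>2 + (0 + y\<^sup>2 * 0)\<^sup>2) (at_right 0)"
    unfolding E_def by (intro tendsto_intros l)
  moreover have "((\<lambda>x. exp (- 4 * \<kappa> * x\<^sup>2)) \<longlongrightarrow> exp (- 4 * \<kappa> * 0\<^sup>2)) (at_right 0)"
    by (intro tendsto_intros)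
  ultimately have "(H \<longlongrightarrow> 0 * 1) (at_right 0)" unfolding H_def by (intro tendsto_mult) auto
  moreover have "\<forall>\<^sub>F s in at_right 0. H x \<le> H s"
    using x mono by (auto simp: eventually_at_right_field intro!: exI[of _ x])
  ultimately have "H x \<le> 0 * 1" by (rule tendsto_lowerbound) simp
  then have "H x \<le> 0" by simp
  moreover have "H x \<ge> 0" unfolding H_def E_def by simp
  ultimately have "E x = 0" by (simp add: H_def)
  then have "D2 x = 0" "D2 x + y\<^sup>2 * D0 x = 0"
    unfolding E_def by (auto simp: add_nonneg_eq_0_iff)
  then show ?thesis using y by simp
qed

section \<open>Nicholson's formula\<close>

lemma besselJ_prod_deriv:
  assumes x: "x > 0"
  shows "((\<lambda>x. besselJ a x * besselJ b x) has_vector_derivative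
           (besselJ_theta a x * besselJ b x + besselJ a x * besselJ_theta b x) / of_real x) (at x)"
  using has_vector_derivative_mult[OF besselJ_deriv[OF x, of a] besselJ_deriv[OF x, of b]]
  by (simp add: add_divide_distrib add.commute)

text \<open>When b^2 = a^2 both factors solve the same second-order equation, so the product solves
  its symmetric square, which has order three.\<close>

lemma besselJ_prod_deriv1:
  assumes x: "x > 0" and ab: "b\<^sup>2 = a\<^sup>2"
  shows "((\<lambda>x. besselJ_theta a x * besselJ b x + besselJ a x * besselJ_theta b x) has_vector_derivative
           (2 * (a\<^sup>2 - of_real (x\<^sup>2)) * (besselJ a x * besselJ b x) + 2 * (besselJ_theta a x * besselJ_theta b x)) / of_real x) (at x)"
  using has_vector_derivative_add[OF
      has_vector_derivative_mult[OF besselJ_theta_deriv[OF x, of a] besselJ_deriv[OF x, of b]]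
      has_vector_derivative_mult[OF besselJ_deriv[OF x, of a] besselJ_theta_deriv[OF x, of b]]]
  unfolding ab by (rule has_vector_derivative_eq_rhs) (simp add: add_divide_distrib diff_divide_distrib algebra_simps)

lemma has_vector_derivative_of_real': "(f has_real_derivative D) (at x) \<Longrightarrow> ((\<lambda>x. complex_of_real (f x)) has_vector_derivative of_real D) (at x)"
  by (intro has_vector_derivative_of_real) (simp add: has_real_derivative_iff_has_vector_derivative)

lemma besselJ_prod_deriv2:
  assumes x: "x > 0" and ab: "b\<^sup>2 = a\<^sup>2"
  shows "((\<lambda>x. 2 * (a\<^sup>2 - of_real (x\<^sup>2)) * (besselJ a x * besselJ b x) + 2 * (besselJ_theta a x * besselJ_theta b x)) has_vector_derivative
           (4 * a\<^sup>2 * (besselJ_theta a x * besselJ b x + besselJ a x * besselJ_theta b x)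
             - 4 * of_real (x\<^sup>2) * ((besselJ_theta a x * besselJ b x + besselJ a x * besselJ_theta b x) + besselJ a x * besselJ b x)) / of_real x) (at x)"
proof -
  have sq: "((\<lambda>x. 2 * (a\<^sup>2 - complex_of_real (x\<^sup>2))) has_vector_derivative 2 * (0 - of_real (2 * x))) (at x)"
    by (intro has_vector_derivative_mult_right has_vector_derivative_diff has_vector_derivative_const has_vector_derivative_of_real')
       (auto intro!: derivative_eq_intros)
  show ?thesis
    using has_vector_derivative_add[OF has_vector_derivative_mult[OF sq besselJ_prod_deriv[OF x, of a b]]
      has_vector_derivative_mult_right[OF has_vector_derivative_mult[OF besselJ_theta_deriv[OF x, of a] besselJ_theta_deriv[OF x, of b]], of 2]]
    unfolding ab by (rule has_vector_derivative_eq_rhs) (use x in \<open>simp add: field_simps power2_eq_square\<close>)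
qed

text \<open>\<open>lincomb prod0\<close> is \<open>\<pi>\<^sup>2/8 (J\<^sub>\<mu>\<^sup>2 + Y\<^sub>\<mu>\<^sup>2)\<close> with \<open>Y\<^sub>\<mu>\<close> eliminated, \<open>\<mu> = iy/2\<close>; \<open>prod1\<close> and \<open>prod2\<close> are \<open>\<theta>\<close> and \<open>\<theta>\<^sup>2\<close> of
  \<open>prod0\<close>.\<close>

definition nichA :: "real \<Rightarrow> real" where "nichA y = - (pi\<^sup>2 / 8) / (sinh (pi * y / 2))\<^sup>2"
definition nichB :: "real \<Rightarrow> real" where "nichB y = (pi\<^sup>2 / 4) * cosh (pi * y / 2) / (sinh (pi * y / 2))\<^sup>2"

definition lincomb :: "(complex \<Rightarrow> complex \<Rightarrow> real \<Rightarrow> complex) \<Rightarrow> real \<Rightarrow> real \<Rightarrow> complex" where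
  "lincomb f y x = (let \<mu> = \<i> * of_real y / 2 in
     of_real (nichA y) * (f \<mu> \<mu> x + f (- \<mu>) (- \<mu>) x) + of_real (nichB y) * f \<mu> (- \<mu>) x)"

definition prod0 where "prod0 a b x = besselJ a x * besselJ b x"
definition prod1 where "prod1 a b x = besselJ_theta a x * besselJ b x + besselJ a x * besselJ_theta b x"
definition prod2 where "prod2 a b x = 2 * (a\<^sup>2 - of_real (x\<^sup>2)) * (besselJ a x * besselJ b x) + 2 * (besselJ_theta a x * besselJ_theta b x)"

text \<open>The index pairs of the three summands all satisfy b^2 = a^2 = -y^2/4, so one equation
  for products serves them all.\<close>

lemma lincomb_deriv:
  assumes f: "\<And>a b. b\<^sup>2 = a\<^sup>2 \<Longrightarrow> a\<^sup>2 = - of_real (y\<^sup>2 / 4) \<Longrightarrow> (f a b has_vector_derivative f' a b x) (at x)"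
  shows "(lincomb f y has_vector_derivative lincomb f' y x) (at x)"
  unfolding lincomb_def[abs_def] Let_def
  by (intro has_vector_derivative_add has_vector_derivative_mult_right f)
     (simp_all add: power_mult_distrib power_divide)

lemma lincomb_deriv0: "x > 0 \<Longrightarrow> (lincomb prod0 y has_vector_derivative lincomb prod1 y x / of_real x) (at x)"
proof -
  assume x: "x > 0"
  have "(lincomb prod0 y has_vector_derivative lincomb (\<lambda>a b x. prod1 a b x / of_real x) y x) (at x)"
    by (intro lincomb_deriv) (unfold prod0_def[abs_def] prod1_def, rule besselJ_prod_deriv[OF x])
  also have "lincomb (\<lambda>a b x. prod1 a b x / of_real x) y x = lincomb prod1 y x / of_real x"
    using x by (simp add: lincomb_def Let_def add_divide_distrib algebra_simps)
  finally show ?thesis .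
qed

lemma lincomb_deriv1: "x > 0 \<Longrightarrow> (lincomb prod1 y has_vector_derivative lincomb prod2 y x / of_real x) (at x)"
proof -
  assume x: "x > 0"
  have "(lincomb prod1 y has_vector_derivative lincomb (\<lambda>a b x. prod2 a b x / of_real x) y x) (at x)"
    by (intro lincomb_deriv) (unfold prod1_def[abs_def] prod2_def, rule besselJ_prod_deriv1[OF x])
  also have "lincomb (\<lambda>a b x. prod2 a b x / of_real x) y x = lincomb prod2 y x / of_real x"
    using x by (simp add: lincomb_def Let_def add_divide_distrib algebra_simps)
  finally show ?thesis .
qed

lemma lincomb_deriv2: "x > 0 \<Longrightarrow> (lincomb prod2 y has_vector_derivative
    (- of_real (y\<^sup>2) * lincomb prod1 y x - 4 * of_real (x\<^sup>2) * (lincomb prod1 y x + lincomb prod0 y x)) / of_real x) (at x)"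
proof -
  assume x: "x > 0"
  let ?f = "\<lambda>a b x. (- of_real (y\<^sup>2) * prod1 a b x - 4 * of_real (x\<^sup>2) * (prod1 a b x + prod0 a b x)) / of_real x"
  have "(lincomb prod2 y has_vector_derivative lincomb ?f y x) (at x)"
  proof (rule lincomb_deriv)
    fix a b :: complex assume "b\<^sup>2 = a\<^sup>2" and a: "a\<^sup>2 = - of_real (y\<^sup>2 / 4)"
    from besselJ_prod_deriv2[OF x this(1)]
    show "(prod2 a b has_vector_derivative ?f a b x) (at x)"
      unfolding prod2_def[abs_def] prod1_def prod0_def
      by (rule has_vector_derivative_eq_rhs) (simp add: a)
  qed
  also have "lincomb ?f y x = (- of_real (y\<^sup>2) * lincomb prod1 y x - 4 * of_real (x\<^sup>2) * (lincomb prod1 y x + lincomb prod0 y x)) / of_real x"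
    unfolding lincomb_def Let_def by (simp add: algebra_simps add_divide_distrib diff_divide_distrib)
  finally show ?thesis .
qed

section \<open>Leading terms of the Bessel products at the origin\<close>

lemma pw_mult: "pw a x * pw b x = pw (a + b) x"
  by (simp add: pw_def exp_add distrib_right)

lemma pw_0 [simp]: "pw 0 x = 1" by (simp add: pw_def)

lemma norm_pw_imag: "norm (pw (\<i> * of_real r) x) = 1"
  by (simp add: pw_def norm_exp_eq_Re)

lemma half_sq_tendsto: "((\<lambda>x. complex_of_real ((x / 2)\<^sup>2)) \<longlongrightarrow> 0) (at_right 0)"
proof -
  have "((\<lambda>x. complex_of_real ((x / 2)\<^sup>2)) \<longlongrightarrow> of_real ((0 / 2)\<^sup>2)) (at_right 0)" by (intro tendsto_intros) simp
  then show ?thesis by simp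
qed

lemma bseries_tendsto: "((\<lambda>x. bseries \<nu> (of_real ((x / 2)\<^sup>2))) \<longlongrightarrow> rGamma (\<nu> + 1)) (at_right 0)"
  using isCont_tendsto_compose[OF continuous_bseries half_sq_tendsto] by (simp add: bseries_0)

lemma bseries_theta_tendsto: "(bseries_theta \<nu> \<longlongrightarrow> \<nu> * rGamma (\<nu> + 1)) (at_right 0)"
proof -
  have "(bseries_theta \<nu> \<longlongrightarrow> \<nu> * rGamma (\<nu> + 1) - 2 * 0 * rGamma (\<nu> + 1 + 1)) (at_right 0)"
    unfolding bseries_theta_def[abs_def] by (intro tendsto_intros bseries_tendsto half_sq_tendsto)
  then show ?thesis by simp
qed

text \<open>Leading term of the k-th \<theta>-image of J_a J_b, since \<theta> multiplies
  (x/2)^(a+b) by a + b. For b = -a it survives only for k = 0, where 0^0 = 1 gives the right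
  coefficient.\<close>

definition prodlim :: "nat \<Rightarrow> complex \<Rightarrow> complex \<Rightarrow> real \<Rightarrow> complex" where
  "prodlim k a b x = (a + b) ^ k * (pw (a + b) x * (rGamma (a + 1) * rGamma (b + 1)))"

lemma null_mult_pw:
  assumes "(f \<longlongrightarrow> L) F"
  shows "((\<lambda>x. pw (\<i> * of_real r) x * f x - pw (\<i> * of_real r) x * L) \<longlongrightarrow> 0) F"
proof (rule Lim_null_comparison)
  have "((\<lambda>x. norm (f x - L)) \<longlongrightarrow> 0) F" using assms by (simp add: tendsto_norm_zero_iff LIM_zero_iff)
  then show "((\<lambda>x. norm (f x - L)) \<longlongrightarrow> 0) F" .
  show "\<forall>\<^sub>F x in F. norm (pw (\<i> * of_real r) x * f x - pw (\<i> * of_real r) x * L) \<le> norm (f x - L)"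
    by (simp add: norm_mult norm_pw_imag flip: right_diff_distrib)
qed

lemma prod_asym:
  assumes ab: "a + b = \<i> * of_real r" and b: "b\<^sup>2 = a\<^sup>2"
  shows "((\<lambda>x. prod0 a b x - prodlim 0 a b x) \<longlongrightarrow> 0) (at_right 0)"
    and "((\<lambda>x. prod1 a b x - prodlim 1 a b x) \<longlongrightarrow> 0) (at_right 0)"
    and "((\<lambda>x. prod2 a b x - prodlim 2 a b x) \<longlongrightarrow> 0) (at_right 0)"
proof -
  let ?w = "\<lambda>x. complex_of_real ((x / 2)\<^sup>2)"
  have ev: "\<forall>\<^sub>F x in at_right (0::real). x > 0" by (simp add: eventually_at_filter)
  have "((\<lambda>x. bseries a (?w x) * bseries b (?w x)) \<longlongrightarrow> rGamma (a + 1) * rGamma (b + 1)) (at_right 0)"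
    by (intro tendsto_intros bseries_tendsto)
  note null_mult_pw[OF this, of r, folded ab]
  moreover have "\<forall>\<^sub>F x in at_right 0. pw (a + b) x * (bseries a (?w x) * bseries b (?w x)) - pw (a + b) x * (rGamma (a + 1) * rGamma (b + 1)) = prod0 a b x - prodlim 0 a b x"
    using ev by eventually_elim (simp add: prod0_def prodlim_def besselJ_eq mult_ac flip: pw_mult)
  ultimately show "((\<lambda>x. prod0 a b x - prodlim 0 a b x) \<longlongrightarrow> 0) (at_right 0)"
    by (rule Lim_transform_eventually)
  have "((\<lambda>x. bseries_theta a x * bseries b (?w x) + bseries a (?w x) * bseries_theta b x) \<longlongrightarrow> a * rGamma (a + 1) * rGamma (b + 1) + rGamma (a + 1) * (b * rGamma (b + 1))) (at_right 0)"
    by (intro tendsto_intros bseries_tendsto bseries_theta_tendsto)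
  note null_mult_pw[OF this, of r, folded ab]
  moreover have "\<forall>\<^sub>F x in at_right 0. pw (a + b) x * (bseries_theta a x * bseries b (?w x) + bseries a (?w x) * bseries_theta b x) - pw (a + b) x * (a * rGamma (a + 1) * rGamma (b + 1) + rGamma (a + 1) * (b * rGamma (b + 1))) = prod1 a b x - prodlim 1 a b x"
    using ev by eventually_elim (simp add: prod1_def prodlim_def besselJ_eq besselJ_theta_def algebra_simps flip: pw_mult)
  ultimately show "((\<lambda>x. prod1 a b x - prodlim 1 a b x) \<longlongrightarrow> 0) (at_right 0)"
    by (rule Lim_transform_eventually)
  have x2: "((\<lambda>x. complex_of_real (x\<^sup>2)) \<longlongrightarrow> 0) (at_right 0)"
  proof -
    have "((\<lambda>x. complex_of_real (x\<^sup>2)) \<longlongrightarrow> of_real (0\<^sup>2)) (at_right 0)" by (intro tendsto_intros)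
    then show ?thesis by simp
  qed
  have "((\<lambda>x. 2 * (a\<^sup>2 - of_real (x\<^sup>2)) * (bseries a (?w x) * bseries b (?w x)) + 2 * (bseries_theta a x * bseries_theta b x)) \<longlongrightarrow> 2 * (a\<^sup>2 - 0) * (rGamma (a + 1) * rGamma (b + 1)) + 2 * ((a * rGamma (a + 1)) * (b * rGamma (b + 1)))) (at_right 0)"
    by (intro tendsto_intros bseries_tendsto bseries_theta_tendsto x2)
  note null_mult_pw[OF this, of r, folded ab]
  moreover have "\<forall>\<^sub>F x in at_right 0. pw (a + b) x * (2 * (a\<^sup>2 - of_real (x\<^sup>2)) * (bseries a (?w x) * bseries b (?w x)) + 2 * (bseries_theta a x * bseries_theta b x)) - pw (a + b) x * (2 * (a\<^sup>2 - 0) * (rGamma (a + 1) * rGamma (b + 1)) + 2 * ((a * rGamma (a + 1)) * (b * rGamma (b + 1)))) = prod2 a b x - prodlim 2 a b x"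
    using ev
  proof eventually_elim
    \<comment> \<open>The leading coefficient of \<open>prod2\<close> is 2 a^2 + 2 a b, which equals
      (a + b)^2 precisely because b^2 = a^2.\<close>
    case (elim x)
    have "(a + b)\<^sup>2 = 2 * a\<^sup>2 + 2 * a * b" using b by (simp add: power2_eq_square algebra_simps)
    then have as: "prodlim 2 a b x = pw (a + b) x * (2 * (a\<^sup>2 - 0) * (rGamma (a + 1) * rGamma (b + 1)) + 2 * ((a * rGamma (a + 1)) * (b * rGamma (b + 1))))"
      by (simp add: prodlim_def algebra_simps)
    have "prod2 a b x = pw (a + b) x * (2 * (a\<^sup>2 - of_real (x\<^sup>2)) * (bseries a (?w x) * bseries b (?w x)) + 2 * (bseries_theta a x * bseries_theta b x))"
      using elim unfolding prod2_def besselJ_eq[OF elim] besselJ_theta_def pw_mult[symmetric] by (simp only: distrib_left mult_ac)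
    with as show ?case by simp
  qed
  ultimately show "((\<lambda>x. prod2 a b x - prodlim 2 a b x) \<longlongrightarrow> 0) (at_right 0)"
    by (rule Lim_transform_eventually)
qed

lemma lincomb_asym:
  assumes "\<And>a b r. a + b = \<i> * of_real r \<Longrightarrow> b\<^sup>2 = a\<^sup>2 \<Longrightarrow> ((\<lambda>x. f a b x - prodlim k a b x) \<longlongrightarrow> 0) (at_right 0)"
  shows "((\<lambda>x. lincomb f y x - lincomb (prodlim k) y x) \<longlongrightarrow> 0) (at_right 0)"
proof -
  let ?\<mu> = "\<i> * complex_of_real y / 2"
  have 1: "((\<lambda>x. f ?\<mu> ?\<mu> x - prodlim k ?\<mu> ?\<mu> x) \<longlongrightarrow> 0) (at_right 0)"
    by (rule assms[of _ _ y]) simp_all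
  have 2: "((\<lambda>x. f (- ?\<mu>) (- ?\<mu>) x - prodlim k (- ?\<mu>) (- ?\<mu>) x) \<longlongrightarrow> 0) (at_right 0)"
    by (rule assms[of _ _ "-y"]) simp_all
  have 3: "((\<lambda>x. f ?\<mu> (- ?\<mu>) x - prodlim k ?\<mu> (- ?\<mu>) x) \<longlongrightarrow> 0) (at_right 0)"
    by (rule assms[of _ _ 0]) simp_all
  have "((\<lambda>x. c * ((f ?\<mu> ?\<mu> x - prodlim k ?\<mu> ?\<mu> x) + (f (- ?\<mu>) (- ?\<mu>) x - prodlim k (- ?\<mu>) (- ?\<mu>) x))
     + d * (f ?\<mu> (- ?\<mu>) x - prodlim k ?\<mu> (- ?\<mu>) x)) \<longlongrightarrow> c * (0 + 0) + d * 0) (at_right 0)" for c d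
    by (intro tendsto_intros 1 2 3)
  then show ?thesis by (simp add: lincomb_def Let_def algebra_simps)
qed

text \<open>The reciprocal Gamma values at the conjugate points 1 + \<mu> and 1 - \<mu> are
  conjugate, and reflection fixes their modulus. So the two pure products give multiples of
  \<open>nichZ\<close> and its conjugate, and the mixed product gives the constant term.\<close>

lemma lincomb_asym_eq:
  assumes y: "y > 0"
  shows "of_real (y\<^sup>2) * lincomb (prodlim 0) y x = of_real ((pi * y / 2) * (cosh (pi * y / 2) / sinh (pi * y / 2)) - Re (nichZ y x))"
    and "of_real y * lincomb (prodlim 1) y x = - of_real (Im (nichZ y x))"
    and "lincomb (prodlim 2) y x = of_real (Re (nichZ y x))"
proof -
  define \<mu> where "\<mu> = \<i> * complex_of_real y / 2"
  define s where "s = sinh (pi * y / 2)"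
  have s: "s > 0" using y by (simp add: s_def)
  define r where "r = rGamma (\<mu> + 1)"
  define r' where "r' = rGamma (- \<mu> + 1)"
  define G where "G = Gamma (1 + \<mu>)"
  have ref: "Gamma (1 + \<mu>) * Gamma (1 - \<mu>) = of_real ((pi * y / 2) / s)"
    using Gamma_reflection_one_plus_imag[of "y / 2"] y by (simp add: \<mu>_def s_def)
  then have nz: "Gamma (1 + \<mu>) \<noteq> 0" "Gamma (1 - \<mu>) \<noteq> 0" using s y by auto
  have cG: "cnj G = Gamma (1 - \<mu>)"
    by (simp add: G_def cnj_Gamma \<mu>_def)
  \<comment> \<open>Reflection turns 1 / Gamma(1 + \<mu>) into a real multiple of Gamma(1 - \<mu>),
    the conjugate of \<open>G\<close>.\<close>
  have rr: "r = of_real (s / (pi * y / 2)) * cnj G" "r' = of_real (s / (pi * y / 2)) * G"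
    using ref nz s y unfolding cG unfolding r_def r'_def G_def by (simp_all add: rGamma_inverse_Gamma field_simps)
  have GG: "G * cnj G = of_real ((pi * y / 2) / s)" using ref by (simp add: cG) (simp add: G_def)
  have rr': "r * r' = of_real (s / (pi * y / 2))"
  proof -
    have "r * r' = of_real (s / (pi * y / 2)) * of_real (s / (pi * y / 2)) * (G * cnj G)" unfolding rr by simp
    moreover have "q * q * (1 / q) = q" if "q > 0" for q :: real using that by simp
    then have "s / (pi * y / 2) * (s / (pi * y / 2)) * (1 / (s / (pi * y / 2))) = s / (pi * y / 2)"
      using s y by simp
    moreover have "1 / (s / (pi * y / 2)) = (pi * y / 2) / s" by simp
    ultimately show ?thesis unfolding GG by (simp only: of_real_mult[symmetric])
  qed
  have pc: "pw (- \<mu> + - \<mu>) x = exp (- \<i> * of_real (y * ln (x / 2)))"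
    by (simp add: pw_def \<mu>_def mult.assoc)
  have pcn: "pw (\<mu> + \<mu>) x = cnj (exp (- \<i> * of_real (y * ln (x / 2))))"
    by (simp add: pw_def \<mu>_def exp_cnj mult.assoc)
  define Z where "Z = nichZ y x"
  have Z: "pw (- \<mu> + - \<mu>) x * (r' * r') = of_real ((s / (pi * y / 2))\<^sup>2) * Z"
    unfolding pc rr Z_def nichZ_def by (simp add: G_def \<mu>_def power2_eq_square)
  have Z': "pw (\<mu> + \<mu>) x * (r * r) = of_real ((s / (pi * y / 2))\<^sup>2) * cnj Z"
    unfolding pcn rr Z_def nichZ_def by (simp add: G_def \<mu>_def power2_eq_square)
  define c where "c = - (pi\<^sup>2 / 8) / s\<^sup>2"
  define d where "d = (pi\<^sup>2 / 4) * cosh (pi * y / 2) / s\<^sup>2"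
  define e where "e = (s / (pi * y / 2))\<^sup>2"
  \<comment> \<open>The weight \<open>nichA\<close> is matched to this value: y^2 times it is -1/2,
    and Z plus its conjugate is 2 Re Z.\<close>
  have ce: "c * e = - 1 / (2 * y\<^sup>2)"
    using s y by (simp add: c_def e_def power_divide power_mult_distrib field_simps)
  have de: "d * (s / (pi * y / 2)) = (pi / (2 * y)) * (cosh (pi * y / 2) / s)"
    using s y by (simp add: d_def field_simps power2_eq_square)
  have cd: "c = nichA y" "d = nichB y"
    by (simp_all add: c_def d_def s_def nichA_def nichB_def)
  have L: "lincomb (prodlim k) y x = of_real c * (of_real e * ((2 * \<mu>) ^ k * cnj Z + (- 2 * \<mu>) ^ k * Z)) + of_real d * (0 ^ k * of_real (s / (pi * y / 2)))" for k
  proof -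
    have "lincomb (prodlim k) y x = of_real c * ((\<mu> + \<mu>) ^ k * (pw (\<mu> + \<mu>) x * (r * r)) + (- \<mu> + - \<mu>) ^ k * (pw (- \<mu> + - \<mu>) x * (r' * r')))
       + of_real d * ((\<mu> + - \<mu>) ^ k * (pw (\<mu> + - \<mu>) x * (r * r')))"
      unfolding lincomb_def Let_def prodlim_def cd r_def r'_def \<mu>_def by simp
    then show ?thesis unfolding Z Z' rr' e_def[symmetric] by (simp add: algebra_simps)
  qed
  have L': "lincomb (prodlim k) y x = of_real (c * e) * ((2 * \<mu>) ^ k * cnj Z + (- 2 * \<mu>) ^ k * Z) + 0 ^ k * of_real (d * (s / (pi * y / 2)))" for k
    unfolding L by (simp only: of_real_mult mult_ac)
  have m2: "2 * \<mu> = \<i> * of_real y" by (simp add: \<mu>_def)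
  have Re: "cnj Z + Z = of_real (2 * Re Z)" by (simp add: complex_eq_iff)
  have Im: "cnj Z - Z = - 2 * \<i> * of_real (Im Z)" by (simp add: complex_eq_iff)
  have "lincomb (prodlim 0) y x = of_real (- 1 / (2 * y\<^sup>2) * (2 * Re Z) + (pi / (2 * y)) * (cosh (pi * y / 2) / s))"
    unfolding L' ce de using Re by simp
  then show "of_real (y\<^sup>2) * lincomb (prodlim 0) y x = of_real ((pi * y / 2) * (cosh (pi * y / 2) / sinh (pi * y / 2)) - Re (nichZ y x))"
    unfolding Z_def s_def[symmetric] using y s by (simp only: of_real_mult[symmetric] of_real_eq_iff) (simp add: field_simps power2_eq_square)
  have "lincomb (prodlim 1) y x = of_real (- 1 / (2 * y\<^sup>2)) * (\<i> * of_real y * (cnj Z - Z))"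
    unfolding L' ce m2 using m2 by (simp add: algebra_simps)
  also have "\<dots> = of_real (- Im Z / y)"
    unfolding Im using y by (simp add: field_simps power2_eq_square)
  finally show "of_real y * lincomb (prodlim 1) y x = - of_real (Im (nichZ y x))"
    using y by (simp add: Z_def)
  have "(2 * \<mu>)\<^sup>2 = - of_real (y\<^sup>2)" "(- 2 * \<mu>)\<^sup>2 = - of_real (y\<^sup>2)"
    using m2 by (simp_all add: power_mult_distrib \<mu>_def power_divide)
  then have "lincomb (prodlim 2) y x = of_real (- 1 / (2 * y\<^sup>2)) * (- of_real (y\<^sup>2) * (cnj Z + Z))"
    unfolding L' ce by (simp add: algebra_simps)
  also have "\<dots> = of_real (Re Z)"
  proof -
    have "(- 1 / (2 * y\<^sup>2)) * (- (y\<^sup>2) * (2 * Re Z)) = Re Z" using y by simp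
    then show ?thesis unfolding Re by (simp only: of_real_mult[symmetric] of_real_minus[symmetric])
  qed
  finally show "lincomb (prodlim 2) y x = of_real (Re (nichZ y x))" by (simp add: Z_def)
qed

lemma tendsto_0_linear_bound:
  assumes "\<And>x. x > 0 \<Longrightarrow> \<bar>f x\<bar> \<le> C * x"
  shows "((\<lambda>x. complex_of_real (f x)) \<longlongrightarrow> 0) (at_right 0)"
proof -
  have "(f \<longlongrightarrow> 0) (at_right 0)"
  proof (rule Lim_null_comparison)
    show "\<forall>\<^sub>F x in at_right 0. norm (f x) \<le> C * x" using assms by (auto simp: eventually_at_filter)
    show "((\<lambda>x. C * x) \<longlongrightarrow> 0) (at_right 0)" by (auto intro!: tendsto_eq_intros)
  qed
  from tendsto_of_real[OF this, where 'a = complex] show ?thesis by simp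
qed

text \<open>Neither term need converge by itself; the common oscillating parts cancel in the
  difference. The plus sign in the second limit reflects that \<open>nichQ\<close> is minus \<theta>
  of \<open>nichN\<close>.\<close>

lemma nicholson_limits:
  assumes y: "y > 0"
  shows "((\<lambda>x. lincomb prod0 y x - of_real (nichN y x)) \<longlongrightarrow> 0) (at_right 0)"
    and "((\<lambda>x. lincomb prod1 y x + of_real (nichQ y x)) \<longlongrightarrow> 0) (at_right 0)"
    and "((\<lambda>x. lincomb prod2 y x - of_real (nichP y x)) \<longlongrightarrow> 0) (at_right 0)"
proof -
  note A = lincomb_asym[of prod0 0 y, OF prod_asym(1)] lincomb_asym[of prod1 1 y, OF prod_asym(2)] lincomb_asym[of prod2 2 y, OF prod_asym(3)]
  note B = tendsto_0_linear_bound[OF nichN_asymp[OF _ y]] tendsto_0_linear_bound[OF nichQ_asymp[of _ y]] tendsto_0_linear_bound[OF nichP_asymp[of _ y]]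
  have "((\<lambda>x. (of_real (y\<^sup>2) * (lincomb prod0 y x - lincomb (prodlim 0) y x)
     - of_real (y\<^sup>2 * nichN y x - (pi * y / 2 * (cosh (pi * y / 2) / sinh (pi * y / 2)) - Re (nichZ y x)))) / of_real (y\<^sup>2)) \<longlongrightarrow> (of_real (y\<^sup>2) * 0 - 0) / of_real (y\<^sup>2)) (at_right 0)"
    using y by (intro tendsto_intros A(1) B(1)) auto
  also have "(\<lambda>x. (of_real (y\<^sup>2) * (lincomb prod0 y x - lincomb (prodlim 0) y x)
     - of_real (y\<^sup>2 * nichN y x - (pi * y / 2 * (cosh (pi * y / 2) / sinh (pi * y / 2)) - Re (nichZ y x)))) / of_real (y\<^sup>2)) = (\<lambda>x. lincomb prod0 y x - of_real (nichN y x))"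
  proof
    fix x
    have "of_real (y\<^sup>2) * (lincomb prod0 y x - lincomb (prodlim 0) y x)
     - of_real (y\<^sup>2 * nichN y x - (pi * y / 2 * (cosh (pi * y / 2) / sinh (pi * y / 2)) - Re (nichZ y x)))
     = of_real (y\<^sup>2) * (lincomb prod0 y x - of_real (nichN y x))"
      unfolding right_diff_distrib lincomb_asym_eq(1)[OF y] by simp
    then show "(of_real (y\<^sup>2) * (lincomb prod0 y x - lincomb (prodlim 0) y x)
     - of_real (y\<^sup>2 * nichN y x - (pi * y / 2 * (cosh (pi * y / 2) / sinh (pi * y / 2)) - Re (nichZ y x)))) / of_real (y\<^sup>2) = lincomb prod0 y x - of_real (nichN y x)"
      using y by simp
  qed
  finally show "((\<lambda>x. lincomb prod0 y x - of_real (nichN y x)) \<longlongrightarrow> 0) (at_right 0)" by simp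
  have "((\<lambda>x. (of_real y * (lincomb prod1 y x - lincomb (prodlim 1) y x) + of_real (y * nichQ y x - Im (nichZ y x))) / of_real y) \<longlongrightarrow> (of_real y * 0 + 0) / of_real y) (at_right 0)"
    using y by (intro tendsto_intros A(2) B(2)) auto
  also have "(\<lambda>x. (of_real y * (lincomb prod1 y x - lincomb (prodlim 1) y x) + of_real (y * nichQ y x - Im (nichZ y x))) / of_real y) = (\<lambda>x. lincomb prod1 y x + of_real (nichQ y x))"
  proof
    fix x
    have "of_real y * (lincomb prod1 y x - lincomb (prodlim 1) y x) + of_real (y * nichQ y x - Im (nichZ y x)) = of_real y * (lincomb prod1 y x + of_real (nichQ y x))"
      unfolding right_diff_distrib lincomb_asym_eq(2)[OF y] by (simp add: algebra_simps)
    then show "(of_real y * (lincomb prod1 y x - lincomb (prodlim 1) y x) + of_real (y * nichQ y x - Im (nichZ y x))) / of_real y = lincomb prod1 y x + of_real (nichQ y x)"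
      using y by simp
  qed
  finally show "((\<lambda>x. lincomb prod1 y x + of_real (nichQ y x)) \<longlongrightarrow> 0) (at_right 0)" by simp
  have "((\<lambda>x. (lincomb prod2 y x - lincomb (prodlim 2) y x) - of_real (nichP y x - Re (nichZ y x))) \<longlongrightarrow> 0 - 0) (at_right 0)"
    by (intro tendsto_intros A(3) B(3))
  then show "((\<lambda>x. lincomb prod2 y x - of_real (nichP y x)) \<longlongrightarrow> 0) (at_right 0)"
    unfolding lincomb_asym_eq(3)[OF y] by simp
qed

lemma has_vector_derivative_linear_component:
  fixes f :: "real \<Rightarrow> complex"
  assumes "bounded_linear u" "(f has_vector_derivative f' / of_real x) (at x)" "x > 0"
  shows "((\<lambda>x. u (f x)) has_real_derivative u f' / x) (at x)"
proof -
  interpret bounded_linear u by fact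
  have "f' / of_real x = (1 / x) *\<^sub>R f'" by (simp add: scaleR_conv_of_real)
  then show ?thesis
    using has_vector_derivative[OF assms(2)] by (simp add: has_real_derivative_iff_has_vector_derivative scaleR)
qed

lemma lincomb_eq_nichN:
  assumes y: "y > 0" and x: "x > 0"
  shows "lincomb prod0 y x = of_real (nichN y x)"
proof -
  define D0 where "D0 = (\<lambda>x. lincomb prod0 y x - of_real (nichN y x))"
  define D1 where "D1 = (\<lambda>x. lincomb prod1 y x + of_real (nichQ y x))"
  define D2 where "D2 = (\<lambda>x. lincomb prod2 y x - of_real (nichP y x))"
  have d0: "(D0 has_vector_derivative D1 x / of_real x) (at x)" if "x > 0" for x
    using has_vector_derivative_diff[OF lincomb_deriv0[OF that] has_vector_derivative_of_real'[OF nichN_deriv[OF that]], of y y]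
    by (simp add: D0_def D1_def add_divide_distrib)
  have d1: "(D1 has_vector_derivative D2 x / of_real x) (at x)" if "x > 0" for x
    using has_vector_derivative_add[OF lincomb_deriv1[OF that] has_vector_derivative_of_real'[OF nichQ_deriv[OF that]], of y y]
    by (simp add: D1_def D2_def diff_divide_distrib)
  have d2: "(D2 has_vector_derivative (- (y\<^sup>2) *\<^sub>R D1 x - (4 * x\<^sup>2) *\<^sub>R (D1 x + D0 x)) / of_real x) (at x)" if "x > 0" for x
    unfolding D2_def
    by (rule has_vector_derivative_eq_rhs[OF has_vector_derivative_diff[OF lincomb_deriv2[OF that] has_vector_derivative_of_real'[OF nichP_deriv[OF that]], of y y]])
       (simp add: D1_def D0_def scaleR_conv_of_real algebra_simps add_divide_distrib diff_divide_distrib)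
  \<comment> \<open>The energy argument concerns real functions, whereas the Bessel side is not
    known to be real beforehand; \<open>u\<close> is instantiated with \<open>Re\<close> and
    \<open>Im\<close>.\<close>
  have z: "u (D0 x) = 0" if u: "bounded_linear u" for u :: "complex \<Rightarrow> real"
  proof (rule energy_zero[OF y, of "\<lambda>x. u (D0 x)" "\<lambda>x. u (D1 x)" "\<lambda>x. u (D2 x)" x])
    interpret u: bounded_linear u by fact
    show "((\<lambda>x. u (D0 x)) has_real_derivative u (D1 x) / x) (at x)" if "x > 0" for x
      by (rule has_vector_derivative_linear_component[OF u d0[OF that] that])
    show "((\<lambda>x. u (D1 x)) has_real_derivative u (D2 x) / x) (at x)" if "x > 0" for x
      by (rule has_vector_derivative_linear_component[OF u d1[OF that] that])
    show "((\<lambda>x. u (D2 x)) has_real_derivative (- y\<^sup>2 * u (D1 x) - 4 * x\<^sup>2 * (u (D1 x) + u (D0 x))) / x) (at x)" if "x > 0" for x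
      using has_vector_derivative_linear_component[OF u d2[OF that] that] by (simp add: u.add u.diff u.scaleR u.neg)
    show "((\<lambda>x. u (D0 x)) \<longlongrightarrow> 0) (at_right 0)" "((\<lambda>x. u (D1 x)) \<longlongrightarrow> 0) (at_right 0)" "((\<lambda>x. u (D2 x)) \<longlongrightarrow> 0) (at_right 0)"
      using u.tendsto[OF nicholson_limits(1)[OF y]] u.tendsto[OF nicholson_limits(2)[OF y]] u.tendsto[OF nicholson_limits(3)[OF y]]
      by (simp_all add: D0_def D1_def D2_def)
  qed fact
  have "D0 x = 0" using z[OF bounded_linear_Re] z[OF bounded_linear_Im] by (simp add: complex_eq_iff)
  then show ?thesis by (simp add: D0_def)
qed

lemma nicholson:
  assumes y: "y > 0" and x: "x > 0"
  shows "(besselJ (\<i> * of_real y / 2) x)\<^sup>2 + (besselY (\<i> * of_real y / 2) x)\<^sup>2 = of_real (8 / pi\<^sup>2 * nichN y x)"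
proof -
  define \<mu> where "\<mu> = \<i> * complex_of_real y / 2"
  define s where "s = sinh (pi * y / 2)"
  define c where "c = cosh (pi * y / 2)"
  have s: "s > 0" using y by (simp add: s_def)
  have sin: "sin (\<mu> * of_real pi) = \<i> * of_real s"
    using sin_i_times[of "of_real (pi * y / 2)"]
    by (simp add: \<mu>_def s_def sinh_field_def mult_ac exp_minus flip: exp_of_real)
  have cos: "cos (\<mu> * of_real pi) = of_real c"
    using cos_i_times[of "of_real (pi * y / 2)"]
    by (simp add: \<mu>_def c_def cosh_field_def mult_ac exp_minus flip: exp_of_real)
  define U1 where "U1 = besselJ \<mu> x"
  define U2 where "U2 = besselJ (- \<mu>) x"
  have cs: "c\<^sup>2 = s\<^sup>2 + 1" by (simp add: c_def s_def cosh_square_eq)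
  have Y: "besselY \<mu> x = (U1 * of_real c - U2) / (\<i> * of_real s)"
    unfolding besselY_def sin cos by (simp add: U1_def U2_def)
  have "(besselJ \<mu> x)\<^sup>2 + (besselY \<mu> x)\<^sup>2 = U1\<^sup>2 - (U1 * of_real c - U2)\<^sup>2 / of_real (s\<^sup>2)"
    unfolding Y by (simp add: U1_def power_divide power_mult_distrib)
  also have "\<dots> = (of_real (s\<^sup>2) * U1\<^sup>2 - (U1\<^sup>2 * of_real (c\<^sup>2) - 2 * of_real c * (U1 * U2) + U2\<^sup>2)) / of_real (s\<^sup>2)"
    using s by (simp add: diff_divide_distrib power2_eq_square algebra_simps add_divide_distrib)
  \<comment> \<open>The identity cosh^2 = sinh^2 + 1 leaves an expression symmetric in the orders
    \<mu> and -\<mu>, as in \<open>lincomb\<close>.\<close>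
  also have "\<dots> = (2 * of_real c * (U1 * U2) - (U1\<^sup>2 + U2\<^sup>2)) / of_real (s\<^sup>2)"
    unfolding cs by (simp add: algebra_simps)
  also have "\<dots> = of_real (8 / pi\<^sup>2) * lincomb prod0 y x"
  proof -
    have L: "lincomb prod0 y x = of_real (pi\<^sup>2 / 8) * ((2 * of_real c * (U1 * U2) - (U1\<^sup>2 + U2\<^sup>2)) / of_real (s\<^sup>2))"
      unfolding lincomb_def Let_def prod0_def \<mu>_def[symmetric] s_def[symmetric] c_def[symmetric] U1_def[symmetric] U2_def[symmetric]
        nichA_def nichB_def
      using s by (simp add: field_simps power2_eq_square)
    have "complex_of_real (8 / pi\<^sup>2) * (of_real (pi\<^sup>2 / 8) * z) = z" for z
      by (simp flip: mult.assoc of_real_mult)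
    then show ?thesis unfolding L ..
  qed
  finally show ?thesis using lincomb_eq_nichN[OF y x] by (simp add: \<mu>_def)
qed

section \<open>The Bessel function \<open>J\<^sub>0\<close>\<close>

text \<open>Defined through \<open>bseries\<close>, it is continuous on the whole line with value 1
  at 0, whereas \<open>besselJ 0 0\<close> is 0 because \<open>0 powr 0 = 0\<close>.\<close>

definition j0 :: "real \<Rightarrow> real" where "j0 x = Re (bseries 0 (of_real ((x / 2)\<^sup>2)))"
definition j0_theta :: "real \<Rightarrow> real" where "j0_theta x = Re (bseries_theta 0 x)"

lemma continuous_on_j0 [continuous_intros]:
  "continuous_on A f \<Longrightarrow> continuous_on A (\<lambda>x. j0 (f x))"
  unfolding j0_def
  by (intro continuous_intros continuous_on_compose2[OF continuous_at_imp_continuous_on[of UNIV "bseries 0"]]) (auto intro: continuous_bseries)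

lemma continuous_on_j0_theta [continuous_intros]:
  "continuous_on A f \<Longrightarrow> continuous_on A (\<lambda>x. j0_theta (f x))"
proof -
  have bseries: "continuous_on A (\<lambda>x. bseries \<nu> (g x))" if "continuous_on A g" for \<nu> and A :: "'a set" and g
    using that by (intro continuous_on_compose2[OF continuous_at_imp_continuous_on[of UNIV "bseries \<nu>"]]) (auto intro: continuous_bseries)
  then show "continuous_on A f \<Longrightarrow> continuous_on A (\<lambda>x. j0_theta (f x))"
    unfolding j0_theta_def bseries_theta_def by (intro continuous_intros bseries) auto
qed

lemma borel_measurable_j0 [measurable]: "j0 \<in> borel_measurable borel"
  by (intro borel_measurable_continuous_onI continuous_intros)

text \<open>The partial sums are real and the reals are closed, so the \<open>Re\<close> in
  \<open>j0\<close> loses nothing.\<close>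

lemma besselJ_0_eq: "x > 0 \<Longrightarrow> besselJ 0 x = of_real (j0 x)"
proof -
  assume x: "x > 0"
  have real: "bcoeff 0 k * of_real ((x / 2)\<^sup>2) ^ k \<in> \<real>" for k
  proof -
    have "rGamma (of_nat k + 0 + 1 :: complex) = of_real (rGamma (real k + 1))"
      by (simp add: rGamma_complex_of_real[symmetric])
    then have "bcoeff 0 k * of_real ((x / 2)\<^sup>2) ^ k = of_real ((- 1) ^ k * rGamma (real k + 1) / fact k * ((x / 2)\<^sup>2) ^ k)"
      by (simp add: bcoeff_def)
    then show ?thesis by (simp only: Reals_of_real)
  qed
  have "bseries 0 (of_real ((x / 2)\<^sup>2)) \<in> \<real>"
  proof (rule closed_sequentially[OF closed_complex_Reals])
    show "(\<Sum>k<n. bcoeff 0 k * of_real ((x / 2)\<^sup>2) ^ k) \<in> \<real>" for n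
      by (rule sum_in_Reals) (rule real)
    show "(\<lambda>n. \<Sum>k<n. bcoeff 0 k * of_real ((x / 2)\<^sup>2) ^ k) \<longlonglongrightarrow> bseries 0 (of_real ((x / 2)\<^sup>2))"
      unfolding bseries_def by (rule summable_LIMSEQ[OF summable_bseries])
  qed
  then show ?thesis by (simp add: besselJ_eq[OF x] j0_def of_real_Re)
qed

lemma j0_deriv: "x > 0 \<Longrightarrow> (j0 has_real_derivative j0_theta x / x) (at x)"
proof -
  assume x: "x > 0"
  have "((\<lambda>x. Re (besselJ 0 x)) has_real_derivative Re (besselJ_theta 0 x) / x) (at x)"
    by (rule has_vector_derivative_linear_component[OF bounded_linear_Re besselJ_deriv x]) fact
  then have "((\<lambda>x. Re (besselJ 0 x)) has_real_derivative j0_theta x / x) (at x)"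
    by (simp add: besselJ_theta_def j0_theta_def)
  then show ?thesis
    by (rule has_field_derivative_transform_within_open[where S = "{0<..}"]) (use x besselJ_0_eq in auto)
qed

lemma j0_theta_deriv: "x > 0 \<Longrightarrow> (j0_theta has_real_derivative - x * j0 x) (at x)"
proof -
  assume x: "x > 0"
  have "((\<lambda>x. Re (besselJ_theta 0 x)) has_real_derivative Re ((0\<^sup>2 - of_real (x\<^sup>2)) * besselJ 0 x) / x) (at x)"
    by (rule has_vector_derivative_linear_component[OF bounded_linear_Re besselJ_theta_deriv x]) fact
  then show ?thesis
    using x by (simp add: besselJ_theta_def j0_theta_def[abs_def] besselJ_0_eq power2_eq_square flip: of_real_mult)
qed

lemma j0_tendsto: "(j0 \<longlongrightarrow> 1) (at_right 0)"
proof -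
  have "(j0 \<longlongrightarrow> Re (rGamma (0 + 1))) (at_right 0)"
    unfolding j0_def[abs_def] by (intro tendsto_intros bseries_tendsto)
  then show ?thesis by (simp add: rGamma_inverse_Gamma)
qed

text \<open>Up to sign this is x J_1(x). A linear rate at 0 outweighs the bound 4 / sqrt z on
  \<open>K0\<close> in a boundary term and gives the square-root bound on (0, 1].\<close>

lemma j0_theta_small: "\<exists>C. \<forall>x. 0 \<le> x \<longrightarrow> x \<le> 1 \<longrightarrow> \<bar>j0_theta x\<bar> \<le> C * x"
proof -
  have "continuous_on {0..1::real} (\<lambda>x. bseries 1 (of_real ((x / 2)\<^sup>2)))"
    by (intro continuous_intros continuous_on_compose2[OF continuous_at_imp_continuous_on[of UNIV "bseries 1"]]) (auto intro: continuous_bseries)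
  from compact_imp_bounded[OF compact_continuous_image[OF this compact_Icc]]
  obtain C where "\<forall>x\<in>{0..1}. norm (bseries 1 (of_real ((x / 2)\<^sup>2))) \<le> C"
    by (auto simp: bounded_iff)
  then have C: "\<And>x. 0 \<le> x \<Longrightarrow> x \<le> 1 \<Longrightarrow> norm (bseries 1 (of_real ((x / 2)\<^sup>2))) \<le> C" by simp
  have C0: "C \<ge> 0" using C[of 0] norm_ge_zero order_trans by (metis order_refl zero_le_one)
  have "\<bar>j0_theta x\<bar> \<le> C * x" if "0 \<le> x" "x \<le> 1" for x
  proof -
    have "\<bar>j0_theta x\<bar> \<le> norm (bseries_theta 0 x)" unfolding j0_theta_def by (rule abs_Re_le_cmod)
    also have "bseries_theta 0 x = of_real (- 2 * (x / 2)\<^sup>2) * bseries 1 (of_real ((x / 2)\<^sup>2))"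
      by (simp add: bseries_theta_def)
    also have "norm \<dots> = x\<^sup>2 / 2 * norm (bseries 1 (of_real ((x / 2)\<^sup>2)))"
      unfolding norm_mult norm_of_real by (simp add: power_divide)
    also have "\<dots> \<le> x * C"
    proof (rule mult_mono)
      show "x\<^sup>2 / 2 \<le> x" using that mult_left_le[of x x] by (simp add: power2_eq_square)
    qed (use that C C0 in auto)
    finally show ?thesis by (simp add: mult.commute)
  qed
  then show ?thesis by blast
qed

text \<open>\<open>E\<close> is the energy of \<open>\<surd>x J\<^sub>0(x)\<close>, which solves \<open>y'' + (1 + 1/(4x\<^sup>2)) y = 0\<close>.\<close>

lemma j0_energy:
  assumes x: "x \<ge> 1"
  defines "E \<equiv> \<lambda>x. (j0 x / 2 + j0_theta x)\<^sup>2 / x + x * (j0 x)\<^sup>2 + (j0 x)\<^sup>2 / (4 * x)"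
  shows "E x \<le> E 1"
proof (rule DERIV_nonpos_imp_nonincreasing[OF x])
  fix x :: real assume "1 \<le> x"
  then have x: "x > 0" by simp
  have "(E has_real_derivative (2 * (j0 x / 2 + j0_theta x) * (j0_theta x / x / 2 + - x * j0 x) * x - (j0 x / 2 + j0_theta x)\<^sup>2 * 1) / (x * x)
     + ((j0 x)\<^sup>2 + x * (2 * j0 x * (j0_theta x / x))) + ((2 * j0 x * (j0_theta x / x)) * (4 * x) - (j0 x)\<^sup>2 * 4) / ((4 * x) * (4 * x))) (at x)"
    unfolding E_def
    by (rule derivative_eq_intros j0_deriv[OF x] j0_theta_deriv[OF x] refl | use x in \<open>simp add: field_simps\<close>)+
  also have "(2 * (j0 x / 2 + j0_theta x) * (j0_theta x / x / 2 + - x * j0 x) * x - (j0 x / 2 + j0_theta x)\<^sup>2 * 1) / (x * x)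
     + ((j0 x)\<^sup>2 + x * (2 * j0 x * (j0_theta x / x))) + ((2 * j0 x * (j0_theta x / x)) * (4 * x) - (j0 x)\<^sup>2 * 4) / ((4 * x) * (4 * x)) = - (j0 x)\<^sup>2 / (2 * x\<^sup>2)"
    using x by (simp add: field_simps power2_eq_square)
  finally show "\<exists>D. (E has_real_derivative D) (at x) \<and> D \<le> 0"
    by (intro exI conjI) auto
qed

text \<open>For x \<ge> 1 both bounds are read off from the energy, for x \<le> 1 from compactness
  and \<open>j0_theta_small\<close>. The square-root growth of \<open>j0_theta\<close> is what later
  makes \<open>phi\<close> decay.\<close>

lemma j0_bounds:
  obtains B where "B > 0" "\<And>x. x > 0 \<Longrightarrow> \<bar>j0 x\<bar> \<le> B" "\<And>x. x > 0 \<Longrightarrow> \<bar>j0_theta x\<bar> \<le> B * sqrt x"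
proof -
  define E1 where "E1 = (j0 1 / 2 + j0_theta 1)\<^sup>2 / 1 + 1 * (j0 1)\<^sup>2 + (j0 1)\<^sup>2 / (4 * 1)"
  have E: "(j0 x / 2 + j0_theta x)\<^sup>2 / x + x * (j0 x)\<^sup>2 + (j0 x)\<^sup>2 / (4 * x) \<le> E1" if "x \<ge> 1" for x
    using j0_energy[OF that] by (simp add: E1_def)
  define S where "S = sqrt E1"
  have S0: "S \<ge> 0" by (simp add: S_def E1_def)
  have big0: "\<bar>j0 x\<bar> \<le> S" if x: "x \<ge> 1" for x
  proof -
    have "(j0 x)\<^sup>2 \<le> x * (j0 x)\<^sup>2" using mult_right_mono[of 1 x "(j0 x)\<^sup>2"] x by simp
    also have "\<dots> \<le> E1"
    proof -
      have "0 \<le> (j0 x / 2 + j0_theta x)\<^sup>2 / x" "0 \<le> (j0 x)\<^sup>2 / (4 * x)" using x by auto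
      then show ?thesis using E[OF x] by linarith
    qed
    finally have "sqrt ((j0 x)\<^sup>2) \<le> S" unfolding S_def by (rule real_sqrt_le_mono)
    then show ?thesis by simp
  qed
  have big1: "\<bar>j0_theta x\<bar> \<le> 2 * S * sqrt x" if x: "x \<ge> 1" for x
  proof -
    have "(j0 x / 2 + j0_theta x)\<^sup>2 / x \<le> E1"
    proof -
      have "0 \<le> x * (j0 x)\<^sup>2" "0 \<le> (j0 x)\<^sup>2 / (4 * x)" using x by auto
      then show ?thesis using E[OF x] by linarith
    qed
    then have "(j0 x / 2 + j0_theta x)\<^sup>2 \<le> E1 * x" using x by (simp add: field_simps)
    then have "sqrt ((j0 x / 2 + j0_theta x)\<^sup>2) \<le> sqrt (E1 * x)" by (rule real_sqrt_le_mono)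
    then have "\<bar>j0 x / 2 + j0_theta x\<bar> \<le> S * sqrt x" by (simp add: S_def real_sqrt_mult)
    moreover have "S \<le> S * sqrt x" using mult_left_mono[of 1 "sqrt x" S] S0 x by simp
    moreover have "\<bar>j0_theta x\<bar> \<le> \<bar>j0 x / 2 + j0_theta x\<bar> + \<bar>j0 x\<bar>" by linarith
    ultimately show ?thesis using big0[OF x] by linarith
  qed
  have "continuous_on {0..1} j0" by (intro continuous_intros)
  from compact_imp_bounded[OF compact_continuous_image[OF this compact_Icc]]
  obtain B0 where "\<forall>x\<in>{0..1}. \<bar>j0 x\<bar> \<le> B0"
    by (auto simp: bounded_iff)
  then have B0: "\<And>x. 0 \<le> x \<Longrightarrow> x \<le> 1 \<Longrightarrow> \<bar>j0 x\<bar> \<le> B0" by simp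
  obtain C where C: "\<And>x. 0 \<le> x \<Longrightarrow> x \<le> 1 \<Longrightarrow> \<bar>j0_theta x\<bar> \<le> C * x" using j0_theta_small by blast
  have C0: "C \<ge> 0" using order_trans[OF abs_ge_zero C[of 1]] by simp
  have B00: "B0 \<ge> 0" using order_trans[OF abs_ge_zero B0[of 1]] by simp
  show ?thesis
  proof
    show "1 + 2 * S + B0 + C > 0" using S0 B00 C0 by simp
    fix x :: real assume x: "x > 0"
    show "\<bar>j0 x\<bar> \<le> 1 + 2 * S + B0 + C"
      using B0[of x] big0[of x] x S0 B00 C0 by (cases "x \<le> 1") auto
    show "\<bar>j0_theta x\<bar> \<le> (1 + 2 * S + B0 + C) * sqrt x"
    proof (cases "x \<le> 1")
      case True
      have "x = sqrt x * sqrt x" using x by simp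
      also have "\<dots> \<le> sqrt x * 1" using True x by (intro mult_left_mono) auto
      finally have "C * x \<le> C * sqrt x" using C0 by (simp add: mult_left_mono)
      also have "\<dots> \<le> (1 + 2 * S + B0 + C) * sqrt x" using S0 B00 x by (intro mult_right_mono) auto
      finally show ?thesis using C[of x] True x by simp
    next
      case False
      have "2 * S * sqrt x \<le> (1 + 2 * S + B0 + C) * sqrt x" using C0 B00 x by (intro mult_right_mono) auto
      then show ?thesis using big1[of x] False by linarith
    qed
  qed
qed

section \<open>The two closed-form integrals behind the biorthogonality\<close>

lemma integral_j0_K0:
  assumes a: "a > 0" and b: "b > 0"
  shows "has_bochner_integral hl (\<lambda>x. x * (j0 (b * x) * K0 (a * x))) (1 / (a\<^sup>2 + b\<^sup>2))"
proof -
  obtain B where B: "B > 0" "\<And>x. x > 0 \<Longrightarrow> \<bar>j0 x\<bar> \<le> B" "\<And>x. x > 0 \<Longrightarrow> \<bar>j0_theta x\<bar> \<le> B * sqrt x"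
    using j0_bounds by blast
  obtain C where C: "\<And>x. 0 \<le> x \<Longrightarrow> x \<le> 1 \<Longrightarrow> \<bar>j0_theta x\<bar> \<le> C * x" using j0_theta_small by blast
  let ?g = "\<lambda>x. x * (j0 (b * x) * K0 (a * x))"
  have cK: "continuous_on {0<..} (\<lambda>x. K0 (a * x))"
    by (rule continuous_on_compose2[OF continuous_on_K0]) (use a in \<open>auto intro!: continuous_intros\<close>)
  have ig: "integrable hl ?g"
  proof (rule integrable_hl_exp_bound[where x = "a / 2" and C = "B * 2 / a"])
    fix x :: real assume x: "x > 0"
    have ax: "a * x > 0" and bx: "b * x > 0" using a b x by auto
    have "x * K0 (a * x) = (a * x) * K0 (a * x) / a" using a by simp
    also have "\<dots> \<le> (2 * exp (- (a * x) / 2)) / a"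
      using order_trans[OF K0_le_zK1[OF ax] zK1_le_exp[OF ax]] a by (intro divide_right_mono) auto
    finally have "\<bar>j0 (b * x)\<bar> * (x * K0 (a * x)) \<le> B * ((2 * exp (- (a * x) / 2)) / a)"
      using B(2)[OF bx] x K0_nonneg[of "a * x"] B(1) by (intro mult_mono) auto
    then show "\<bar>?g x\<bar> \<le> B * 2 / a * exp (- (a / 2) * x)"
      using x K0_nonneg[of "a * x"] by (simp add: abs_mult mult_ac)
  qed (use a cK in \<open>auto intro!: continuous_intros\<close>)
  \<comment> \<open>The Wronskian u \<theta>v - v \<theta>u of u = J_0(bx) and v = K_0(ax). As
    \<theta>^2 u = -b^2 x^2 u and \<theta>^2 v = a^2 x^2 v, its derivative is (a^2 + b^2) x u v; its
    limit at 0 is -1.\<close>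
  let ?F = "\<lambda>x. - (j0 (b * x) * zK1 (a * x)) - j0_theta (b * x) * K0 (a * x)"
  have "integral\<^sup>L hl (\<lambda>x. (a\<^sup>2 + b\<^sup>2) * ?g x) = 0 - (- 1)"
  proof (rule integral_hl_FTC[where F = ?F])
    fix x :: real assume x: "x > 0"
    have ax: "a * x > 0" and bx: "b * x > 0" using a b x by auto
    have l: "((\<lambda>x. c * x) has_real_derivative c) (at x)" for c by (auto intro!: derivative_eq_intros)
    note d = DERIV_chain2[OF j0_deriv[OF bx] l] DERIV_chain2[OF j0_theta_deriv[OF bx] l] DERIV_chain2[OF zK1_deriv[OF ax] l] DERIV_chain2[OF K0_deriv[OF ax] l]
    have "(?F has_real_derivative - (j0_theta (b * x) / (b * x) * b * zK1 (a * x) + (- (a * x) * K0 (a * x) * a) * j0 (b * x))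
        - ((- (b * x) * j0 (b * x) * b) * K0 (a * x) + (- zK1 (a * x) / (a * x) * a) * j0_theta (b * x))) (at x)"
      by (intro DERIV_diff DERIV_minus DERIV_mult d)
    also have "- (j0_theta (b * x) / (b * x) * b * zK1 (a * x) + (- (a * x) * K0 (a * x) * a) * j0 (b * x))
        - ((- (b * x) * j0 (b * x) * b) * K0 (a * x) + (- zK1 (a * x) / (a * x) * a) * j0_theta (b * x)) = (a\<^sup>2 + b\<^sup>2) * ?g x"
      using a b x by (simp add: field_simps power2_eq_square)
    finally show "(?F has_real_derivative (a\<^sup>2 + b\<^sup>2) * ?g x) (at x)" .
  next
    show "continuous_on {0<..} (\<lambda>x. (a\<^sup>2 + b\<^sup>2) * ?g x)" by (intro continuous_intros cK)
    show "integrable hl (\<lambda>x. (a\<^sup>2 + b\<^sup>2) * ?g x)" using ig by simp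
    have fl: "filterlim (\<lambda>x. c * x) (at_right 0) (at_right 0)" if "c > 0" for c :: real
      using that by real_asymp
    have "((\<lambda>x. j0_theta (b * x) * K0 (a * x)) \<longlongrightarrow> 0) (at_right 0)"
    proof (rule Lim_null_comparison)
      have "norm (j0_theta (b * x) * K0 (a * x)) \<le> C * (b * x) * (4 / sqrt (a * x))" if "0 < x" "x < 1 / b" for x
      proof -
        have "\<bar>j0_theta (b * x)\<bar> \<le> C * (b * x)" using that b by (intro C) (auto simp: field_simps)
        moreover have "K0 (a * x) \<le> 4 / sqrt (a * x)" using that a by (intro K0_le_sqrt) auto
        ultimately show ?thesis using K0_nonneg[of "a * x"] unfolding real_norm_def abs_mult
          by (intro mult_mono) auto
      qed
      then show "\<forall>\<^sub>F x in at_right 0. norm (j0_theta (b * x) * K0 (a * x)) \<le> C * (b * x) * (4 / sqrt (a * x))"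
        using b by (auto simp: eventually_at_right_field intro!: exI[of _ "1 / b"])
      show "((\<lambda>x. C * (b * x) * (4 / sqrt (a * x))) \<longlongrightarrow> 0) (at_right 0)"
      proof -
        have "((\<lambda>x. (b * x) * (4 / sqrt (a * x))) \<longlongrightarrow> 0) (at_right 0)" using a b by real_asymp
        from tendsto_mult_right_zero[OF this, of C] show ?thesis by (simp add: mult.assoc)
      qed
    qed
    then have "(?F \<longlongrightarrow> - (1 * 1) - 0) (at_right 0)"
      by (intro tendsto_intros filterlim_compose[OF j0_tendsto fl[OF b]] filterlim_compose[OF zK1_tendsto_0 fl[OF a]])
    then show "(?F \<longlongrightarrow> - 1) (at_right 0)" by simp
    have "((\<lambda>x. j0 (b * x) * zK1 (a * x)) \<longlongrightarrow> 0) at_top"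
    proof (rule tendsto_0_exp_bound[of "a / 2" _ "2 * B"])
      fix x :: real assume x: "x > 0"
      then have ax: "a * x > 0" and bx: "b * x > 0" using a b by auto
      have "\<bar>j0 (b * x)\<bar> * zK1 (a * x) \<le> B * (2 * exp (- (a * x) / 2))"
        using B(1) B(2)[OF bx] zK1_le_exp[OF ax] zK1_pos[OF ax] by (intro mult_mono) auto
      then show "\<bar>j0 (b * x) * zK1 (a * x)\<bar> \<le> 2 * B * exp (- (a / 2) * x)"
        using zK1_pos[OF ax] by (simp add: abs_mult mult_ac)
    qed (use a in auto)
    moreover have "((\<lambda>x. j0_theta (b * x) * K0 (a * x)) \<longlongrightarrow> 0) at_top"
    proof (rule Lim_null_comparison)
      have "norm (j0_theta (b * x) * K0 (a * x)) \<le> B * (sqrt (b * x) * (2 * exp (- (a * x) / 2) / (a * x)))" if x: "x > 0" for x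
      proof -
        have ax: "a * x > 0" and bx: "b * x > 0" using a b x by auto
        have "K0 (a * x) \<le> 2 * exp (- (a * x) / 2) / (a * x)"
          using order_trans[OF K0_le_zK1[OF ax] zK1_le_exp[OF ax]] ax by (simp add: pos_le_divide_eq mult.commute)
        with B(3)[OF bx] show ?thesis using K0_nonneg[of "a * x"] B(1) bx unfolding real_norm_def abs_mult mult.assoc[symmetric, of B]
          by (intro mult_mono) auto
      qed
      then show "\<forall>\<^sub>F x in at_top. norm (j0_theta (b * x) * K0 (a * x)) \<le> B * (sqrt (b * x) * (2 * exp (- (a * x) / 2) / (a * x)))"
        by (auto intro: eventually_mono[OF eventually_gt_at_top[of 0]])
      have "((\<lambda>x. sqrt (b * x) * (2 * exp (- (a * x) / 2) / (a * x))) \<longlongrightarrow> 0) at_top" using a b by real_asymp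
      from tendsto_mult_right_zero[OF this, of B]
      show "((\<lambda>x. B * (sqrt (b * x) * (2 * exp (- (a * x) / 2) / (a * x)))) \<longlongrightarrow> 0) at_top" .
    qed
    ultimately have "(?F \<longlongrightarrow> - 0 - 0) at_top" by (intro tendsto_intros)
    then show "(?F \<longlongrightarrow> 0) at_top" by simp
  qed
  then have "(a\<^sup>2 + b\<^sup>2) * integral\<^sup>L hl ?g = 1" by simp
  moreover have "a\<^sup>2 + b\<^sup>2 > 0" using a by (simp add: add_pos_nonneg)
  moreover have "I = 1 / s" if "s * I = 1" "s > 0" for s I :: real
    using that by (simp add: field_simps)
  ultimately have "integral\<^sup>L hl ?g = 1 / (a\<^sup>2 + b\<^sup>2)" by blast
  with ig show ?thesis by (simp add: has_bochner_integral_iff)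
qed

text \<open>The quotient is half of tanh(t + u) - tanh(t - u). One integration by parts leaves
  translates of 1 / cosh^2, whose sine integrals follow from the known transform by the addition
  theorem.\<close>

lemma integral_cos_over_cosh:
  assumes k: "k > 0" and u: "u \<ge> 0"
  shows "(\<integral>t. cos (k * t) * (sinh (2 * u) / (cosh (2 * t) + cosh (2 * u))) \<partial>hl) = (pi / 2) * sin (k * u) / sinh (pi * k / 2)"
proof -
  define S where "S = pi * k / sinh (pi * k / 2)"
  let ?T = "\<lambda>t. (tanh (t + u) - tanh (t - u)) / 2"
  have T: "sinh (2 * u) / (cosh (2 * t) + cosh (2 * u)) = ?T t" for t
  proof -
    have p: "cosh (t + u) \<noteq> 0" "cosh (t - u) \<noteq> 0" by simp_all
    have "?T t = (sinh (t + u) * cosh (t - u) - sinh (t - u) * cosh (t + u)) / (2 * (cosh (t + u) * cosh (t - u)))"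
      using p by (simp add: tanh_def field_simps)
    also have "sinh (t + u) * cosh (t - u) - sinh (t - u) * cosh (t + u) = sinh ((t + u) - (t - u))"
      by (simp only: sinh_diff mult.commute)
    also have "(t + u) - (t - u) = 2 * u" by simp
    also have "2 * (cosh (t + u) * cosh (t - u)) = cosh ((t + u) + (t - u)) + cosh ((t + u) - (t - u))"
      unfolding cosh_add cosh_diff by (simp add: algebra_simps)
    also have "\<dots> = cosh (2 * t) + cosh (2 * u)" by simp
    finally show ?thesis ..
  qed
  let ?q = "\<lambda>t. sin (k * t) / (cosh (t + u))\<^sup>2 - sin (k * t) / (cosh (t - u))\<^sup>2"
  have cis: "has_bochner_integral lborel (\<lambda>w. cos (k * w) / (cosh w)\<^sup>2) S" "has_bochner_integral lborel (\<lambda>w. sin (k * w) / (cosh w)\<^sup>2) 0"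
  proof -
    show "has_bochner_integral lborel (\<lambda>w. cos (k * w) / (cosh w)\<^sup>2) S"
      unfolding S_def by (rule integral_sech_square_cos[OF k])
    have "Im (exp (\<i> * of_real (k * w)) / of_real ((cosh w)\<^sup>2)) = sin (k * w) / (cosh w)\<^sup>2" for w
      by (simp only: Im_divide_of_real) (simp add: Im_exp)
    then show "has_bochner_integral lborel (\<lambda>w. sin (k * w) / (cosh w)\<^sup>2) 0"
      using has_bochner_integral_bounded_linear[OF bounded_linear_Im has_bochner_integral_sech_square_cis[OF k]] by simp
  qed
  have shift: "has_bochner_integral lborel (\<lambda>t. sin (k * t) / (cosh (t + v))\<^sup>2) (- sin (k * v) * S)" for v
  proof -
    have "has_bochner_integral lborel (\<lambda>w. sin (k * w) / (cosh w)\<^sup>2 * cos (k * v) - cos (k * w) / (cosh w)\<^sup>2 * sin (k * v)) (0 * cos (k * v) - S * sin (k * v))"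
      by (intro has_bochner_integral_diff has_bochner_integral_mult_left cis)
    moreover have "sin (k * w) / (cosh w)\<^sup>2 * cos (k * v) - cos (k * w) / (cosh w)\<^sup>2 * sin (k * v) = sin (k * (w - v)) / (cosh w)\<^sup>2" for w
      by (simp add: right_diff_distrib sin_diff diff_divide_distrib)
    ultimately have "has_bochner_integral lborel (\<lambda>w. sin (k * (w - v)) / (cosh w)\<^sup>2) (- sin (k * v) * S)" by (simp add: mult.commute)
    from lborel_has_bochner_integral_real_affine_iff[of 1 _ _ v, THEN iffD1, OF _ this]
    show ?thesis by (simp add: add.commute)
  qed
  have q: "has_bochner_integral lborel ?q (- 2 * sin (k * u) * S)"
    using has_bochner_integral_diff[OF shift[of u] shift[of "-u"]] by (simp add: mult_ac)
  then have iq: "integrable lborel ?q" by (simp add: has_bochner_integral_iff)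
  \<comment> \<open>Evenness halves the integral over the line; reflecting t exchanges the two
    translates and flips the sine.\<close>
  have "?q (- t) = ?q t" for t
  proof -
    have "cosh (- t + u) = cosh (t - u)"
      using cosh_minus[of "t - u"] by (simp only: minus_diff_eq uminus_add_conv_diff)
    moreover have "cosh (- t - u) = cosh (t + u)"
      using cosh_minus[of "t + u"] by (simp only: minus_add_distrib diff_conv_add_uminus)
    ultimately show ?thesis by (simp only: mult_minus_right sin_minus)
  qed
  then have even: "(\<lambda>t. ?q (- t)) = ?q" by (rule ext)
  have "- 2 * sin (k * u) * S = integral\<^sup>L hl ?q + integral\<^sup>L hl ?q"
    using integral_lborel_split[OF iq] has_bochner_integral_integral_eq[OF q] unfolding even by (rule trans[OF sym, rotated])
  then have hq: "integral\<^sup>L hl ?q = - sin (k * u) * S" by linarith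
  have iT: "integrable hl (\<lambda>t. cos (k * t) * ?T t)"
  proof (rule integrable_hl_exp_bound[where x = 2 and C = "sinh (2 * u) * 2"])
    show "continuous_on {0<..} (\<lambda>t. cos (k * t) * ?T t)" by (intro continuous_intros) auto
    fix t :: real
    have s: "sinh (2 * u) \<ge> 0" using u by simp
    have "\<bar>?T t\<bar> \<le> sinh (2 * u) * 2 * exp (- 2 * t)"
    proof -
      have c: "cosh (2 * t) + cosh (2 * u) > 0" by (simp add: add_pos_pos)
      have "exp (2 * t) / 2 \<le> cosh (2 * t) + cosh (2 * u)"
        using cosh_ge_half_exp[of "2 * t"] cosh_real_nonneg[of "2 * u"] by linarith
      then have "1 / (cosh (2 * t) + cosh (2 * u)) \<le> 1 / (exp (2 * t) / 2)"
        by (intro divide_left_mono mult_pos_pos c) auto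
      also have "\<dots> = 2 * exp (- 2 * t)" by (simp add: exp_minus field_simps)
      finally have "sinh (2 * u) * (1 / (cosh (2 * t) + cosh (2 * u))) \<le> sinh (2 * u) * (2 * exp (- 2 * t))"
        using s by (rule mult_left_mono)
      then show ?thesis unfolding T[symmetric] using s c by (simp add: abs_mult)
    qed
    then show "\<bar>cos (k * t) * ?T t\<bar> \<le> sinh (2 * u) * 2 * exp (- 2 * t)" by (intro abs_mult_trig_le) auto
  qed simp
  let ?f = "\<lambda>t. ?q t / 2 + k * (cos (k * t) * ?T t)"
  have "integral\<^sup>L hl ?f = 0 - 0"
  proof (rule integral_hl_FTC[where F = "\<lambda>t. sin (k * t) * ?T t"])
    fix t :: real
    have e: "1 - (tanh t)\<^sup>2 = 1 / (cosh t)\<^sup>2" for t :: real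
    proof -
      have "1 - (tanh t)\<^sup>2 = ((cosh t)\<^sup>2 - (sinh t)\<^sup>2) / (cosh t)\<^sup>2"
        by (simp add: tanh_def power_divide diff_divide_distrib)
      then show ?thesis by (simp add: hyperbolic_pythagoras)
    qed
    have "((\<lambda>t. sin (k * t) * ?T t) has_real_derivative cos (k * t) * k * ?T t + ((1 - (tanh (t + u))\<^sup>2) - (1 - (tanh (t - u))\<^sup>2)) / 2 * sin (k * t)) (at t)"
      by (auto intro!: derivative_eq_intros simp: field_simps)
    then show "((\<lambda>t. sin (k * t) * ?T t) has_real_derivative ?f t) (at t)"
      unfolding e
    proof (rule DERIV_cong)
      have "c * k * T + (A - B) / 2 * s = (s * A - s * B) / 2 + k * (c * T)" for c T A B s :: real
        by (simp add: algebra_simps diff_divide_distrib)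
      from this[of "cos (k * t)" "?T t" "1 / (cosh (t + u))\<^sup>2" "1 / (cosh (t - u))\<^sup>2" "sin (k * t)"]
      show "cos (k * t) * k * ?T t + (1 / (cosh (t + u))\<^sup>2 - 1 / (cosh (t - u))\<^sup>2) / 2 * sin (k * t) = ?f t"
        by (simp only: times_divide_eq_right mult_1_right)
    qed
  next
    show "continuous_on {0<..} ?f" by (intro continuous_intros) auto
    show "integrable hl ?f" using integrable_lborel_hl(1)[OF iq] iT by (intro Bochner_Integration.integrable_add integrable_mult_right integrable_divide)
    have "((\<lambda>t. sin (k * t) * ?T t) \<longlongrightarrow> sin (k * 0) * ((tanh (0 + u) - tanh (0 - u)) / 2)) (at_right 0)"
      by (intro tendsto_intros) auto
    then show "((\<lambda>t. sin (k * t) * ?T t) \<longlongrightarrow> 0) (at_right 0)" by simp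
    have "filterlim (\<lambda>t. t + c) at_top at_top" for c :: real by real_asymp
    then have th: "((\<lambda>t. tanh (t + c)) \<longlongrightarrow> 1) at_top" for c :: real
      by (rule filterlim_compose[OF tanh_real_at_top])
    have "(?T \<longlongrightarrow> (1 - 1) / 2) at_top"
      unfolding diff_conv_add_uminus[of _ u] by (intro tendsto_intros th) auto
    then have T0: "(?T \<longlongrightarrow> 0) at_top" by simp
    show "((\<lambda>t. sin (k * t) * ?T t) \<longlongrightarrow> 0) at_top"
      by (rule lim_null_mult_left_bounded[OF _ T0, where B = 1]) auto
  qed
  moreover have "integral\<^sup>L hl ?f = (- sin (k * u) * S) / 2 + k * (\<integral>t. cos (k * t) * ?T t \<partial>hl)"
    unfolding Bochner_Integration.integral_add[OF integrable_divide[OF integrable_lborel_hl(1)[OF iq]] integrable_mult_right[OF iT]]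
    by (simp only: integral_divide_zero integral_mult_right_zero hq)
  ultimately have "k * (\<integral>t. cos (k * t) * ?T t \<partial>hl) = sin (k * u) * S / 2" by linarith
  also have "\<dots> = k * ((pi / 2) * sin (k * u) / sinh (pi * k / 2))"
    by (simp add: S_def mult_ac)
  finally have "k * (\<integral>t. cos (k * t) * ?T t \<partial>hl) = k * ((pi / 2) * sin (k * u) / sinh (pi * k / 2))" .
  then have "(\<integral>t. cos (k * t) * ?T t \<partial>hl) = (pi / 2) * sin (k * u) / sinh (pi * k / 2)"
    by (rule mult_left_cancel[THEN iffD1, rotated]) (use k in simp)
  then show ?thesis unfolding T .
qed

section \<open>The inversion formula\<close>

definition ip :: "real measure" where "ip = restrict_space lborel {0..pi}"

lemma space_ip [simp]: "space ip = {0..pi}"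
  by (simp add: ip_def space_restrict_space)

lemma measurable_ip_id: "(\<lambda>x. x) \<in> measurable ip borel"
  unfolding ip_def by (intro measurable_restrict_space1) simp

interpretation ip: sigma_finite_measure ip
  unfolding ip_def by (intro sigma_finite_measure_restrict_space) (auto simp: sigma_finite_lborel)

interpretation hl_ip: pair_sigma_finite hl ip ..

lemma integral_ip:
  fixes f :: "real \<Rightarrow> real"
  assumes f: "continuous_on {0..pi} f"
  shows "has_bochner_integral ip f (integral {0..pi} f)"
proof -
  have s: "set_integrable lborel {0..pi} f" by (rule borel_integrable_atLeastAtMost'[OF f])
  have "integrable ip f" using s unfolding ip_def set_integrable_def by (subst integrable_restrict_space) auto
  moreover have "integral\<^sup>L ip f = integral {0..pi} f"
    unfolding ip_def set_borel_integral_eq_integral(2)[OF s, symmetric] set_lebesgue_integral_def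
    by (subst integral_restrict_space) auto
  ultimately show ?thesis by (simp add: has_bochner_integral_iff)
qed

lemma integrable_ip: "continuous_on {0..pi} f \<Longrightarrow> integrable ip (f :: real \<Rightarrow> real)"
  using integral_ip[of f] by (simp add: has_bochner_integral_iff)

lemma integral_ip_FTC:
  fixes f F :: "real \<Rightarrow> real"
  assumes F: "\<And>u. 0 \<le> u \<Longrightarrow> u \<le> pi \<Longrightarrow> (F has_real_derivative f u) (at u)" and f: "continuous_on {0..pi} f"
  shows "integral\<^sup>L ip f = F pi - F 0"
proof -
  have "(f has_integral F pi - F 0) {0..pi}"
    by (rule fundamental_theorem_of_calculus)
       (use F in \<open>auto intro: has_field_derivative_at_within simp flip: has_real_derivative_iff_has_vector_derivative\<close>)
  then show ?thesis using integral_ip[OF f] by (simp add: has_bochner_integral_iff integral_unique)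
qed

lemma abs_integral_ip_le:
  fixes f :: "real \<Rightarrow> real"
  assumes f: "continuous_on {0..pi} f" and C: "\<And>u. 0 \<le> u \<Longrightarrow> u \<le> pi \<Longrightarrow> \<bar>f u\<bar> \<le> C"
  shows "\<bar>integral\<^sup>L ip f\<bar> \<le> pi * C"
proof -
  have c: "has_bochner_integral ip (\<lambda>_. C) (integral {0..pi} (\<lambda>_::real. C))" by (rule integral_ip) (rule continuous_on_const)
  have "\<bar>integral\<^sup>L ip f\<bar> \<le> integral\<^sup>L ip (\<lambda>_. C)"
    by (rule integral_abs_bound_integral[OF integrable_ip[OF f]]) (use c C in \<open>auto simp: has_bochner_integral_iff\<close>)
  also have "\<dots> = pi * C" using c by (simp add: has_bochner_integral_iff)
  finally show ?thesis .
qed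

section \<open>Real form and bounds of the kernel\<close>

definition phi :: "nat \<Rightarrow> real \<Rightarrow> real" where
  "phi m x = x * (\<integral>u. j0 (2 * x * cosh u) * (sinh (2 * u) * sin (real m * u)) \<partial>ip)"

lemma kl_Phi_eq_phi:
  assumes x: "x > 0"
  shows "kl_Phi m x = of_real (phi m x)"
proof -
  let ?f = "\<lambda>u. j0 (2 * x * cosh u) * (sinh (2 * u) * sin (real m * u))"
  have c: "continuous_on {0..pi} ?f" by (intro continuous_intros)
  have "(?f has_integral integral\<^sup>L ip ?f) {0..pi}"
    using integral_ip[OF c] integrable_integral[OF integrable_continuous_interval[OF c]] by (simp add: has_bochner_integral_iff)
  from has_integral_of_real[OF this, where 'b = complex]
  have "((\<lambda>u. complex_of_real (?f u)) has_integral of_real (integral\<^sup>L ip ?f)) {0..pi}" .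
  moreover have "complex_of_real (j0 (2 * x * cosh u)) = besselJ 0 (2 * x * cosh u)" for u
    using x besselJ_0_eq[of "2 * x * cosh u"] by simp
  ultimately have "((\<lambda>u. besselJ 0 (2 * x * cosh u) * of_real (sinh (2 * u) * sin (real m * u))) has_integral of_real (integral\<^sup>L ip ?f)) {0..pi}"
    by (simp only: of_real_mult)
  from integral_unique[OF this] show ?thesis by (simp add: kl_Phi_def phi_def)
qed

lemma borel_measurable_phi [measurable]: "phi m \<in> borel_measurable borel"
proof -
  have "(\<lambda>(x, u). j0 (2 * x * cosh u) * (sinh (2 * u) * sin (real m * u))) \<in> borel_measurable (borel \<Otimes>\<^sub>M ip)"
    by (rule borel_measurable_pair_subspace[OF _ measurable_ip_id]) measurable
  from ip.borel_measurable_lebesgue_integral[OF this]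
  show ?thesis unfolding phi_def[abs_def] by (intro borel_measurable_times) auto
qed

lemma phi_bound_linear: "\<exists>C. \<forall>x>0. \<bar>phi m x\<bar> \<le> C * x"
proof -
  obtain B where B: "B > 0" "\<And>x. x > 0 \<Longrightarrow> \<bar>j0 x\<bar> \<le> B" "\<And>x. x > 0 \<Longrightarrow> \<bar>j0_theta x\<bar> \<le> B * sqrt x"
    using j0_bounds by blast
  have "\<bar>phi m x\<bar> \<le> pi * (B * sinh (2 * pi)) * x" if x: "x > 0" for x
  proof -
    have "\<bar>\<integral>u. j0 (2 * x * cosh u) * (sinh (2 * u) * sin (real m * u)) \<partial>ip\<bar> \<le> pi * (B * sinh (2 * pi))"
    proof (rule abs_integral_ip_le)
      show "continuous_on {0..pi} (\<lambda>u. j0 (2 * x * cosh u) * (sinh (2 * u) * sin (real m * u)))" by (intro continuous_intros)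
      fix u :: real assume u: "0 \<le> u" "u \<le> pi"
      have "\<bar>j0 (2 * x * cosh u)\<bar> \<le> B" using x by (intro B) auto
      moreover have "\<bar>sinh (2 * u) * sin (real m * u)\<bar> \<le> sinh (2 * pi)"
        unfolding mult.commute[of "sinh (2 * u)"] using u by (intro abs_mult_trig_le) auto
      ultimately show "\<bar>j0 (2 * x * cosh u) * (sinh (2 * u) * sin (real m * u))\<bar> \<le> B * sinh (2 * pi)"
        unfolding abs_mult[of "j0 (2 * x * cosh u)"] using B(1) by (intro mult_mono) auto
    qed
    then show ?thesis using x unfolding phi_def abs_mult by (simp add: mult.commute mult_left_mono)
  qed
  then show ?thesis by blast
qed

text \<open>The weight sinh(2u) is exactly what makes the integrand a derivative in u: that of
  \<open>j0_theta (2 * x * cosh u)\<close> is -2 x^2 sinh(2u) J_0(2x cosh u). The boundary terms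
  vanish because sin(mu) is 0 at 0 and at \<pi>.\<close>

lemma phi_by_parts:
  assumes x: "x > 0"
  shows "2 * x * phi m x = real m * (\<integral>u. j0_theta (2 * x * cosh u) * cos (real m * u) \<partial>ip)"
proof -
  let ?f = "\<lambda>u. real m * (j0_theta (2 * x * cosh u) * cos (real m * u)) - 2 * x\<^sup>2 * (j0 (2 * x * cosh u) * (sinh (2 * u) * sin (real m * u)))"
  have "integral\<^sup>L ip ?f = j0_theta (2 * x * cosh pi) * sin (real m * pi) - j0_theta (2 * x * cosh 0) * sin (real m * 0)"
  proof (rule integral_ip_FTC)
    show "continuous_on {0..pi} ?f" by (intro continuous_intros)
    fix u :: real
    have z: "2 * x * cosh u > 0" using x by simp
    have "((\<lambda>u. 2 * x * cosh u) has_real_derivative 2 * x * sinh u) (at u)" by (auto intro!: derivative_eq_intros)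
    from DERIV_chain2[OF j0_theta_deriv[OF z] this]
    have "((\<lambda>u. j0_theta (2 * x * cosh u) * sin (real m * u)) has_real_derivative
       (- (2 * x * cosh u) * j0 (2 * x * cosh u) * (2 * x * sinh u)) * sin (real m * u) + (cos (real m * u) * real m) * j0_theta (2 * x * cosh u)) (at u)"
      by (intro DERIV_mult) (auto intro!: derivative_eq_intros)
    then show "((\<lambda>u. j0_theta (2 * x * cosh u) * sin (real m * u)) has_real_derivative ?f u) (at u)"
      by (rule DERIV_cong) (simp add: sinh_double power2_eq_square)
  qed
  also have "sin (real m * pi) = 0" by (rule sin_npi)
  finally have "integral\<^sup>L ip ?f = 0" by simp
  moreover have "integral\<^sup>L ip ?f = real m * (\<integral>u. j0_theta (2 * x * cosh u) * cos (real m * u) \<partial>ip) - 2 * x\<^sup>2 * (\<integral>u. j0 (2 * x * cosh u) * (sinh (2 * u) * sin (real m * u)) \<partial>ip)"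
    by (subst Bochner_Integration.integral_diff) (auto intro!: integrable_mult_right integrable_ip continuous_intros)
  ultimately show ?thesis by (simp add: phi_def power2_eq_square)
qed

lemma phi_bound_decay: "\<exists>C. \<forall>x>0. \<bar>phi m x\<bar> \<le> C / sqrt x"
proof -
  obtain B where B: "B > 0" "\<And>x. x > 0 \<Longrightarrow> \<bar>j0 x\<bar> \<le> B" "\<And>x. x > 0 \<Longrightarrow> \<bar>j0_theta x\<bar> \<le> B * sqrt x"
    using j0_bounds by blast
  define A where "A = B * sqrt (2 * cosh pi)"
  have "\<bar>phi m x\<bar> \<le> (real m * (pi * A) / 2) / sqrt x" if x: "x > 0" for x
  proof -
    have "\<bar>\<integral>u. j0_theta (2 * x * cosh u) * cos (real m * u) \<partial>ip\<bar> \<le> pi * (A * sqrt x)"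
    proof (rule abs_integral_ip_le)
      show "continuous_on {0..pi} (\<lambda>u. j0_theta (2 * x * cosh u) * cos (real m * u))" by (intro continuous_intros)
      fix u :: real assume u: "0 \<le> u" "u \<le> pi"
      have "\<bar>j0_theta (2 * x * cosh u)\<bar> \<le> B * sqrt (2 * x * cosh u)" using x by (intro B) auto
      also have "\<dots> \<le> B * sqrt (2 * x * cosh pi)"
        using B(1) x u cosh_real_nonneg_le_iff[of u pi] by (intro mult_left_mono real_sqrt_le_mono) auto
      also have "\<dots> = A * sqrt x" by (simp add: A_def real_sqrt_mult)
      finally show "\<bar>j0_theta (2 * x * cosh u) * cos (real m * u)\<bar> \<le> A * sqrt x"
        unfolding mult.commute[of "j0_theta _"] by (intro abs_mult_trig_le) auto
    qed
    then have "real m * \<bar>\<integral>u. j0_theta (2 * x * cosh u) * cos (real m * u) \<partial>ip\<bar> \<le> real m * (pi * (A * sqrt x))"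
      by (intro mult_left_mono) auto
    then have "\<bar>2 * x * phi m x\<bar> \<le> real m * (pi * (A * sqrt x))"
      unfolding phi_by_parts[OF x] by (simp add: abs_mult)
    then have "\<bar>phi m x\<bar> * (2 * x) \<le> real m * (pi * (A * sqrt x))" using x by (simp add: abs_mult mult_ac)
    then have "\<bar>phi m x\<bar> \<le> real m * (pi * (A * sqrt x)) / (2 * x)" using x by (simp only: pos_le_divide_eq mult_pos_pos zero_less_numeral)
    also have "\<dots> = (real m * (pi * A) / 2) * (sqrt x / x)" by simp
    also have "sqrt x / x = 1 / sqrt x" using x by (metis less_imp_le sqrt_divide_self_eq inverse_eq_divide)
    finally show ?thesis by simp
  qed
  then show ?thesis by blast
qed

text \<open>The power (1 + x)^(-3/2), chosen so that \<open>x * decay x\<close> is comparable to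
  min(x, x^(-1/2)) on the whole half-line without a case split.\<close>

definition decay :: "real \<Rightarrow> real" where "decay x = 1 / ((1 + x) * sqrt (1 + x))"

lemma integrable_decay: "integrable hl decay"
proof (rule integrable_hl_FTC_nonneg[where F = "\<lambda>x. - 2 / sqrt (1 + x)"])
  fix x :: real assume x: "x > 0"
  have "((\<lambda>x. - 2 / sqrt (1 + x)) has_real_derivative decay x) (at x)"
  proof -
    have s: "sqrt (1 + x) > 0" "sqrt (1 + x) * sqrt (1 + x) = 1 + x" using x by auto
    have "((\<lambda>x. - 2 / sqrt (1 + x)) has_real_derivative - (- 2 * (1 * (inverse (sqrt (1 + x)) / 2)) / (sqrt (1 + x) * sqrt (1 + x)))) (at x)"
      using x by (auto intro!: derivative_eq_intros simp: divide_simps)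
    then show ?thesis
      by (rule DERIV_cong) (simp only: s(2) decay_def, use s x in \<open>simp add: field_simps\<close>)
  qed
  then show "((\<lambda>x. - 2 / sqrt (1 + x)) has_real_derivative decay x) (at x)" .
  show "decay x \<ge> 0" using x by (simp add: decay_def)
next
  show "continuous_on {0<..} decay" unfolding decay_def[abs_def] by (intro continuous_intros) auto
  show "((\<lambda>x. - 2 / sqrt (1 + x)) \<longlongrightarrow> - 2) (at_right 0)" by (auto intro!: tendsto_eq_intros)
  show "((\<lambda>x. - 2 / sqrt (1 + x)) \<longlongrightarrow> 0) at_top" by real_asymp
qed

lemma phi_bound: "\<exists>C\<ge>0. \<forall>x>0. \<bar>phi m x\<bar> \<le> C * (x * decay x)"
proof -
  obtain C1 where C1: "\<And>x. x > 0 \<Longrightarrow> \<bar>phi m x\<bar> \<le> C1 * x" using phi_bound_linear by blast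
  obtain C2 where C2: "\<And>x. x > 0 \<Longrightarrow> \<bar>phi m x\<bar> \<le> C2 / sqrt x" using phi_bound_decay by blast
  have C0: "C1 \<ge> 0" "C2 \<ge> 0" using order_trans[OF abs_ge_zero C1[of 1]] order_trans[OF abs_ge_zero C2[of 1]] by auto
  have "\<bar>phi m x\<bar> \<le> 4 * (C1 + C2) * (x * decay x)" if x: "x > 0" for x
  proof (cases "x \<le> 1")
    case True
    have "sqrt (1 + x) \<le> 2" using real_sqrt_le_mono[of "1 + x" 4] True by simp
    then have "(1 + x) * sqrt (1 + x) \<le> 2 * 2" using True x by (intro mult_mono) auto
    then have "1 \<le> 4 * decay x" using x by (simp add: decay_def)
    then have "x * 1 \<le> x * (4 * decay x)" using x by (intro mult_left_mono) auto
    then have "C1 * x \<le> C1 * (x * (4 * decay x))" using C0 by (intro mult_left_mono) auto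
    also have "\<dots> \<le> (C1 + C2) * (x * (4 * decay x))"
      using C0 x by (intro mult_right_mono) (auto simp: decay_def)
    finally show ?thesis using C1[OF x] by (simp add: mult_ac)
  next
    case False
    have "sqrt (1 + x) \<le> 2 * sqrt x"
      using real_sqrt_le_mono[of "1 + x" "4 * x"] False by (simp add: real_sqrt_mult)
    then have "(1 + x) * sqrt (1 + x) \<le> (2 * x) * (2 * sqrt x)" using False by (intro mult_mono) auto
    moreover have "1 / s \<le> 4 * (x * (1 / D))" if "D \<le> 2 * x * (2 * s)" "D > 0" "s > 0" for D s :: real
      using that by (simp add: field_simps)
    ultimately have "1 / sqrt x \<le> 4 * (x * decay x)" using x unfolding decay_def by (simp del: mult_le_cancel_left_pos)
    then have "C2 * (1 / sqrt x) \<le> C2 * (4 * (x * decay x))" using C0 by (intro mult_left_mono) auto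
    also have "\<dots> \<le> (C1 + C2) * (4 * (x * decay x))"
      using C0 x by (intro mult_right_mono) (auto simp: decay_def)
    finally show ?thesis using C2[OF x] by (simp add: mult_ac)
  qed
  then show ?thesis using C0 by (intro exI[of _ "4 * (C1 + C2)"]) auto
qed

text \<open>The factor c / x is the shape of the uniform bound \<open>abs_nichN_le\<close>, so this
  is a common majorant for all terms of the series up to their coefficients.\<close>

lemma integrable_phi_over:
  "integrable hl (\<lambda>x. \<bar>phi m x\<bar> * (c / x))"
proof -
  obtain C where C: "C \<ge> 0" "\<And>x. x > 0 \<Longrightarrow> \<bar>phi m x\<bar> \<le> C * (x * decay x)" using phi_bound by blast
  show ?thesis
  proof (rule Bochner_Integration.integrable_bound)
    show "integrable hl (\<lambda>x. (C * \<bar>c\<bar>) * decay x)" using integrable_decay by simp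
    show "(\<lambda>x. \<bar>phi m x\<bar> * (c / x)) \<in> borel_measurable hl" by (rule borel_measurable_hl) measurable
    show "AE x in hl. norm (\<bar>phi m x\<bar> * (c / x)) \<le> norm ((C * \<bar>c\<bar>) * decay x)"
    proof (rule AE_I2)
      fix x assume "x \<in> space hl"
      then have x: "x > 0" by simp
      have "\<bar>phi m x\<bar> * (\<bar>c\<bar> / x) \<le> C * (x * decay x) * (\<bar>c\<bar> / x)"
        using C(2)[OF x] x by (intro mult_right_mono) auto
      also have "\<dots> = C * \<bar>c\<bar> * decay x" using x by simp
      finally show "norm (\<bar>phi m x\<bar> * (c / x)) \<le> norm ((C * \<bar>c\<bar>) * decay x)"
        using x C(1) by (simp add: abs_mult decay_def)
    qed
  qed
qed

section \<open>Biorthogonality of the kernels and the Nicholson integrals\<close>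

lemma phi_K0_integral:
  assumes t: "t > 0"
  shows "(\<integral>x. phi m x * K0 (2 * x * sinh t) \<partial>hl) = (\<integral>u. (sinh (2 * u) * sin (real m * u)) / (2 * (cosh (2 * t) + cosh (2 * u))) \<partial>ip)"
proof -
  obtain B where B: "B > 0" "\<And>x. x > 0 \<Longrightarrow> \<bar>j0 x\<bar> \<le> B" "\<And>x. x > 0 \<Longrightarrow> \<bar>j0_theta x\<bar> \<le> B * sqrt x"
    using j0_bounds by blast
  define a where "a = 2 * sinh t"
  have a: "a > 0" using t by (simp add: a_def)
  let ?f = "\<lambda>x u. x * (j0 (2 * cosh u * x) * K0 (a * x)) * (sinh (2 * u) * sin (real m * u))"
  have ik: "integrable hl (\<lambda>x. x * K0 (a * x))"
  proof (rule integrable_hl_exp_bound[where x = "a / 2" and C = "2 / a"])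
    show "continuous_on {0<..} (\<lambda>x. x * K0 (a * x))"
      by (intro continuous_intros continuous_on_compose2[OF continuous_on_K0]) (use a in auto)
    fix x :: real assume x: "x > 0"
    then have ax: "a * x > 0" using a by simp
    have "x * K0 (a * x) = (a * x) * K0 (a * x) / a" using a by simp
    also have "\<dots> \<le> (2 * exp (- (a * x) / 2)) / a"
      using order_trans[OF K0_le_zK1[OF ax] zK1_le_exp[OF ax]] a by (intro divide_right_mono) auto
    finally show "\<bar>x * K0 (a * x)\<bar> \<le> 2 / a * exp (- (a / 2) * x)"
      using x K0_nonneg[of "a * x"] by (simp add: abs_mult mult_ac)
  qed (use a in auto)
  have cu: "continuous_on {0..pi} (?f x)" for x by (intro continuous_intros)
  have int: "integrable (hl \<Otimes>\<^sub>M ip) (\<lambda>(x, u). ?f x u)"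
  proof (rule hl_ip.Fubini_integrable)
    show meas: "(\<lambda>(x, u). ?f x u) \<in> borel_measurable (hl \<Otimes>\<^sub>M ip)"
      by (rule borel_measurable_pair_subspace[OF measurable_hl_id measurable_ip_id]) measurable
    show "integrable hl (\<lambda>x. \<integral>u. norm (case (x, u) of (x, u) \<Rightarrow> ?f x u) \<partial>ip)"
    proof (rule Bochner_Integration.integrable_bound)
      show "integrable hl (\<lambda>x. (pi * (B * sinh (2 * pi))) * (x * K0 (a * x)))" using ik by simp
      have "(\<lambda>(x, u). norm (case (x, u) of (x, u) \<Rightarrow> ?f x u)) \<in> borel_measurable (hl \<Otimes>\<^sub>M ip)"
        using measurable_compose[OF meas borel_measurable_norm] by (simp add: case_prod_unfold)
      from ip.borel_measurable_lebesgue_integral[OF this]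
      show "(\<lambda>x. \<integral>u. norm (case (x, u) of (x, u) \<Rightarrow> ?f x u) \<partial>ip) \<in> borel_measurable hl" .
      show "AE x in hl. norm (\<integral>u. norm (case (x, u) of (x, u) \<Rightarrow> ?f x u) \<partial>ip) \<le> norm ((pi * (B * sinh (2 * pi))) * (x * K0 (a * x)))"
      proof (rule AE_I2)
        fix x assume "x \<in> space hl"
        then have x: "x > 0" by simp
        have "\<bar>\<integral>u. norm (?f x u) \<partial>ip\<bar> \<le> pi * (B * sinh (2 * pi) * (x * K0 (a * x)))"
        proof (rule abs_integral_ip_le)
          show "continuous_on {0..pi} (\<lambda>u. norm (?f x u))" by (intro continuous_intros)
          fix u :: real assume u: "0 \<le> u" "u \<le> pi"
          have "\<bar>j0 (2 * cosh u * x)\<bar> \<le> B" using x by (intro B) auto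
          moreover have "\<bar>sinh (2 * u) * sin (real m * u)\<bar> \<le> sinh (2 * pi)"
            unfolding mult.commute[of "sinh (2 * u)"] using u by (intro abs_mult_trig_le) auto
          ultimately have "\<bar>j0 (2 * cosh u * x)\<bar> * \<bar>sinh (2 * u) * sin (real m * u)\<bar> * (x * K0 (a * x)) \<le> B * sinh (2 * pi) * (x * K0 (a * x))"
            using B(1) x K0_nonneg[of "a * x"] by (intro mult_right_mono mult_mono) auto
          then show "\<bar>norm (?f x u)\<bar> \<le> B * sinh (2 * pi) * (x * K0 (a * x))"
            using x K0_nonneg[of "a * x"] by (simp add: abs_mult mult_ac)
        qed
        then show "norm (\<integral>u. norm (case (x, u) of (x, u) \<Rightarrow> ?f x u) \<partial>ip) \<le> norm ((pi * (B * sinh (2 * pi))) * (x * K0 (a * x)))"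
          using x B(1) K0_nonneg[of "a * x"] by (simp add: abs_mult mult_ac)
      qed
    qed
    show "AE x in hl. integrable ip (\<lambda>u. case (x, u) of (x, u) \<Rightarrow> ?f x u)"
      using integrable_ip[OF cu] by simp
  qed
  have "phi m x * K0 (2 * x * sinh t) = (\<integral>u. ?f x u \<partial>ip)" for x
  proof -
    have "phi m x * K0 (2 * x * sinh t) = (\<integral>u. (x * K0 (a * x)) * (j0 (2 * x * cosh u) * (sinh (2 * u) * sin (real m * u))) \<partial>ip)"
      unfolding phi_def a_def by (subst integral_mult_right_zero) (simp add: mult_ac)
    also have "\<dots> = (\<integral>u. ?f x u \<partial>ip)"
      by (intro Bochner_Integration.integral_cong refl) (simp add: mult_ac)
    finally show ?thesis .
  qed
  then have "(\<integral>x. phi m x * K0 (2 * x * sinh t) \<partial>hl) = (\<integral>x. \<integral>u. ?f x u \<partial>ip \<partial>hl)" by simp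
  also have "\<dots> = (\<integral>u. \<integral>x. ?f x u \<partial>hl \<partial>ip)"
    using hl_ip.Fubini_integral[OF int] by simp
  also have "\<dots> = (\<integral>u. (sinh (2 * u) * sin (real m * u)) / (2 * (cosh (2 * t) + cosh (2 * u))) \<partial>ip)"
  proof (intro Bochner_Integration.integral_cong refl)
    fix u :: real
    \<comment> \<open>\<open>integral_j0_K0\<close> with b = 2 cosh u. The denominator 4 sinh^2 t +
      4 cosh^2 u is then rewritten in double arguments, matching
      \<open>integral_cos_over_cosh\<close>.\<close>
    have "(\<integral>x. ?f x u \<partial>hl) = 1 / (a\<^sup>2 + (2 * cosh u)\<^sup>2) * (sinh (2 * u) * sin (real m * u))"
      using integral_j0_K0[OF a, of "2 * cosh u"] by (subst integral_mult_left_zero) (simp add: has_bochner_integral_iff)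
    also have "a\<^sup>2 + (2 * cosh u)\<^sup>2 = 2 * (cosh (2 * t) + cosh (2 * u))"
      unfolding cosh_double by (simp add: a_def power_mult_distrib cosh_square_eq)
    finally show "(\<integral>x. ?f x u \<partial>hl) = (sinh (2 * u) * sin (real m * u)) / (2 * (cosh (2 * t) + cosh (2 * u)))" by simp
  qed
  finally show ?thesis .
qed

text \<open>Taking absolute values, the t-integral costs half the integral of \<open>K0\<close>
  divided by x, and |phi| times that is integrable; this justifies the interchange.\<close>

lemma phi_nichN_integrable_integral:
  assumes y: "y > 0"
  shows "integrable hl (\<lambda>x. phi m x * nichN y x)"
    and "(\<integral>x. phi m x * nichN y x \<partial>hl) = (\<integral>t. cos (y * t) * (\<integral>x. phi m x * K0 (2 * x * sinh t) \<partial>hl) \<partial>hl)"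
proof -
  let ?f = "\<lambda>x t. phi m x * (cos (y * t) * K0 (2 * x * sinh t))"
  have int: "integrable (hl \<Otimes>\<^sub>M hl) (\<lambda>(x, t). ?f x t)"
  proof (rule hl_pair.Fubini_integrable)
    show meas: "(\<lambda>(x, t). ?f x t) \<in> borel_measurable (hl \<Otimes>\<^sub>M hl)"
      by (rule borel_measurable_hl_pair) measurable
    show "integrable hl (\<lambda>x. \<integral>t. norm (case (x, t) of (x, t) \<Rightarrow> ?f x t) \<partial>hl)"
    proof (rule Bochner_Integration.integrable_bound[OF integrable_phi_over[of m "integral\<^sup>L hl K0 / 2"]])
      have "(\<lambda>(x, t). norm (case (x, t) of (x, t) \<Rightarrow> ?f x t)) \<in> borel_measurable (hl \<Otimes>\<^sub>M hl)"
        using measurable_compose[OF meas borel_measurable_norm] by (simp add: case_prod_unfold)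
      from hl.borel_measurable_lebesgue_integral[OF this]
      show "(\<lambda>x. \<integral>t. norm (case (x, t) of (x, t) \<Rightarrow> ?f x t) \<partial>hl) \<in> borel_measurable hl" .
      show "AE x in hl. norm (\<integral>t. norm (case (x, t) of (x, t) \<Rightarrow> ?f x t) \<partial>hl) \<le> norm (\<bar>phi m x\<bar> * (integral\<^sup>L hl K0 / 2 / x))"
      proof (rule AE_I2)
        fix x assume "x \<in> space hl"
        then have x: "x > 0" by simp
        have "(\<integral>t. norm (?f x t) \<partial>hl) \<le> (\<integral>t. \<bar>phi m x\<bar> * K0 (2 * x * t) \<partial>hl)"
        proof (rule integral_mono)
          show "integrable hl (\<lambda>t. norm (?f x t))" using integrable_nichN[OF x, of y] by (intro integrable_norm integrable_mult_right)
          show "integrable hl (\<lambda>t. \<bar>phi m x\<bar> * K0 (2 * x * t))" using K0_scale_integral[OF x] by (simp add: has_bochner_integral_iff)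
          fix t assume "t \<in> space hl"
          then have "\<bar>cos (y * t) * K0 (2 * x * sinh t)\<bar> \<le> K0 (2 * x * t)"
            using K0_sinh_le[OF x] by (intro abs_sin_cos_mult_le K0_nonneg) auto
          then show "norm (?f x t) \<le> \<bar>phi m x\<bar> * K0 (2 * x * t)"
            unfolding real_norm_def abs_mult[of "phi m x"] by (intro mult_left_mono) auto
        qed
        also have "\<dots> = \<bar>phi m x\<bar> * (integral\<^sup>L hl K0 / 2 / x)"
          using K0_scale_integral[OF x] by (simp add: has_bochner_integral_iff)
        finally have le: "(\<integral>t. norm (?f x t) \<partial>hl) \<le> \<bar>phi m x\<bar> * (integral\<^sup>L hl K0 / 2 / x)" .
        have "norm (\<integral>t. norm (?f x t) \<partial>hl) = (\<integral>t. norm (?f x t) \<partial>hl)"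
          unfolding real_norm_def by (rule abs_of_nonneg) simp
        with order_trans[OF le abs_ge_self]
        show "norm (\<integral>t. norm (case (x, t) of (x, t) \<Rightarrow> ?f x t) \<partial>hl) \<le> norm (\<bar>phi m x\<bar> * (integral\<^sup>L hl K0 / 2 / x))"
          unfolding prod.case real_norm_def by (simp only:)
      qed
    qed
    show "AE x in hl. integrable hl (\<lambda>t. case (x, t) of (x, t) \<Rightarrow> ?f x t)"
      using integrable_nichN[of _ y] by (intro AE_I2) auto
  qed
  have n: "(\<integral>t. ?f x t \<partial>hl) = phi m x * nichN y x" for x by (simp add: nichN_def)
  show "integrable hl (\<lambda>x. phi m x * nichN y x)"
    using hl_pair.integrable_fst'[OF int] unfolding prod.case n .
  have "(\<integral>x. phi m x * nichN y x \<partial>hl) = (\<integral>t. \<integral>x. ?f x t \<partial>hl \<partial>hl)"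
    using hl_pair.Fubini_integral[OF int] unfolding prod.case n by (rule sym)
  also have "\<dots> = (\<integral>t. cos (y * t) * (\<integral>x. phi m x * K0 (2 * x * sinh t) \<partial>hl) \<partial>hl)"
    by (simp add: mult.left_commute[of "phi m _"])
  finally show "(\<integral>x. phi m x * nichN y x \<partial>hl) = (\<integral>t. cos (y * t) * (\<integral>x. phi m x * K0 (2 * x * sinh t) \<partial>hl) \<partial>hl)" .
qed

lemma integral_sin_sin:
  assumes "m \<ge> 1" "k \<ge> 1"
  shows "(\<integral>u. sin (real m * u) * sin (real k * u) \<partial>ip) = (if m = k then pi / 2 else 0)"
proof (cases "m = k")
  case True
  define c where "c = 2 * real m"
  have c: "c > 0" using assms by (simp add: c_def)
  have e: "sin (real m * u) * sin (real k * u) = 1 / 2 - cos (c * u) / 2" for u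
    using cos_double_sin[of "real m * u"] True by (simp add: c_def power2_eq_square mult.assoc diff_divide_distrib)
  have "(\<integral>u. 1 / 2 - cos (c * u) / 2 \<partial>ip) = (pi / 2 - sin (c * pi) / (2 * c)) - (0 / 2 - sin (c * 0) / (2 * c))"
    by (rule integral_ip_FTC) (use c in \<open>auto intro!: derivative_eq_intros continuous_intros\<close>)
  moreover have "sin (c * pi) = 0" using sin_npi[of "2 * m"] by (simp add: c_def)
  ultimately show ?thesis unfolding e using True by simp
next
  case False
  define c d where "c = real m - real k" and "d = real m + real k"
  have c: "c \<noteq> 0" "d \<noteq> 0" using False assms by (simp_all add: c_def d_def)
  have e: "sin (real m * u) * sin (real k * u) = cos (c * u) / 2 - cos (d * u) / 2" for u
    by (simp add: c_def d_def left_diff_distrib distrib_right cos_diff cos_add diff_divide_distrib add_divide_distrib)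
  have "(\<integral>u. cos (c * u) / 2 - cos (d * u) / 2 \<partial>ip) = (sin (c * pi) / (2 * c) - sin (d * pi) / (2 * d)) - (sin (c * 0) / (2 * c) - sin (d * 0) / (2 * d))"
    by (rule integral_ip_FTC) (use c in \<open>auto intro!: derivative_eq_intros continuous_intros\<close>)
  moreover have "sin (d * pi) = 0" using sin_npi[of "m + k"] by (simp add: d_def)
  moreover have "sin (c * pi) = 0"
    by (simp add: c_def left_diff_distrib sin_diff)
  ultimately show ?thesis using False by (simp add: e)
qed

text \<open>The decay exp(-2t), uniform for u in [0, \<pi>], permits integrating over t first, which
  turns the kernel into a multiple of sin(ku). The factor \<pi>^2/8 is \<pi>/4 times \<pi>/2 and
  cancels the 8/\<pi>^2 of Nicholson's formula.\<close>

lemma phi_nichN_integral: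
  assumes mk: "m \<ge> 1" "k \<ge> 1"
  shows "(\<integral>x. phi m x * nichN (real k) x \<partial>hl) = (if m = k then pi\<^sup>2 / 8 / sinh (pi * real k / 2) else 0)"
proof -
  have k: "real k > 0" using mk by simp
  let ?f = "\<lambda>t u. cos (real k * t) * ((sinh (2 * u) * sin (real m * u)) / (2 * (cosh (2 * t) + cosh (2 * u))))"
  have nz: "cosh (2 * t) + cosh (2 * u) > 0" for t u :: real by (simp add: add_pos_pos)
  have cu: "continuous_on {0..pi} (?f t)" for t
  proof -
    have "2 * (cosh (2 * t) + cosh (2 * u)) \<noteq> 0" for u
      using nz[of t u] by (metis less_irrefl mult_pos_pos zero_less_numeral)
    then show ?thesis by (intro continuous_intros) auto
  qed
  have bound: "\<bar>?f t u\<bar> \<le> sinh (2 * pi) * exp (- 2 * t)" if u: "0 \<le> u" "u \<le> pi" for t u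
  proof -
    have "\<bar>sinh (2 * u) * sin (real m * u)\<bar> \<le> sinh (2 * pi)"
      unfolding mult.commute[of "sinh (2 * u)"] using u by (intro abs_mult_trig_le) auto
    moreover have "exp (2 * t) \<le> 2 * (cosh (2 * t) + cosh (2 * u))"
    proof -
      have "exp (2 * t) / 2 \<le> cosh (2 * t) + cosh (2 * u)"
        using cosh_ge_half_exp[of "2 * t"] cosh_real_nonneg[of "2 * u"] by linarith
      then show ?thesis by simp
    qed
    ultimately have "\<bar>sinh (2 * u) * sin (real m * u)\<bar> / (2 * (cosh (2 * t) + cosh (2 * u))) \<le> sinh (2 * pi) / exp (2 * t)"
      by (intro frac_le) auto
    moreover have "\<bar>2 * (cosh (2 * t) + cosh (2 * u))\<bar> = 2 * (cosh (2 * t) + cosh (2 * u))"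
      using nz[of t u] by simp
    ultimately have "\<bar>(sinh (2 * u) * sin (real m * u)) / (2 * (cosh (2 * t) + cosh (2 * u)))\<bar> \<le> sinh (2 * pi) * exp (- 2 * t)"
      unfolding abs_divide by (simp add: exp_minus divide_inverse)
    then show ?thesis by (intro abs_mult_trig_le) auto
  qed
  have int: "integrable (hl \<Otimes>\<^sub>M ip) (\<lambda>(t, u). ?f t u)"
  proof (rule hl_ip.Fubini_integrable)
    show meas: "(\<lambda>(t, u). ?f t u) \<in> borel_measurable (hl \<Otimes>\<^sub>M ip)"
      by (rule borel_measurable_pair_subspace[OF measurable_hl_id measurable_ip_id]) measurable
    show "integrable hl (\<lambda>t. \<integral>u. norm (case (t, u) of (t, u) \<Rightarrow> ?f t u) \<partial>ip)"
    proof (rule Bochner_Integration.integrable_bound)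
      show "integrable hl (\<lambda>t. (pi * sinh (2 * pi)) * exp (- 2 * t))" using integrable_hl_exp(1)[of 2] by simp
      have "(\<lambda>(t, u). norm (case (t, u) of (t, u) \<Rightarrow> ?f t u)) \<in> borel_measurable (hl \<Otimes>\<^sub>M ip)"
        using measurable_compose[OF meas borel_measurable_norm] by (simp add: case_prod_unfold)
      from ip.borel_measurable_lebesgue_integral[OF this]
      show "(\<lambda>t. \<integral>u. norm (case (t, u) of (t, u) \<Rightarrow> ?f t u) \<partial>ip) \<in> borel_measurable hl" .
      have "\<bar>\<integral>u. norm (?f t u) \<partial>ip\<bar> \<le> pi * (sinh (2 * pi) * exp (- 2 * t))" for t
        by (rule abs_integral_ip_le[OF continuous_on_norm[OF cu]]) (use bound in auto)
      then show "AE t in hl. norm (\<integral>u. norm (case (t, u) of (t, u) \<Rightarrow> ?f t u) \<partial>ip) \<le> norm ((pi * sinh (2 * pi)) * exp (- 2 * t))"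
        by (simp add: abs_mult mult_ac)
    qed
    show "AE t in hl. integrable ip (\<lambda>u. case (t, u) of (t, u) \<Rightarrow> ?f t u)"
      using integrable_ip[OF cu] by simp
  qed
  have "(\<integral>x. phi m x * nichN (real k) x \<partial>hl) = (\<integral>t. \<integral>u. ?f t u \<partial>ip \<partial>hl)"
    unfolding phi_nichN_integrable_integral(2)[OF k]
  proof (intro Bochner_Integration.integral_cong refl)
    fix t assume "t \<in> space hl"
    then show "cos (real k * t) * (\<integral>x. phi m x * K0 (2 * x * sinh t) \<partial>hl) = (\<integral>u. ?f t u \<partial>ip)"
      using phi_K0_integral[of t m] by (simp only: integral_mult_right_zero space_hl greaterThan_iff)
  qed
  also have "\<dots> = (\<integral>u. \<integral>t. ?f t u \<partial>hl \<partial>ip)"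
    using hl_ip.Fubini_integral[OF int] by simp
  also have "\<dots> = (\<integral>u. (pi / 4 / sinh (pi * real k / 2)) * (sin (real m * u) * sin (real k * u)) \<partial>ip)"
  proof (intro Bochner_Integration.integral_cong refl)
    fix u assume "u \<in> space ip"
    then have u: "u \<ge> 0" by simp
    have "(\<integral>t. ?f t u \<partial>hl) = (\<integral>t. (sin (real m * u) / 2) * (cos (real k * t) * (sinh (2 * u) / (cosh (2 * t) + cosh (2 * u)))) \<partial>hl)"
      by (intro Bochner_Integration.integral_cong refl) simp
    also have "\<dots> = (sin (real m * u) / 2) * ((pi / 2) * sin (real k * u) / sinh (pi * real k / 2))"
      unfolding integral_mult_right_zero integral_cos_over_cosh[OF k u] ..
    finally show "(\<integral>t. ?f t u \<partial>hl) = (pi / 4 / sinh (pi * real k / 2)) * (sin (real m * u) * sin (real k * u))"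
      by simp
  qed
  also have "\<dots> = (pi / 4 / sinh (pi * real k / 2)) * (if m = k then pi / 2 else 0)"
    unfolding integral_mult_right_zero integral_sin_sin[OF mk] ..
  finally show ?thesis by (simp add: power2_eq_square)
qed

text \<open>Dominated convergence over growing intervals. The closed interval adds only the point 0,
  a null set, so the value of \<open>G\<close> there is irrelevant.\<close>

lemma integrable_hl_improper:
  fixes G :: "real \<Rightarrow> complex"
  assumes G: "integrable hl G"
  shows "T > 0 \<Longrightarrow> G integrable_on {0..T}"
    and "((\<lambda>T. integral {0..T} G) \<longlongrightarrow> integral\<^sup>L hl G) at_top"
proof -
  have s: "set_integrable lborel {0<..} G" using G by (simp add: integrable_hl_iff)
  have sT: "set_integrable lborel {0<..T} G" for T by (rule set_integrable_subset[OF s]) auto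
  have h: "(G has_integral (LINT x:{0<..T}|lborel. G x)) {0..T}" for T
  proof -
    have "(G has_integral (LINT x:{0<..T}|lborel. G x)) {0<..T}"
      using set_borel_integral_eq_integral[OF sT[of T]] by (simp add: has_integral_iff)
    then show ?thesis
      by (rule has_integral_spike_set_eq[THEN iffD1, rotated -1]) (auto intro: negligible_subset[of "{0}"])
  qed
  show "T > 0 \<Longrightarrow> G integrable_on {0..T}" using h by blast
  have "((\<lambda>T. \<integral>x. indicator {..T} x *\<^sub>R (indicator {0<..} x *\<^sub>R G x) \<partial>lborel) \<longlongrightarrow> (\<integral>x. indicator {0<..} x *\<^sub>R G x \<partial>lborel)) at_top"
    by (rule tendsto_integral_at_top) (use s in \<open>auto simp: set_integrable_def\<close>)
  moreover have "(\<integral>x. indicator {..T} x *\<^sub>R (indicator {0<..} x *\<^sub>R G x) \<partial>lborel) = integral {0..T} G" for T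
    unfolding integral_unique[OF h] set_lebesgue_integral_def
    by (intro Bochner_Integration.integral_cong refl) (auto split: split_indicator)
  ultimately show "((\<lambda>T. integral {0..T} G) \<longlongrightarrow> integral\<^sup>L hl G) at_top"
    by (simp add: integral_hl_eq set_lebesgue_integral_def)
qed

lemma kl_f_eq:
  assumes "x > 0"
  shows "kl_f a x = (\<Sum>i. a (Suc i) * of_real (8 / pi\<^sup>2 * nichN (real (Suc i)) x))"
proof -
  have "(besselJ (\<i> * of_nat (Suc i) / 2) x)\<^sup>2 + (besselY (\<i> * of_nat (Suc i) / 2) x)\<^sup>2 = of_real (8 / pi\<^sup>2 * nichN (real (Suc i)) x)" for i
    using nicholson[of "real (Suc i)" x] assms by (simp only: of_real_of_nat_eq of_nat_0_less_iff zero_less_Suc)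
  then show ?thesis unfolding kl_f_def Let_def by simp
qed

theorem theorem1:
  fixes a :: "nat \<Rightarrow> complex" and n :: nat
  assumes "summable (\<lambda>m. norm (a (Suc m)))"
    and "n \<ge> 1"
  shows "\<exists>L. (\<forall>T>0. (\<lambda>x. kl_Phi n x * kl_f a x) integrable_on {0..T})
          \<and> ((\<lambda>T. integral {0..T} (\<lambda>x. kl_Phi n x * kl_f a x)) \<longlongrightarrow> L) at_top
          \<and> a n = of_real (sinh (pi * real n / 2)) * L"
proof -
  \<comment> \<open>Nicholson's factor 8/\<pi>^2 times the constant of \<open>abs_nichN_le\<close>:
    every function J^2 + Y^2 in the series is at most c / x in modulus.\<close>
  define c where "c = 8 / pi\<^sup>2 * (integral\<^sup>L hl K0 / 2)"
  define w where "w = (\<lambda>x. \<bar>phi n x\<bar> * (c / x))"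
  have w: "integrable hl w" unfolding w_def by (rule integrable_phi_over)
  define F where "F = (\<lambda>i x. a (Suc i) * of_real (8 / pi\<^sup>2 * (phi n x * nichN (real (Suc i)) x)))"
  define G where "G = (\<lambda>x. kl_Phi n x * kl_f a x)"
  have bound: "norm (F i x) \<le> norm (a (Suc i)) * w x" if x: "x > 0" for i x
  proof -
    have "\<bar>8 / pi\<^sup>2 * (phi n x * nichN (real (Suc i)) x)\<bar> = 8 / pi\<^sup>2 * (\<bar>phi n x\<bar> * \<bar>nichN (real (Suc i)) x\<bar>)"
      by (simp add: abs_mult)
    also have "\<dots> \<le> 8 / pi\<^sup>2 * (\<bar>phi n x\<bar> * (integral\<^sup>L hl K0 / (2 * x)))"
      using abs_nichN_le[OF x] by (intro mult_left_mono) auto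
    also have "\<dots> = w x" by (simp add: w_def c_def mult_ac)
    finally show ?thesis unfolding F_def norm_mult norm_of_real by (intro mult_left_mono) auto
  qed
  have iF: "integrable hl (F i)" for i
    unfolding F_def using phi_nichN_integrable_integral(1)[of "real (Suc i)" n]
    by (intro integrable_mult_right integrable_of_real) auto
  have sum_pt: "summable (\<lambda>i. norm (F i x))" if "x > 0" for x
    by (rule summable_comparison_test'[OF summable_mult2[OF assms(1), of "w x"]]) (use bound[OF that] in auto)
  \<comment> \<open>Summability of the L^1 norms is the hypothesis for integrating termwise; the
    same majorant \<open>w\<close> serves every index.\<close>
  have sum_int: "summable (\<lambda>i. \<integral>x. norm (F i x) \<partial>hl)"
  proof (rule summable_comparison_test'[OF summable_mult2[OF assms(1), of "integral\<^sup>L hl w"]])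
    fix i :: nat
    have "(\<integral>x. norm (F i x) \<partial>hl) \<le> (\<integral>x. norm (a (Suc i)) * w x \<partial>hl)"
      using w iF bound by (intro integral_mono integrable_norm integrable_mult_right) auto
    then show "norm (\<integral>x. norm (F i x) \<partial>hl) \<le> norm (a (Suc i)) * integral\<^sup>L hl w" by simp
  qed
  have G: "G x = (\<Sum>i. F i x)" if x: "x > 0" for x
  proof -
    have "F i x = of_real (phi n x) * (a (Suc i) * of_real (8 / pi\<^sup>2 * nichN (real (Suc i)) x))" for i
      by (simp add: F_def mult_ac)
    moreover have "summable (\<lambda>i. a (Suc i) * of_real (8 / pi\<^sup>2 * nichN (real (Suc i)) x))"
    proof (rule summable_norm_cancel, rule summable_comparison_test'[OF summable_mult2[OF assms(1), of "c / x"]])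
      fix i :: nat
      have "\<bar>8 / pi\<^sup>2 * nichN (real (Suc i)) x\<bar> \<le> c / x"
        using mult_left_mono[OF abs_nichN_le[OF x], of "8 / pi\<^sup>2" "real (Suc i)"] by (simp add: c_def abs_mult mult_ac)
      then have "norm (a (Suc i)) * \<bar>8 / pi\<^sup>2 * nichN (real (Suc i)) x\<bar> \<le> norm (a (Suc i)) * (c / x)"
        by (intro mult_left_mono) auto
      then show "norm (norm (a (Suc i) * of_real (8 / pi\<^sup>2 * nichN (real (Suc i)) x))) \<le> norm (a (Suc i)) * (c / x)"
        unfolding norm_mult norm_of_real by simp
    qed
    ultimately show ?thesis
      unfolding G_def kl_f_eq[OF x] kl_Phi_eq_phi[OF x] by (simp only: suminf_mult)
  qed
  have iS: "integrable hl (\<lambda>x. \<Sum>i. F i x)" and sumsS: "(\<lambda>i. integral\<^sup>L hl (F i)) sums (\<integral>x. (\<Sum>i. F i x) \<partial>hl)"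
    using sum_pt by (auto intro!: integrable_suminf sums_integral iF sum_int AE_I2)
  have iG: "integrable hl G"
    using iS by (rule Bochner_Integration.integrable_cong[THEN iffD1, OF refl, rotated]) (simp add: G)
  have GS: "integral\<^sup>L hl G = (\<integral>x. (\<Sum>i. F i x) \<partial>hl)"
    by (rule Bochner_Integration.integral_cong) (simp_all add: G)
  \<comment> \<open>The term with index \<open>i\<close> carries \<open>a (Suc i)\<close>, so the
    surviving one is i = n - 1, which is legitimate as n \<ge> 1.\<close>
  have vF: "integral\<^sup>L hl (F i) = (if i = n - 1 then a n * of_real (1 / sinh (pi * real n / 2)) else 0)" for i
  proof -
    have "integral\<^sup>L hl (F i) = a (Suc i) * of_real (8 / pi\<^sup>2 * (\<integral>x. phi n x * nichN (real (Suc i)) x \<partial>hl))"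
      unfolding F_def by (simp only: integral_mult_right_zero integral_of_real integral_complex_of_real)
    also have "\<dots> = (if i = n - 1 then a n * of_real (1 / sinh (pi * real n / 2)) else 0)"
    proof -
      have p: "(\<integral>x. phi n x * nichN (real (Suc i)) x \<partial>hl) = (if n = Suc i then pi\<^sup>2 / 8 / sinh (pi * real (Suc i) / 2) else 0)"
        by (rule phi_nichN_integral[OF assms(2)]) simp
      show ?thesis unfolding p using assms(2) by (cases n) auto
    qed
    finally show ?thesis .
  qed
  have "(\<lambda>i. integral\<^sup>L hl (F i)) sums (a n * of_real (1 / sinh (pi * real n / 2)))"
    unfolding vF by (rule sums_single)
  with sumsS have "integral\<^sup>L hl G = a n * of_real (1 / sinh (pi * real n / 2))"
    unfolding GS by (rule sums_unique2)
  moreover have "sinh (pi * real n / 2) \<noteq> 0" using assms(2) by simp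
  ultimately have "a n = of_real (sinh (pi * real n / 2)) * integral\<^sup>L hl G" by simp
  with integrable_hl_improper[OF iG] show ?thesis unfolding G_def by blast
qed

end
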